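(* For every integer $M>1$ there exists a positive constant $N$, depending only on $M$, such that the following holds. Let $\varepsilon\in\{+,-\}$, let $n\geqslant 2$ be an integer, let $q$ be a prime power, and let $G=\mathrm{PSL}_n^{\varepsilon}(q)$. If $|G|\geqslant N$, then the power word $\omega=x^M$ satisfies $$|\omega(G)|\geqslant \frac{\ln (n)}{2n\cdot M^2}\,|G|.$$
   Context: $\mathrm{PSL}_n^{+}(q)=\mathrm{PSL}_n(q)$ is the projective special linear group over the field $\mathbb{F}_q$, and $\mathrm{PSL}_n^{-}(q)=\mathrm{PSU}_n(q)$ is the projective special unitary group, whose matrices have entries in $\mathbb{F}_{q^2}$. For the word $\omega=x^M$ and a group $G$, $\omega(G)=\{g^M : g\in G\}$ is the image of the $M$-th power map. A power word is a word of the form $\upsilon^m$ with $m>1$. *)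

theory Defs
  imports
    Complex_Main
    "HOL-Algebra.Coset"
    "HOL-Algebra.Weak_Morphisms"
    "HOL-Combinatorics.Permutations"
    "HOL-Number_Theory.Prime_Powers"
    "Jordan_Normal_Form.Matrix"
begin

text \<open>
  The order of the ground field has to vary inside a statement, so fields are HOL-Algebra
  structures rather than types of class \<open>field\<close>. The arithmetic of \<open>'a mat\<close> in the library needs
  type classes on \<open>'a\<close>; it is restated here relative to an explicit ring structure.
\<close>

definition mats_over :: "('a, 'b) ring_scheme \<Rightarrow> nat \<Rightarrow> 'a mat set" where
  "mats_over R n = {A \<in> carrier_mat n n. elements_mat A \<subseteq> carrier R}"

definition mat_mult_over :: "('a, 'b) ring_scheme \<Rightarrow> nat \<Rightarrow> 'a mat \<Rightarrow> 'a mat \<Rightarrow> 'a mat" where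
  "mat_mult_over R n A B =
     mat n n (\<lambda>(i, j). \<Oplus>\<^bsub>R\<^esub>k\<in>{..<n}. A $$ (i, k) \<otimes>\<^bsub>R\<^esub> B $$ (k, j))"

definition mat_one_over :: "('a, 'b) ring_scheme \<Rightarrow> nat \<Rightarrow> 'a mat" where
  "mat_one_over R n = mat n n (\<lambda>(i, j). if i = j then \<one>\<^bsub>R\<^esub> else \<zero>\<^bsub>R\<^esub>)"

definition det_over :: "('a, 'b) ring_scheme \<Rightarrow> nat \<Rightarrow> 'a mat \<Rightarrow> 'a" where
  "det_over R n A =
     (\<Oplus>\<^bsub>R\<^esub>p\<in>{p. p permutes {..<n}}.
        (if evenperm p then \<one>\<^bsub>R\<^esub> else \<ominus>\<^bsub>R\<^esub> \<one>\<^bsub>R\<^esub>) \<otimes>\<^bsub>R\<^esub> (\<Otimes>\<^bsub>R\<^esub>i\<in>{..<n}. A $$ (i, p i)))"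

definition SL :: "nat \<Rightarrow> ('a, 'b) ring_scheme \<Rightarrow> 'a mat monoid" where
  "SL n F = \<lparr>carrier = {A \<in> mats_over F n. det_over F n A = \<one>\<^bsub>F\<^esub>},
             monoid.mult = mat_mult_over F n, one = mat_one_over F n\<rparr>"

text \<open>
  For \<open>SU n q F\<close> the field \<open>F\<close> has order \<open>q\<^sup>2\<close> and \<open>x \<mapsto> x\<^sup>q\<close> is its involutory automorphism.
  The group is taken with respect to the Hermitian form whose Gram matrix is the identity; all
  nondegenerate Hermitian forms of a given dimension over a finite field are equivalent.
\<close>

definition conj_transpose :: "nat \<Rightarrow> ('a, 'b) ring_scheme \<Rightarrow> 'a mat \<Rightarrow> 'a mat" where
  "conj_transpose q F A = transpose_mat (map_mat (\<lambda>x. x [^]\<^bsub>F\<^esub> q) A)"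

definition SU :: "nat \<Rightarrow> nat \<Rightarrow> ('a, 'b) ring_scheme \<Rightarrow> 'a mat monoid" where
  "SU n q F = (SL n F)\<lparr>carrier := {A \<in> carrier (SL n F).
      mat_mult_over F n A (conj_transpose q F A) = mat_one_over F n}\<rparr>"

definition group_center :: "('a, 'b) monoid_scheme \<Rightarrow> 'a set" where
  "group_center G = {z \<in> carrier G. \<forall>g\<in>carrier G. z \<otimes>\<^bsub>G\<^esub> g = g \<otimes>\<^bsub>G\<^esub> z}"

definition PSL :: "nat \<Rightarrow> ('a, 'b) ring_scheme \<Rightarrow> 'a mat set monoid" where
  "PSL n F = SL n F Mod group_center (SL n F)"

definition PSU :: "nat \<Rightarrow> nat \<Rightarrow> ('a, 'b) ring_scheme \<Rightarrow> 'a mat set monoid" where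
  "PSU n q F = SU n q F Mod group_center (SU n q F)"

datatype lin_type = Plus | Minus

fun PSL_eps :: "lin_type \<Rightarrow> nat \<Rightarrow> nat \<Rightarrow> ('a, 'b) ring_scheme \<Rightarrow> 'a mat set monoid" where
  "PSL_eps Plus n q F = PSL n F"
| "PSL_eps Minus n q F = PSU n q F"

fun entry_field_order :: "lin_type \<Rightarrow> nat \<Rightarrow> nat" where
  "entry_field_order Plus q = q"
| "entry_field_order Minus q = q\<^sup>2"

definition is_GF :: "nat \<Rightarrow> ('a, 'b) ring_scheme \<Rightarrow> bool" where
  "is_GF q F \<longleftrightarrow> field F \<and> card (carrier F) = q"

definition power_word_image :: "nat \<Rightarrow> ('a, 'b) monoid_scheme \<Rightarrow> 'a set" where
  "power_word_image M G = (\<lambda>g. g [^]\<^bsub>G\<^esub> M) ` carrier G"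

text \<open>
  Quantifying over all structures of type \<open>nat ring\<close> reaches every finite field up to isomorphism:
\<close>

lemma is_GF_nat_model:
  assumes "is_GF q (F :: ('a, 'b) ring_scheme)" and "q > 0"
  shows "\<exists>(K :: nat ring) f. is_GF q K \<and> f \<in> ring_iso F K"
proof -
  have F: "field F" and c: "card (carrier F) = q" using assms(1) by (auto simp: is_GF_def)
  have "finite (carrier F)" using c assms(2) by (simp add: card_ge_0_finite)
  then obtain f :: "'a \<Rightarrow> nat" where inj: "inj_on f (carrier F)"
    using finite_imp_inj_to_nat_seg by blast
  have "f \<in> ring_iso F (image_ring f F)" by (rule inj_imp_image_ring_iso[OF inj])
  moreover have "is_GF q (image_ring f F)"
    using field.inj_imp_image_ring_is_field[OF F inj] c
    by (simp add: is_GF_def image_ring_carrier card_image[OF inj])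
  ultimately show ?thesis by blast
qed

end

theory Submission
  imports Defs "HOL-Algebra.Algebraic_Closure_Type" "HOL-Number_Theory.Residues"
    "Jordan_Normal_Form.Char_Poly"
begin

text \<open>
  Embed the matrices into \<open>GL\<^sub>n(L)\<close> for an algebraically closed field \<open>L\<close>, and put \<open>e = q\<close> in the
  linear and \<open>e = -q\<close> in the unitary case. For \<open>k + m = n\<close> the group \<open>GL\<^sub>n(q)\<close>, respectively
  \<open>U\<^sub>n(q)\<close>, contains a torus \<open>T\<^sub>k \<times> T\<^sub>m\<close>, where \<open>T\<^sub>k\<close> consists of the solutions of
  \<open>x\<^bsup>e^k - 1\<^esup> = 1\<close>: the pair \<open>(a, b)\<close> acts with eigenvalues \<open>a, a\<^bsup>e\<^esup>, a\<^bsup>e^2\<^esup>, \<dots>\<close> and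
  \<open>b, b\<^bsup>e\<^esup>, \<dots>\<close>. Call \<open>g\<close> regular if it is conjugate to an element \<open>t\<close> of determinant 1 of such a
  torus and \<open>t\<^sup>M\<close> has \<open>n\<close> distinct eigenvalues. All \<open>M\<close>-th roots of \<open>g\<^sup>M\<close> then lie in one torus, so
  there are at most \<open>M\<^sup>2\<close> of them, and it suffices that the proportion of regular elements is at least
  \<open>ln n / (2 n)\<close>. The centralizer of a regular element is a torus of order \<open>|T\<^sub>k| |T\<^sub>m|\<close>, and a set of
  eigenvalues comes from at most \<open>2 k m\<close> triples \<open>(k, a, b)\<close>; hence the proportion is at least about
  \<open>\<Sum>\<^sub>k 1 / (2 k (n - k))\<close>, which is asymptotic to \<open>ln n / n\<close>. Irregular pairs \<open>(a, b)\<close> are negligible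
  if \<open>q\<close> is large or if \<open>k\<close> and \<open>m\<close> are both large.
\<close>

(* Otherwise the order of a group is shadowed by the multiplicity of a root of a polynomial. *)
hide_const (open) Polynomial.order

section \<open>Tori in the multiplicative group\<close>

text \<open>Why two orbits of eigenvalues: elements with a single orbit make up a proportion of only
  about 1/n. The logarithm comes from summing over all ways to split n into two parts, whereas c
  orbits would allow up to \<open>M^c\<close> roots; two orbits are exactly what the factor
  \<open>M\<^sup>2\<close> pays for. Two side conditions cost nothing. Restricting to determinant 1
  keeps one pair out of |T_1|, but the classes are formed under conjugation by GL_n(q) or U_n(q), at
  least |T_1| times as large as the special subgroup. Dividing by the centre Z enlarges the fibres
  of the power map at most by the factor |Z|, and the order of the group shrinks by the same factor.
  The constant N only serves to exclude that q and n are both bounded. If q >= 40 M, then for every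
  k at least half of the pairs are usable. If n >= (768 M)^3, the k far from 0 and n carry enough of
  the harmonic sum, even for q = 2. The split into equal halves is dropped in that case: the two
  orbits can then coincide after taking \<open>M\<close>-th powers, and the proportion of such pairs
  is only bounded by a multiple of M/q.\<close>

lemma card_power_eq_le:
  fixes c :: "'a::idom"
  assumes "m > 0"
  shows "finite {x. x ^ m = c}" "card {x. x ^ m = c} \<le> m"
proof -
  let ?p = "monom 1 m + [:-c:]"
  have "degree ?p = m"
    using assms by (subst degree_add_eq_left) (auto simp: degree_monom_eq)
  moreover from this have "?p \<noteq> 0" using assms by auto
  moreover have "{x. x ^ m = c} = {x. poly ?p x = 0}" by (simp add: poly_monom)
  ultimately show "finite {x. x ^ m = c}" "card {x. x ^ m = c} \<le> m"
    using poly_roots_finite[of ?p] card_poly_roots_bound[of ?p] by auto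
qed

text \<open>The polynomial X^m - 1 is separable: a double root would be a root of the derivative m
  X^(m-1), hence 0, and 0 is not an m-th root of unity.\<close>

lemma card_roots_of_unity_alg_closed:
  assumes m: "(of_nat m :: 'a::alg_closed_field) \<noteq> 0"
  shows "card {x::'a. x ^ m = 1} = m"
proof -
  have m0: "m > 0" using m by (cases m) auto
  define p :: "'a poly" where "p = monom 1 m + [:-1:]"
  have deg: "degree p = m"
    using m0 unfolding p_def by (subst degree_add_eq_left) (auto simp: degree_monom_eq)
  then have p0: "p \<noteq> 0" using m0 by auto
  obtain A where A: "size A = m" "p = smult (lead_coeff p) (\<Prod>x\<in>#A. [:-x, 1:])"
    using alg_closed_imp_factorization[OF p0] deg by auto
  have roots: "{x. poly p x = 0} = set_mset A"
    using p0 by (subst A(2)) (auto simp: poly_prod_mset)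
  have "count A x \<le> 1" for x
  proof (rule ccontr)
    assume "\<not> count A x \<le> 1"
    then have "replicate_mset 2 x \<subseteq># A"
      by (simp add: subseteq_mset_def count_replicate_mset)
    then obtain B where "A = {#x, x#} + B"
      by (metis mset_subset_eq_exists_conv numeral_2_eq_2 replicate_mset_0 replicate_mset_Suc)
    then have "p = [:-x, 1:] * ([:-x, 1:] * smult (lead_coeff p) (\<Prod>x\<in>#B. [:-x, 1:]))"
      using A(2) by (simp add: mult_ac)
    then obtain r where r: "p = [:-x, 1:] * ([:-x, 1:] * r)" by blast
    have "poly (pderiv p) x = 0" unfolding r by (simp only: pderiv_mult poly_add poly_mult) simp
    then have "of_nat m * x ^ (m - 1) = 0"
      by (simp add: p_def pderiv_add pderiv_monom poly_monom)
    then have "x = 0" using m by auto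
    moreover have "poly p x = 0" by (simp add: r)
    ultimately show False using m0 by (simp add: p_def poly_monom power_0_left)
  qed
  then have "A = mset_set (set_mset A)"
    by (intro multiset_eqI) (metis count_greater_eq_one_iff count_mset_set(1,3) finite_set_mset le_antisym not_in_iff)
  then have "card (set_mset A) = m" using A(1) by (metis size_mset_set)
  then show ?thesis using roots by (simp add: p_def poly_monom)
qed

lemma powi_eq_cases:
  fixes x c :: "'a::field"
  shows "x powi s = c \<longleftrightarrow> x ^ nat \<bar>s\<bar> = (if s \<ge> 0 then c else inverse c)"
  by (auto simp: power_int_def power_inverse)

lemma card_powi_eq_le:
  fixes c :: "'a::field"
  assumes "s \<noteq> 0"
  shows "finite {x. x powi s = c}" "card {x. x powi s = c} \<le> nat \<bar>s\<bar>"
  using card_power_eq_le[of "nat \<bar>s\<bar>" "if s \<ge> 0 then c else inverse c"] assms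
  by (simp_all add: powi_eq_cases)

lemma card_powi_eq_1:
  assumes "(of_int s :: 'a::alg_closed_field) \<noteq> 0"
  shows "card {x::'a. x powi s = 1} = nat \<bar>s\<bar>"
proof -
  have "(of_nat (nat \<bar>s\<bar>) :: 'a) \<noteq> 0"
    using assms by (cases "s \<ge> 0") auto
  from card_roots_of_unity_alg_closed[OF this] show ?thesis
    by (cases "s \<ge> 0") (simp_all add: powi_eq_cases)
qed

text \<open>The twist \<open>x \<mapsto> x\<^sup>e\<close> with \<open>e = q\<close> governs the linear and \<open>e = -q\<close> the unitary groups.\<close>

locale signed_frobenius =
  fixes q :: nat and e :: int and ty :: "'l::alg_closed_field itself"
  assumes q2: "q \<ge> 2"
    and e_cases: "e = int q \<or> e = - int q"
    and q_zero: "(of_nat q :: 'l) = 0"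
    and add_power_q: "\<And>x y :: 'l. (x + y) ^ q = x ^ q + y ^ q"
begin

definition \<Phi> :: "'l \<Rightarrow> 'l" where "\<Phi> x = x powi e"

definition torus :: "nat \<Rightarrow> 'l set" where "torus k = {x. x \<noteq> 0 \<and> (\<Phi> ^^ k) x = x}"

text \<open>This is the order of T_k: q^k - 1 in the linear and q^k - (-1)^k in the unitary
  case.\<close>

definition tau :: "nat \<Rightarrow> nat" where "tau k = nat \<bar>e ^ k - 1\<bar>"

text \<open>The contribution of one orbit to the determinant; for e = q and x in T_k it is the norm
  from the field of order q^k to the field of order q.\<close>

definition nrm :: "nat \<Rightarrow> 'l \<Rightarrow> 'l" where "nrm k x = (\<Prod>i<k. (\<Phi> ^^ i) x)"

lemma e_nonzero: "e \<noteq> 0"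
  using e_cases q2 by auto

lemma e_pow_not_1: "k > 0 \<Longrightarrow> e ^ k \<noteq> 1"
proof
  assume k: "k > 0" "e ^ k = 1"
  have "1 < \<bar>e\<bar> ^ k" using e_cases q2 k(1) by (intro one_less_power) auto
  then show False using k(2) by (metis abs_1 less_irrefl power_abs)
qed

lemma tau_pos: "k > 0 \<Longrightarrow> tau k > 0"
  using e_pow_not_1 by (simp add: tau_def)

lemma abs_e_pow: "\<bar>e ^ k\<bar> = int q ^ k"
  using e_cases by (auto simp: power_abs)

lemma tau_bounds: "tau k \<le> q ^ k + 1" "q ^ k \<le> tau k + 1"
proof -
  have "\<bar>e ^ k - 1\<bar> \<le> int q ^ k + 1" "int q ^ k \<le> \<bar>e ^ k - 1\<bar> + 1"
    using abs_e_pow[of k] by linarith+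
  then show "tau k \<le> q ^ k + 1" "q ^ k \<le> tau k + 1"
    by (simp_all add: tau_def nat_le_iff le_nat_iff flip: of_nat_power)
qed

lemma \<Phi>_0 [simp]: "\<Phi> 0 = 0" and \<Phi>_1 [simp]: "\<Phi> 1 = 1"
  using e_nonzero by (auto simp: \<Phi>_def)

lemma \<Phi>_eq_0_iff [simp]: "\<Phi> x = 0 \<longleftrightarrow> x = 0"
  using e_nonzero by (auto simp: \<Phi>_def)

lemma \<Phi>_mult: "\<Phi> (x * y) = \<Phi> x * \<Phi> y"
  by (simp add: \<Phi>_def power_int_mult_distrib)

lemma \<Phi>_inverse: "\<Phi> (inverse x) = inverse (\<Phi> x)"
  by (simp add: \<Phi>_def power_int_inverse)

lemma \<Phi>_prod: "\<Phi> (prod f A) = (\<Prod>i\<in>A. \<Phi> (f i))"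
  by (induction A rule: infinite_finite_induct) (auto simp: \<Phi>_mult)

lemma funpow_\<Phi>: "(\<Phi> ^^ k) x = x powi (e ^ k)"
  by (induction k) (simp_all add: \<Phi>_def power_int_mult[symmetric] mult.commute)

lemma funpow_\<Phi>_mult: "(\<Phi> ^^ k) (x * y) = (\<Phi> ^^ k) x * (\<Phi> ^^ k) y"
  by (simp add: funpow_\<Phi> power_int_mult_distrib)

lemma funpow_\<Phi>_power: "(\<Phi> ^^ k) (x ^ m) = (\<Phi> ^^ k) x ^ m"
  by (simp add: funpow_\<Phi> power_int_power power_int_power' mult.commute)

lemma funpow_\<Phi>_eq_0_iff [simp]: "(\<Phi> ^^ k) x = 0 \<longleftrightarrow> x = 0"
  using e_nonzero by (auto simp: funpow_\<Phi>)

lemma diff_power_q: "(x - y :: 'l) ^ q = x ^ q - y ^ q"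
  using add_power_q[of "x - y" y] by simp

lemma inj_power_q: "x ^ q = y ^ q \<Longrightarrow> x = (y::'l)"
  using diff_power_q[of x y] q2 by simp

lemma inj_\<Phi>: "inj \<Phi>"
proof (rule injI)
  fix x y assume xy: "\<Phi> x = \<Phi> y"
  show "x = y"
    using e_cases
  proof
    assume "e = int q" then show ?thesis using xy unfolding \<Phi>_def by (simp add: inj_power_q)
  next
    assume "e = - int q" then show ?thesis using xy unfolding \<Phi>_def by (simp add: power_int_minus inj_power_q)
  qed
qed

lemma inj_funpow_\<Phi>: "(\<Phi> ^^ k) x = (\<Phi> ^^ k) y \<longleftrightarrow> x = y"
  using inj_fn[OF inj_\<Phi>, of k] by (auto dest: injD)

lemma torus_altdef: "torus k = {x. x powi (e ^ k - 1) = 1}" if "k > 0"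
proof -
  have "x \<noteq> 0 \<and> x powi (e ^ k) = x \<longleftrightarrow> x powi (e ^ k - 1) = 1" for x :: 'l
    using e_pow_not_1[OF that] by (cases "x = 0") (auto simp: power_int_diff)
  then show ?thesis by (simp add: torus_def funpow_\<Phi>)
qed

lemma of_int_e_pow: "k > 0 \<Longrightarrow> (of_int (e ^ k) :: 'l) = 0"
  using e_cases q_zero by (auto simp: power_0_left)

lemma card_torus: "k > 0 \<Longrightarrow> card (torus k) = tau k"
  unfolding torus_altdef tau_def using of_int_e_pow[of k] by (intro card_powi_eq_1) (simp add: power_0_left)

lemma finite_torus: "k > 0 \<Longrightarrow> finite (torus k)"
  using card_torus tau_pos card_ge_0_finite by metis

lemma torus_nonzero: "x \<in> torus k \<Longrightarrow> x \<noteq> 0"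
  by (simp add: torus_def)

lemma torus_power: "x \<in> torus k \<Longrightarrow> x ^ m \<in> torus k"
  by (simp add: torus_def funpow_\<Phi>_power)

lemma torus_funpow_\<Phi>_iff: "(\<Phi> ^^ i) x \<in> torus k \<longleftrightarrow> x \<in> torus k"
proof -
  have "(\<Phi> ^^ k) ((\<Phi> ^^ i) x) = (\<Phi> ^^ i) ((\<Phi> ^^ k) x)"
    by (simp add: funpow_add[THEN fun_cong, unfolded comp_def, symmetric] add.commute)
  then show ?thesis by (simp add: torus_def inj_funpow_\<Phi>)
qed

lemma torus_funpow_\<Phi>: "x \<in> torus k \<Longrightarrow> (\<Phi> ^^ i) x \<in> torus k"
  by (simp add: torus_funpow_\<Phi>_iff)

lemma torus_diff:
  assumes "x \<in> torus k" "x \<in> torus d" "d \<le> k"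
  shows "x \<in> torus (k - d)"
proof -
  have "(\<Phi> ^^ k) x = (\<Phi> ^^ (k - d)) ((\<Phi> ^^ d) x)"
    using assms(3) by (metis comp_apply funpow_add le_add_diff_inverse2)
  then show ?thesis using assms by (simp add: torus_def)
qed

section \<open>Norm maps of the tori\<close>

lemma nrm_power: "nrm k (x ^ m) = nrm k x ^ m"
  by (simp add: nrm_def funpow_\<Phi>_power prod_power_distrib)

lemma nrm_\<Phi>:
  assumes "x \<in> torus k"
  shows "nrm k (\<Phi> x) = nrm k x"
proof (cases k)
  case (Suc j)
  have "nrm k (\<Phi> x) = (\<Prod>i<Suc j. (\<Phi> ^^ Suc i) x)"
    by (simp add: nrm_def Suc funpow_swap1)
  also have "\<dots> = (\<Prod>i<j. (\<Phi> ^^ Suc i) x) * x"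
    using assms by (simp add: torus_def Suc)
  also have "\<dots> = nrm k x"
    unfolding nrm_def Suc prod.lessThan_Suc_shift by simp
  finally show ?thesis .
qed (simp add: nrm_def)

lemma nrm_funpow_\<Phi>: "x \<in> torus k \<Longrightarrow> nrm k ((\<Phi> ^^ i) x) = nrm k x"
  by (induction i) (simp_all add: nrm_\<Phi> torus_funpow_\<Phi>)

lemma nrm_in_torus: "x \<in> torus k \<Longrightarrow> nrm k x \<in> torus 1"
  using nrm_\<Phi>[of x k] unfolding torus_def
  by (simp add: nrm_def \<Phi>_prod funpow_swap1)

lemma nrm_powi:
  assumes "x \<noteq> 0"
  shows "nrm k x = x powi (\<Sum>i<k. e ^ i)"
  using assms by (induction k) (simp_all add: nrm_def funpow_\<Phi> power_int_add)

text \<open>On nonzero elements the norm is the power with exponent (e^k - 1)/(e - 1); the absolute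
  value of this exponent is the order of the kernel of the norm on T_k.\<close>

definition ker_card :: "nat \<Rightarrow> nat" where "ker_card k = nat \<bar>\<Sum>i<k. e ^ i\<bar>"

lemma tau_eq: "tau k = tau 1 * ker_card k"
proof -
  have "e ^ k - 1 = (e - 1) * (\<Sum>i<k. e ^ i)"
    by (rule power_diff_1_eq)
  then show ?thesis by (simp add: tau_def ker_card_def abs_mult nat_mult_distrib)
qed

text \<open>A power of the norm is again a power map with nonzero exponent. The case m = 1 bounds
  the fibres of the norm, the case m = 2M the pairs whose two orbits meet after \<open>M\<close>-th
  powers.\<close>

lemma nrm_fibre_le:
  assumes "k > 0" "m > 0"
  shows "finite {x \<in> torus k. nrm k x ^ m = c}" "card {x \<in> torus k. nrm k x ^ m = c} \<le> m * ker_card k"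
proof -
  let ?s = "(\<Sum>i<k. e ^ i) * int m"
  have s: "?s \<noteq> 0"
    using tau_pos[OF assms(1)] tau_eq[of k] assms(2) by (auto simp: ker_card_def)
  have sub: "{x \<in> torus k. nrm k x ^ m = c} \<subseteq> {x. x powi ?s = c}"
    by (auto simp: torus_def nrm_powi power_int_power')
  show "finite {x \<in> torus k. nrm k x ^ m = c}"
    by (rule finite_subset[OF sub card_powi_eq_le(1)[OF s]])
  have "card {x \<in> torus k. nrm k x ^ m = c} \<le> nat \<bar>?s\<bar>"
    using card_mono[OF card_powi_eq_le(1)[OF s] sub] card_powi_eq_le(2)[OF s, of c] by linarith
  then show "card {x \<in> torus k. nrm k x ^ m = c} \<le> m * ker_card k"
    by (simp add: ker_card_def abs_mult nat_mult_distrib mult.commute)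
qed

text \<open>Counting replaces Hilbert 90: T_k has |T_1| times \<open>ker_card k\<close> elements,
  spread over |T_1| fibres of size at most \<open>ker_card k\<close>, so every fibre is
  full.\<close>

lemma card_nrm_fibre:
  assumes k: "k > 0" and c: "c \<in> torus 1"
  shows "card {x \<in> torus k. nrm k x = c} = ker_card k"
proof (rule antisym)
  note le = nrm_fibre_le[OF k, of 1, simplified]
  show "card {x \<in> torus k. nrm k x = c} \<le> ker_card k" by (rule le)
  have "tau k = card (\<Union>c\<in>torus 1. {x \<in> torus k. nrm k x = c})"
    using card_torus[OF k] nrm_in_torus by (intro arg_cong[of _ _ card] trans[OF sym[OF card_torus[OF k]]]) auto
  also have "\<dots> = (\<Sum>c\<in>torus 1. card {x \<in> torus k. nrm k x = c})"
    using finite_torus[of 1] le by (intro card_UN_disjoint) auto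
  also have "\<dots> = card {x \<in> torus k. nrm k x = c} + (\<Sum>c\<in>torus 1 - {c}. card {x \<in> torus k. nrm k x = c})"
    using c finite_torus[of 1] by (intro sum.remove) auto
  also have "\<dots> \<le> card {x \<in> torus k. nrm k x = c} + card (torus 1 - {c}) * ker_card k"
    using sum_bounded_above[of "torus 1 - {c}" "\<lambda>c. card {x \<in> torus k. nrm k x = c}" "ker_card k"] le
    by simp
  also have "card (torus 1 - {c}) = tau 1 - 1"
    using c card_torus[of 1] finite_torus[of 1] by simp
  finally have "tau 1 * ker_card k \<le> card {x \<in> torus k. nrm k x = c} + (tau 1 - 1) * ker_card k"
    by (simp add: tau_eq[of k])
  moreover have "tau 1 * ker_card k = (tau 1 - 1) * ker_card k + ker_card k"
    using tau_pos[of 1] by (cases "tau 1") auto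
  ultimately show "ker_card k \<le> card {x \<in> torus k. nrm k x = c}" by linarith
qed

end

section \<open>Pairs with distinct eigenvalues\<close>

lemma card_power_vimage_le:
  fixes T :: "'a::idom set"
  assumes "M > 0" "finite T"
  shows "finite {a. a ^ M \<in> T}" "card {a. a ^ M \<in> T} \<le> M * card T"
proof -
  have eq: "{a. a ^ M \<in> T} = (\<Union>c\<in>T. {a. a ^ M = c})" by auto
  show "finite {a. a ^ M \<in> T}" unfolding eq using assms card_power_eq_le by blast
  have "card (\<Union>c\<in>T. {a. a ^ M = c}) \<le> (\<Sum>c\<in>T. card {a. a ^ M = c})"
    by (rule card_UN_le[OF assms(2)])
  also have "\<dots> \<le> (\<Sum>c\<in>T. M)" using card_power_eq_le[OF assms(1)] by (intro sum_mono) auto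
  finally show "card {a. a ^ M \<in> T} \<le> M * card T" by (simp add: eq mult.commute)
qed

lemma card_Sigma_le:
  assumes "finite A" "\<And>a. a \<in> A \<Longrightarrow> card (B a) \<le> c"
  shows "card (Sigma A B) \<le> card A * c"
proof (cases "\<forall>a\<in>A. finite (B a)")
  case True
  then have "card (Sigma A B) = (\<Sum>a\<in>A. card (B a))"
    using assms(1) by (intro card_SigmaI) auto
  then show ?thesis using sum_bounded_above[of A "\<lambda>a. card (B a)" c] assms by simp
next
  case False
  then obtain a where a: "a \<in> A" "infinite (B a)" by blast
  \<comment> \<open>One infinite fibre makes the whole set infinite, and its \<open>card\<close> is
    then 0 by convention.\<close>
  have "infinite (Sigma A B)"
  proof
    assume "finite (Sigma A B)"
    moreover have "B a \<subseteq> snd ` Sigma A B" using a by force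
    ultimately show False using a finite_subset by blast
  qed
  then show ?thesis by simp
qed

context signed_frobenius
begin

definition eigs :: "nat \<Rightarrow> 'l \<Rightarrow> 'l \<Rightarrow> nat \<Rightarrow> 'l" where
  "eigs k a b i = (if i < k then (\<Phi> ^^ i) a else (\<Phi> ^^ (i - k)) b)"

definition good :: "nat \<Rightarrow> nat \<Rightarrow> nat \<Rightarrow> ('l \<times> 'l) set" where
  "good M k m = {(a, b). a \<in> torus k \<and> b \<in> torus m \<and> nrm k a * nrm m b = 1 \<and>
     inj_on (eigs k (a ^ M) (b ^ M)) {..<k + m}}"

text \<open>
  If \<open>a\<^sup>M\<close> has period less than \<open>k\<close> under \<open>\<Phi>\<close>, then it has one of size at most \<open>k/2\<close>, since \<open>d\<close> and
  \<open>k - d\<close> are periods at the same time.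
\<close>

definition short :: "nat \<Rightarrow> nat \<Rightarrow> 'l set" where
  "short M k = {a \<in> torus k. \<exists>d\<in>{1..k div 2}. a ^ M \<in> torus d}"

lemma card_short_le:
  assumes "M > 0"
  shows "finite (short M k)" "card (short M k) \<le> (\<Sum>d=1..k div 2. M * tau d)"
proof -
  have sub: "short M k \<subseteq> (\<Union>d\<in>{1..k div 2}. {a. a ^ M \<in> torus d})"
    by (auto simp: short_def)
  have fin: "finite (\<Union>d\<in>{1..k div 2}. {a::'l. a ^ M \<in> torus d})"
    using card_power_vimage_le(1)[OF assms finite_torus] by simp
  show "finite (short M k)" using sub fin by (rule finite_subset)
  have "card (short M k) \<le> card (\<Union>d\<in>{1..k div 2}. {a::'l. a ^ M \<in> torus d})"
    using fin sub by (rule card_mono)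
  also have "\<dots> \<le> (\<Sum>d=1..k div 2. card {a::'l. a ^ M \<in> torus d})"
    by (rule card_UN_le) simp
  also have "\<dots> \<le> (\<Sum>d=1..k div 2. M * tau d)"
  proof (rule sum_mono)
    fix d assume "d \<in> {1..k div 2}"
    then show "card {a::'l. a ^ M \<in> torus d} \<le> M * tau d"
      using card_power_vimage_le(2)[OF assms finite_torus, of d] card_torus[of d] by simp
  qed
  finally show "card (short M k) \<le> (\<Sum>d=1..k div 2. M * tau d)" .
qed

lemma shortI:
  assumes "a \<in> torus k" "a ^ M \<in> torus d" "0 < d" "d < k"
  shows "a \<in> short M k"
proof (cases "d \<le> k div 2")
  case True
  then show ?thesis using assms by (auto simp: short_def)
next
  case False
  have "a ^ M \<in> torus (k - d)" using assms torus_power by (intro torus_diff) auto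
  moreover have "k - d \<in> {1..k div 2}" using False assms(4) by auto
  ultimately show ?thesis using assms(1) by (auto simp: short_def)
qed

lemma shortI_collision:
  assumes "a \<in> torus k" "(\<Phi> ^^ i) (a ^ M) = (\<Phi> ^^ j) (a ^ M)" "i < j" "j < k"
  shows "a \<in> short M k"
proof -
  have "(\<Phi> ^^ j) (a ^ M) = (\<Phi> ^^ i) ((\<Phi> ^^ (j - i)) (a ^ M))"
    using assms(3) by (metis comp_apply funpow_add le_add_diff_inverse less_imp_le)
  then have "(\<Phi> ^^ (j - i)) (a ^ M) = a ^ M"
    using assms(2) inj_funpow_\<Phi>[of i] by metis
  then have "a ^ M \<in> torus (j - i)"
    using assms(1) by (simp add: torus_def)
  then show ?thesis using assms by (intro shortI[of a k M "j - i"]) auto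
qed

text \<open>There are \<open>tau k * ker_card m\<close> pairs with norm product 1. A pair that is
  not good has a collision inside the first orbit (\<open>E1\<close>), inside the second one
  (\<open>E2\<close>), or between the two (\<open>E3\<close>); the last kind without the others
  needs k = m.\<close>

lemma card_good_ge:
  assumes k: "k > 0" and m: "m > 0" and M: "M > 0"
  shows "tau k * ker_card m \<le> card (good M k m) +
     (\<Sum>d=1..k div 2. M * tau d) * ker_card m + (\<Sum>d=1..m div 2. M * tau d) * ker_card k +
     (if k = m then 2 * M * ker_card k * ker_card k else 0)"
proof -
  define P where "P = (SIGMA a : torus k. {b \<in> torus m. nrm m b = inverse (nrm k a)})"
  have nz: "nrm k a \<noteq> 0" if "a \<in> torus k" for a k
    using nrm_in_torus[OF that] torus_nonzero by blast
  have P_alt: "P = {(a, b). a \<in> torus k \<and> b \<in> torus m \<and> nrm k a * nrm m b = 1}"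
    using nz by (auto simp: P_def field_simps)
  have inv: "inverse c \<in> torus 1" if "c \<in> torus 1" for c
    using that by (simp add: torus_def \<Phi>_inverse)
  have card_P: "card P = tau k * ker_card m"
    unfolding P_def using finite_torus[OF k] finite_torus[OF m] card_nrm_fibre[OF m] inv nrm_in_torus card_torus[OF k]
    by (subst card_SigmaI) auto
  have fin_P: "finite P"
    unfolding P_def using finite_torus[OF k] finite_torus[OF m] by auto
  define E1 where "E1 = (SIGMA a : short M k. {b \<in> torus m. nrm m b = inverse (nrm k a)})"
  define E2 where "E2 = (SIGMA b : short M m. {a \<in> torus k. nrm k a = inverse (nrm m b)})"
  define E3 where "E3 = (if k = m then (SIGMA a : {a \<in> torus k. nrm k a ^ (2 * M) = 1}.
      {b \<in> torus m. nrm m b = inverse (nrm k a)}) else {})"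
  have fin_short: "finite (short M k)" for k by (rule card_short_le[OF M])
  have fib: "card {b \<in> torus m. nrm m b = c} \<le> ker_card m" if "m > 0" for m c
    using nrm_fibre_le(2)[OF that, of 1 c] by simp
  have E1: "finite E1" "card E1 \<le> (\<Sum>d=1..k div 2. M * tau d) * ker_card m"
  proof -
    show "finite E1" unfolding E1_def using finite_torus[OF m] fin_short by auto
    show "card E1 \<le> (\<Sum>d=1..k div 2. M * tau d) * ker_card m"
      unfolding E1_def
      by (rule order.trans[OF card_Sigma_le[OF fin_short fib[OF m]] mult_right_mono[OF card_short_le(2)[OF M]]]) simp
  qed
  have E2: "finite E2" "card E2 \<le> (\<Sum>d=1..m div 2. M * tau d) * ker_card k"
  proof -
    show "finite E2" unfolding E2_def using finite_torus[OF k] fin_short by auto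
    show "card E2 \<le> (\<Sum>d=1..m div 2. M * tau d) * ker_card k"
      unfolding E2_def
      by (rule order.trans[OF card_Sigma_le[OF fin_short fib[OF k]] mult_right_mono[OF card_short_le(2)[OF M]]]) simp
  qed
  have "finite E3 \<and> card E3 \<le> (if k = m then 2 * M * ker_card k * ker_card k else 0)"
  proof (cases "k = m")
    case True
    have f: "finite {a \<in> torus k. nrm k a ^ (2 * M) = 1}" "card {a \<in> torus k. nrm k a ^ (2 * M) = 1} \<le> 2 * M * ker_card k"
      using nrm_fibre_le[OF k, of "2 * M" 1] M by auto
    show ?thesis
    proof
      show "finite E3" unfolding E3_def using f(1) finite_torus[OF m] True by auto
      have "card E3 \<le> 2 * M * ker_card k * ker_card m"
        unfolding E3_def if_P[OF True]
        by (rule order.trans[OF card_Sigma_le[OF f(1) fib[OF m]] mult_right_mono[OF f(2)]]) simp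
      then show "card E3 \<le> (if k = m then 2 * M * ker_card k * ker_card k else 0)"
        using True by simp
    qed
  qed (simp add: E3_def)
  then have E3: "finite E3" "card E3 \<le> (if k = m then 2 * M * ker_card k * ker_card k else 0)" by auto
  have sub: "P \<subseteq> good M k m \<union> E1 \<union> prod.swap ` E2 \<union> E3"
  proof
    fix p assume p: "p \<in> P"
    obtain a b where ab: "p = (a, b)" by (cases p)
    have a: "a \<in> torus k" and b: "b \<in> torus m" and N: "nrm k a * nrm m b = 1"
      using p ab P_alt by auto
    have N': "nrm m b = inverse (nrm k a)" "nrm k a = inverse (nrm m b)"
      using N by (metis inverse_unique mult.commute)+
    show "p \<in> good M k m \<union> E1 \<union> prod.swap ` E2 \<union> E3"
    proof (cases "a \<in> short M k \<or> b \<in> short M m")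
      case True
      moreover have "p = prod.swap (b, a)" by (simp add: ab)
      ultimately show ?thesis using a b N' ab by (auto simp: E1_def E2_def)
    next
      case False
      show ?thesis
      proof (cases "inj_on (eigs k (a ^ M) (b ^ M)) {..<k + m}")
        case True
        then show ?thesis using a b N ab by (auto simp: good_def)
      next
        case False': False
        then obtain i j where ij: "i < j" "j < k + m"
          "eigs k (a ^ M) (b ^ M) i = eigs k (a ^ M) (b ^ M) j"
          unfolding inj_on_def by (metis lessThan_iff linorder_neqE_nat)
        have "i < k \<and> k \<le> j"
        proof (rule ccontr)
          assume "\<not> (i < k \<and> k \<le> j)"
          then consider "j < k" | "k \<le> i" using ij(1) by linarith
          then show False
          proof cases
            case 1
            then show False using ij shortI_collision[OF a, of i M j] False by (simp add: eigs_def)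
          next
            case 2
            then show False using ij shortI_collision[OF b, of "i - k" M "j - k"] False by (simp add: eigs_def)
          qed
        qed
        then have eq: "(\<Phi> ^^ i) (a ^ M) = (\<Phi> ^^ (j - k)) (b ^ M)"
          using ij by (simp add: eigs_def)
        have aM: "a ^ M \<in> torus m"
          using eq torus_funpow_\<Phi>_iff[of i "a ^ M" m] torus_funpow_\<Phi>_iff[of "j - k" "b ^ M" m] torus_power[OF b] by simp
        have bM: "b ^ M \<in> torus k"
          using eq torus_funpow_\<Phi>_iff[of i "a ^ M" k] torus_funpow_\<Phi>_iff[of "j - k" "b ^ M" k] torus_power[OF a] by simp
        \<comment> \<open>Meeting orbits have the same periods, so for different lengths the longer
          orbit would be short.\<close>
        have km: "k = m"
          using shortI[OF a aM] shortI[OF b bM] False k m by (metis linorder_neqE_nat)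
        \<comment> \<open>The norm is constant on orbits, so a and b have norms with equal
          \<open>M\<close>-th powers. These norms are inverse to each other, hence their 2M-th
          powers are 1.\<close>
        have "nrm k (a ^ M) = nrm k (b ^ M)"
          using nrm_funpow_\<Phi>[of "a ^ M" k i] nrm_funpow_\<Phi>[of "b ^ M" k "j - k"] eq a b km torus_power by metis
        then have "nrm k a ^ M = nrm k b ^ M" by (simp add: nrm_power)
        moreover have "nrm k a ^ M * nrm k b ^ M = 1"
          using N km by (metis power_mult_distrib power_one)
        ultimately have "nrm k a ^ (2 * M) = 1"
          by (simp add: mult_2 power_add)
        then show ?thesis using a b N' ab km by (auto simp: E3_def)
      qed
    qed
  qed
  have "finite (good M k m)"
    by (rule finite_subset[OF _ fin_P]) (auto simp: good_def P_alt)
  then have "card P \<le> card (good M k m \<union> E1 \<union> prod.swap ` E2 \<union> E3)"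
    using E1 E2 E3 by (intro card_mono[OF _ sub]) auto
  also have "\<dots> \<le> card (good M k m) + card E1 + card (prod.swap ` E2) + card E3"
    using card_Un_le[of "good M k m \<union> E1 \<union> prod.swap ` E2" E3] card_Un_le[of "good M k m \<union> E1" "prod.swap ` E2"]
      card_Un_le[of "good M k m" E1] by linarith
  also have "card (prod.swap ` E2) \<le> card E2" by (rule card_image_le) (rule E2)
  finally show ?thesis using card_P E1 E2 E3 by linarith
qed

end

section \<open>Hermitian forms\<close>

text \<open>A kernel vector of the transpose is the coefficient vector of a nonzero polynomial of
  degree less than n with the n roots \<open>d i\<close>.\<close>

lemma det_vandermonde_nonzero:
  fixes d :: "nat \<Rightarrow> 'a::field"
  assumes inj: "inj_on d {..<n}"
  shows "det (mat n n (\<lambda>(i, j). d j ^ i)) \<noteq> 0"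
proof
  let ?V = "mat n n (\<lambda>(i, j). d j ^ i)"
  assume "det ?V = 0"
  then have "det (transpose_mat ?V) = 0" by (subst det_transpose[of _ n]) auto
  then obtain v where v: "v \<in> carrier_vec n" "v \<noteq> 0\<^sub>v n" "transpose_mat ?V *\<^sub>v v = 0\<^sub>v n"
    using det_0_iff_vec_prod_zero[of "transpose_mat ?V" n] by auto
  define p where "p = (\<Sum>j<n. monom (v $ j) j)"
  have coeff: "coeff p i = (if i < n then v $ i else 0)" for i
    by (auto simp: p_def coeff_sum sum.delta)
  have root: "poly p (d i) = 0" if "i < n" for i
  proof -
    have "poly p (d i) = (transpose_mat ?V *\<^sub>v v) $ i"
      using v(1) that by (auto simp: p_def poly_sum poly_monom scalar_prod_def lessThan_atLeast0 intro!: sum.cong)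
    then show ?thesis using v(3) that by simp
  qed
  have "p = 0"
  proof (rule ccontr)
    assume p: "p \<noteq> 0"
    then have "degree p < n"
      using coeff by (metis leading_coeff_0_iff)
    moreover have "n \<le> card {x. poly p x = 0}"
      using card_mono[OF poly_roots_finite[OF p], of "d ` {..<n}"] root card_image[OF inj] by auto
    ultimately show False using card_poly_roots_bound[OF p] by linarith
  qed
  then have "v $ i = 0" if "i < n" for i using coeff[of i] that by simp
  then show False using v(1,2) by auto
qed

lemma obtain_mat_inverse:
  fixes A :: "'a::field mat"
  assumes A: "A \<in> carrier_mat n n" and d: "det A \<noteq> 0"
  obtains B where "B \<in> carrier_mat n n" "A * B = 1\<^sub>m n" "B * A = 1\<^sub>m n"
proof -
  have "A \<in> Units (ring_mat TYPE('a) n ())" using det_non_zero_imp_unit[OF A d] .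
  then show ?thesis using that unfolding Units_def by (auto simp: ring_mat_def)
qed

lemma det_nonzero_if_right_inverse:
  fixes A :: "'a::field mat"
  assumes "A \<in> carrier_mat n n" "B \<in> carrier_mat n n" "A * B = 1\<^sub>m n"
  shows "det A \<noteq> 0"
  using det_mult[OF assms(1,2)] assms(3) by auto

section \<open>Conjugate transposes, and traces and norms of the field of order q^2 inside L\<close>

context signed_frobenius
begin

sublocale frob: comm_ring_hom "\<lambda>x::'l. x ^ q"
  using q2 by unfold_locales (auto simp: add_power_q power_mult_distrib)

abbreviation frob :: "'l mat \<Rightarrow> 'l mat" where "frob A \<equiv> map_mat (\<lambda>x. x ^ q) A"

text \<open>On matrices over L this is not an involution, only on those with entries in the field of
  order q^2.\<close>

abbreviation star :: "'l mat \<Rightarrow> 'l mat" where "star A \<equiv> transpose_mat (frob A)"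

lemma star_mult:
  assumes "A \<in> carrier_mat n n" "B \<in> carrier_mat n n"
  shows "star (A * B) = star B * star A"
  using assms frob.mat_hom_mult[OF assms] by (simp add: transpose_mult[of _ n n _ n])

lemma star_carrier [simp]: "A \<in> carrier_mat n n \<Longrightarrow> star A \<in> carrier_mat n n"
  by simp

lemma star_one [simp]: "star (1\<^sub>m n) = 1\<^sub>m n"
  by (simp add: frob.mat_hom_one)

lemma star_add:
  assumes "A \<in> carrier_mat n n" "B \<in> carrier_mat n n"
  shows "star (A + B) = star A + star B"
  using assms by (intro eq_matI) (auto simp: add_power_q)

lemma star_minus:
  assumes "A \<in> carrier_mat n n" "B \<in> carrier_mat n n"
  shows "star (A - B) = star A - star B"
  using assms by (intro eq_matI) (auto simp: diff_power_q)

lemma det_star: "A \<in> carrier_mat n n \<Longrightarrow> det (star A) = det A ^ q"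
  by (subst det_transpose[of _ n]) auto

text \<open>Otherwise all q^2 - 1 nonzero elements of the field of order q^2 would satisfy z^(q-1) =
  -1, which has at most q - 1 solutions.\<close>

lemma ex_trace_nonzero: "\<exists>z::'l. z ^ (q * q) = z \<and> z + z ^ q \<noteq> 0"
proof (rule ccontr)
  assume none: "\<nexists>z::'l. z ^ (q * q) = z \<and> z + z ^ q \<noteq> 0"
  let ?K = "{z::'l. z ^ (q * q - 1) = 1}"
  have qq: "q * q - 1 \<ge> q" using mult_le_mono1[OF q2, of q] q2 by linarith
  have "(of_nat (q * q - 1) :: 'l) = of_nat (q * q) - 1" using qq q2 by (simp add: of_nat_diff)
  then have "(of_nat (q * q - 1) :: 'l) \<noteq> 0" by (simp add: q_zero)
  then have "card ?K = q * q - 1" by (rule card_roots_of_unity_alg_closed)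
  moreover have "?K \<subseteq> {z. z ^ (q - 1) = - 1}"
  proof
    fix z assume z: "z \<in> ?K"
    have "q * q - 1 > 0" using qq q2 by linarith
    then have z0: "z \<noteq> 0" using z by (auto simp: zero_power simp del: power_0_left)
    have "z ^ (q * q) = z ^ (q * q - 1) * z" using qq q2 by (metis One_nat_def Suc_diff_1 gr_zeroI mult.commute not_numeral_le_zero mult_is_0 power_Suc)
    then have "z + z ^ q = 0" using z none by auto
    moreover have "z ^ q = z ^ (q - 1) * z" using q2 by (metis power_minus_mult zero_less_numeral less_le_trans)
    ultimately have "(z ^ (q - 1) + 1) * z = 0" by (simp add: algebra_simps)
    then show "z \<in> {z. z ^ (q - 1) = - 1}" using z0 by (simp add: eq_neg_iff_add_eq_0)
  qed
  ultimately have "q * q - 1 \<le> q - 1"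
    using card_power_eq_le[of "q - 1" "- 1 :: 'l"] card_mono[of "{z::'l. z ^ (q - 1) = - 1}" ?K] q2 by fastforce
  then show False using qq q2 by linarith
qed

text \<open>Take c in L as a (q+1)-th root of 1/s. As s is fixed by the q-th power map, c^(q^2-1) =
  1, so c already lies in the field of order q^2.\<close>

lemma ex_norm_scaling:
  assumes "s ^ q = s" "s \<noteq> (0::'l)"
  shows "\<exists>c. c ^ (q * q) = c \<and> c * c ^ q * s = 1"
proof -
  obtain c where c: "c ^ Suc q = inverse s" using nth_root_exists[of "Suc q" "inverse s"] by auto
  have c0: "c \<noteq> 0" using c assms(2) by auto
  have "(c ^ Suc q) ^ q = c ^ Suc q" using assms(1) by (simp only: c power_inverse)
  then have "c ^ (q * q) * c ^ q = c * c ^ q"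
    by (simp add: power_mult_distrib power_mult mult.commute)
  then have "c ^ (q * q) = c" using c0 by simp
  moreover have "c * c ^ q * s = 1" using c assms(2) by (simp add: field_simps)
  ultimately show ?thesis by blast
qed

definition unit_mat_at :: "nat \<Rightarrow> nat \<Rightarrow> 'l mat" where
  "unit_mat_at n j = mat n n (\<lambda>(i, i'). if i = j \<and> i' = j then 1 else 0)"

text \<open>A nonzero Hermitian form has a nonzero value s at some vector e_a + t e_b. The value is
  fixed by the q-th power map, so a scalar c normalizes it to 1. The resulting vector u becomes row
  j of U.\<close>

lemma hermitian_represents_one:
  assumes W: "W \<in> carrier_mat n n" and herm: "star W = W" and nz: "W \<noteq> 0\<^sub>m n n" and j: "j < n"
  shows "\<exists>U\<in>carrier_mat n n. star (star U) = U \<and> U * W * star U = unit_mat_at n j \<and> unit_mat_at n j * U = U"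
proof -
  have h: "W $$ (b, a) = W $$ (a, b) ^ q" if "a < n" "b < n" for a b
    using arg_cong[OF herm, of "\<lambda>A. A $$ (b, a)"] that W by simp
  have "\<exists>a b t s. a < n \<and> b < n \<and> t ^ (q * q) = t \<and> s ^ q = s \<and> s \<noteq> 0 \<and>
     s = W $$ (a, a) + t * W $$ (b, a) + (t ^ q * W $$ (a, b) + t * t ^ q * W $$ (b, b))"
  proof (cases "\<exists>a<n. W $$ (a, a) \<noteq> 0")
    case True
    then obtain a where "a < n" "W $$ (a, a) \<noteq> 0" by blast
    then show ?thesis
      using h[of a a] q2 by (intro exI[of _ a] exI[of _ a] exI[of _ 0] exI[of _ "W $$ (a, a)"]) auto
  next
    case False
    obtain b a where ab: "a < n" "b < n" "W $$ (b, a) \<noteq> 0"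
      using nz W by (metis carrier_matD(1) carrier_matD(2) eq_matI index_zero_mat(1) index_zero_mat(2) index_zero_mat(3))
    \<comment> \<open>With zero diagonal, the value at e_a + t e_b is the trace of t times
      \<open>W $$ (b, a)\<close>; the quotient of z by this entry makes it the nonzero trace of
      z.\<close>
    obtain z :: 'l where z: "z ^ (q * q) = z" "z + z ^ q \<noteq> 0" using ex_trace_nonzero by blast
    let ?w = "W $$ (b, a)"
    have w: "?w ^ (q * q) = ?w" using h[of a b] h[of b a] ab by (simp add: power_mult)
    have t: "(z / ?w) ^ (q * q) = z / ?w" using z w by (simp add: power_divide)
    have "W $$ (a, b) = ?w ^ q" using h[of b a] ab by simp
    then have "(z / ?w) ^ q * W $$ (a, b) = z ^ q" using ab by (simp add: power_divide)
    moreover have "(z + z ^ q) ^ q = z + z ^ q"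
      using z by (simp add: add_power_q power_mult[symmetric] add.commute)
    ultimately show ?thesis
      using ab z False t by (intro exI[of _ a] exI[of _ b] exI[of _ "z / ?w"] exI[of _ "z + z ^ q"]) auto
  qed
  then obtain a b t s where ab: "a < n" "b < n" and t: "t ^ (q * q) = t" and s: "s ^ q = s" "s \<noteq> 0"
    and s_eq: "s = W $$ (a, a) + t * W $$ (b, a) + (t ^ q * W $$ (a, b) + t * t ^ q * W $$ (b, b))"
    by blast
  obtain c where c: "c ^ (q * q) = c" "c * c ^ q * s = 1" using ex_norm_scaling[OF s] by blast
  define u where "u l = c * (if l = a then 1 else 0) + c * t * (if l = b then 1 else 0)" for l
  define U where "U = mat n n (\<lambda>(i, l). if i = j then u l else 0)"
  have U: "U \<in> carrier_mat n n" by (simp add: U_def)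
  have uq: "u l ^ q = c ^ q * (if l = a then 1 else 0) + c ^ q * t ^ q * (if l = b then 1 else 0)" for l
    using q2 by (simp add: u_def add_power_q power_mult_distrib)
  have "(u l ^ q) ^ q = u l" for l
    using q2 c t by (simp add: uq add_power_q power_mult_distrib power_mult[symmetric] u_def power_0_left)
  then have "star (star U) = U"
    using q2 by (intro eq_matI) (auto simp: U_def)
  moreover have UW: "(U * W) $$ (i, l) = (if i = j then c * (W $$ (a, l) + t * W $$ (b, l)) else 0)"
    if "i < n" "l < n" for i l
    using that W ab
    by (auto simp: U_def u_def scalar_prod_def distrib_right distrib_left sum.distrib mult.assoc
        if_distrib[of "\<lambda>x. x * _"] if_distrib[of "\<lambda>x. _ * x"] sum.delta cong: if_cong)
  have "U * W * star U = unit_mat_at n j"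
  proof (rule eq_matI)
    fix i i' assume "i < dim_row (unit_mat_at n j)" "i' < dim_col (unit_mat_at n j)"
    then have i: "i < n" "i' < n" by (auto simp: unit_mat_at_def)
    have "(U * W * star U) $$ (i, i') = (\<Sum>l<n. (U * W) $$ (i, l) * U $$ (i', l) ^ q)"
      using i W U by (simp add: scalar_prod_def lessThan_atLeast0 del: assoc_mult_mat)
    also have "\<dots> = (\<Sum>l<n. if i = j \<and> i' = j then c * (W $$ (a, l) + t * W $$ (b, l)) * u l ^ q else 0)"
    proof (rule sum.cong)
      fix l assume "l \<in> {..<n}"
      then have "U $$ (i', l) = (if i' = j then u l else 0)" "l < n" using i by (auto simp: U_def)
      then show "(U * W) $$ (i, l) * U $$ (i', l) ^ q =
          (if i = j \<and> i' = j then c * (W $$ (a, l) + t * W $$ (b, l)) * u l ^ q else 0)"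
        using i q2 UW[of i l] by (auto simp del: index_mult_mat)
    qed simp
    also have "\<dots> = (if i = j \<and> i' = j then c * c ^ q * s else 0)"
      using ab by (auto simp: uq s_eq distrib_left sum.distrib if_distrib[of "\<lambda>x. _ * x"] sum.delta cong: if_cong)
        (simp add: algebra_simps)
    finally show "(U * W * star U) $$ (i, i') = unit_mat_at n j $$ (i, i')"
      using i c by (simp add: unit_mat_at_def)
  qed (auto simp: U_def unit_mat_at_def)
  moreover have "unit_mat_at n j * U = U"
    using j by (intro eq_matI)
      (auto simp: U_def unit_mat_at_def scalar_prod_def if_distrib[of "\<lambda>x. x * _"] sum.delta cong: if_cong)
  ultimately show ?thesis using U by blast
qed

section \<open>Orthonormalization of Hermitian forms\<close>

definition proj_mat :: "nat \<Rightarrow> nat \<Rightarrow> 'l mat" where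
  "proj_mat n j = mat n n (\<lambda>(i, i'). if i = i' \<and> i < j then 1 else 0)"

text \<open>
  A Gram-Schmidt step in matrix form: the rows of \<open>R\<close> with index less than \<open>j\<close> are orthonormal for \<open>H\<close>
  and the others vanish. The condition that \<open>star\<close> is involutive on \<open>R\<close> says that the entries lie in the
  field of order \<open>q\<^sup>2\<close>.
\<close>

lemma orthonormal_step:
  assumes H: "H \<in> carrier_mat n n" and herm: "star H = H" and det: "det H \<noteq> 0" and j: "j < n"
    and R: "R \<in> carrier_mat n n" "star (star R) = R"
    and XH: "R * H * star R = proj_mat n j" and EX: "proj_mat n j * R = R"
  shows "\<exists>R'\<in>carrier_mat n n. star (star R') = R' \<and> R' * H * star R' = proj_mat n (Suc j) \<and>
    proj_mat n (Suc j) * R' = R'"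
proof -
  note [simp] = H R(1) mult_carrier_mat[of _ n n _ n] minus_carrier_mat[where nr = n and nc = n]
  note alg = right_mult_one_mat[of _ n n] left_mult_one_mat[of _ n n] mult_minus_distrib_mat[of _ n n _ n] minus_mult_distrib_mat[of _ n n _ _ n]
    mult_add_distrib_mat[of _ n n _ n] add_mult_distrib_mat[of _ n n _ _ n] assoc_mult_mat[of _ n n _ n _ n]
  have E [simp]: "proj_mat n i \<in> carrier_mat n n" "unit_mat_at n i \<in> carrier_mat n n" for i
    by (simp_all add: proj_mat_def unit_mat_at_def)
  have XH': "R * (H * (star R * B)) = proj_mat n j * B" if "B \<in> carrier_mat n n" for B
    using XH[symmetric] that by (simp add: assoc_mult_mat[of _ n n _ n _ n])
  have minus_zero: "A - 0\<^sub>m n n = A" if "A \<in> carrier_mat n n" for A :: "'l mat"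
    using that by (intro eq_matI) auto
  \<comment> \<open>Multiplying a row vector by Y subtracts its components along the rows of R, so Y
    maps into their orthogonal complement with respect to H.\<close>
  define Y where "Y = 1\<^sub>m n - H * (star R * R)"
  have Y [simp]: "Y \<in> carrier_mat n n" by (simp add: Y_def)
  have sY: "star Y = 1\<^sub>m n - star R * (R * H)"
    unfolding Y_def by (simp add: star_minus[of _ n] star_mult[of _ n] herm R(2) alg)
  have ssY: "star (star Y) = Y"
    unfolding sY Y_def by (simp add: star_minus[of _ n] star_mult[of _ n] herm R(2) alg)
  have XHY: "R * (H * star Y) = 0\<^sub>m n n"
  proof -
    have "proj_mat n j * (R * H) = R * H"
      using assoc_mult_mat[of "proj_mat n j" n n R n H n] EX by simp
    then have "R * (H * star Y) = R * H - R * H" unfolding sY by (simp add: alg XH')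
    also have "\<dots> = 0\<^sub>m n n" by (rule minus_r_inv_mat) simp
    finally show ?thesis .
  qed
  have YHX: "Y * (H * star R) = 0\<^sub>m n n"
  proof -
    have "star (R * (H * star Y)) = Y * (H * star R)"
      by (simp add: star_mult[of _ n] herm ssY alg)
    moreover have "star (0\<^sub>m n n) = 0\<^sub>m n n" using q2 by (intro eq_matI) auto
    ultimately show ?thesis using XHY by simp
  qed
  \<comment> \<open>W is the Gram matrix of the projected vectors; a vector of value 1 for W
    projects to a vector of value 1 for H orthogonal to the rows of R.\<close>
  define W where "W = Y * (H * star Y)"
  have W [simp]: "W \<in> carrier_mat n n" by (simp add: W_def)
  have "star W = W" unfolding W_def by (simp add: star_mult[of _ n] herm ssY alg)
  have W_eq: "W = H * star Y"
  proof -
    have "W = H * star Y - H * (star R * (R * (H * star Y)))"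
      unfolding W_def Y_def[symmetric] by (subst Y_def) (simp add: alg)
    also have "\<dots> = H * star Y" unfolding XHY by (simp add: right_mult_zero_mat[of _ n n] minus_zero)
    finally show ?thesis .
  qed
  \<comment> \<open>If W = H Y^* vanished, invertibility of H would give Y = 0, and then R would be
    invertible. But R has rank at most j, as it is fixed by a projection of determinant 0.\<close>
  have "W \<noteq> 0\<^sub>m n n"
  proof
    assume W0: "W = 0\<^sub>m n n"
    obtain Hi where Hi: "Hi \<in> carrier_mat n n" "Hi * H = 1\<^sub>m n"
      using obtain_mat_inverse[OF H det] by metis
    have "star Y = Hi * (H * star Y)"
      using Hi assoc_mult_mat[of Hi n n H n "star Y" n] left_mult_one_mat[of "star Y" n n] by simp
    also have "\<dots> = 0\<^sub>m n n" using W0 W_eq Hi by simp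
    finally have z: "1\<^sub>m n - star R * (R * H) = 0\<^sub>m n n" by (simp add: sY)
    have eq_one: "A = 1\<^sub>m n" if "A \<in> carrier_mat n n" "1\<^sub>m n - A = 0\<^sub>m n n" for A :: "'l mat"
    proof (rule eq_matI)
      fix i j assume "i < dim_row (1\<^sub>m n :: 'l mat)" "j < dim_col (1\<^sub>m n :: 'l mat)"
      then show "A $$ (i, j) = 1\<^sub>m n $$ (i, j)"
        using arg_cong[OF that(2), of "\<lambda>A. A $$ (i, j)"] that(1) by simp
    qed (use that in auto)
    have "star R * (R * H) = 1\<^sub>m n" by (rule eq_one[OF _ z]) simp
    then have "det (star R) \<noteq> 0"
      by (intro det_nonzero_if_right_inverse[of _ n "R * H"]) auto
    then have "det R \<noteq> 0" using q2 by (simp add: det_star[of _ n])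
    moreover have "det R = det (proj_mat n j) * det R"
      using det_mult[of "proj_mat n j" n R] EX by simp
    moreover have "det (proj_mat n j) = 0"
    proof -
      have "det (proj_mat n j) = prod_list (diag_mat (proj_mat n j))"
        by (rule det_upper_triangular[of _ n]) (auto simp: proj_mat_def)
      moreover have "0 \<in> set (diag_mat (proj_mat n j))"
        using j by (auto simp: diag_mat_def proj_mat_def image_iff intro!: bexI[of _ j])
      ultimately show ?thesis by (simp add: prod_list_zero_iff)
    qed
    ultimately show False by simp
  qed
  then obtain U where U: "U \<in> carrier_mat n n" "star (star U) = U" "U * W * star U = unit_mat_at n j"
      "unit_mat_at n j * U = U"
    using hermitian_represents_one[OF W \<open>star W = W\<close> _ j] by blast
  note [simp] = U(1)
  \<comment> \<open>U has only row j, so this puts one new orthonormal vector into the row that was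
    zero in R.\<close>
  define R' where "R' = R + U * Y"
  have R' [simp]: "R' \<in> carrier_mat n n" by (simp add: R'_def)
  have sR': "star R' = star R + star Y * star U"
    unfolding R'_def by (simp add: star_add[of _ n] star_mult[of _ n])
  have "star (star R') = R'"
    unfolding sR' by (simp add: star_add[of _ n] star_mult[of _ n] R ssY U R'_def)
  moreover have "R' * H * star R' = proj_mat n (Suc j)"
  proof -
    have "R' * H * star R' = R * H * star R + (U * (Y * (H * star R)) +
        (R * (H * star Y) * star U + U * (Y * (H * star Y)) * star U))"
      unfolding sR' unfolding R'_def by (simp add: alg assoc_add_mat[of _ n n])
    also have "\<dots> = proj_mat n j + unit_mat_at n j"
      unfolding XH XHY YHX W_def[symmetric] U(3)
      by (simp add: right_mult_zero_mat[of _ n n] left_mult_zero_mat[of _ n n] left_add_zero_mat[of _ n n])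
    also have "\<dots> = proj_mat n (Suc j)"
      by (intro eq_matI) (auto simp: proj_mat_def unit_mat_at_def)
    finally show ?thesis .
  qed
  moreover have "proj_mat n (Suc j) * R' = R'"
  proof -
    have 1: "proj_mat n (Suc j) * proj_mat n j = proj_mat n j"
      by (intro eq_matI) (auto simp: proj_mat_def scalar_prod_def if_distrib[of "\<lambda>x. x * _"] cong: if_cong
        intro!: sum.neutral)
    have 2: "proj_mat n (Suc j) * unit_mat_at n j = unit_mat_at n j"
      by (intro eq_matI) (auto simp: proj_mat_def unit_mat_at_def scalar_prod_def if_distrib[of "\<lambda>x. x * _"] cong: if_cong
        intro!: sum.neutral)
    have "proj_mat n (Suc j) * R = R"
      using assoc_mult_mat[of "proj_mat n (Suc j)" n n "proj_mat n j" n R n] 1 EX by simp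
    moreover have "proj_mat n (Suc j) * U = U"
      using assoc_mult_mat[of "proj_mat n (Suc j)" n n "unit_mat_at n j" n U n] 2 U by simp
    moreover from this have "proj_mat n (Suc j) * (U * Y) = U * Y"
      using assoc_mult_mat[of "proj_mat n (Suc j)" n n U n Y n] by simp
    ultimately show ?thesis unfolding R'_def by (simp add: alg)
  qed
  ultimately show ?thesis by (intro bexI[of _ R']) auto
qed

lemma hermitian_congruent_one:
  assumes H: "H \<in> carrier_mat n n" and herm: "star H = H" and det: "det H \<noteq> 0"
  shows "\<exists>R\<in>carrier_mat n n. R * H * star R = 1\<^sub>m n"
proof -
  have "\<exists>R\<in>carrier_mat n n. star (star R) = R \<and> R * H * star R = proj_mat n j \<and> proj_mat n j * R = R"
    if "j \<le> n" for j
    using that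
  proof (induction j)
    case 0
    have "proj_mat n 0 = 0\<^sub>m n n" by (intro eq_matI) (auto simp: proj_mat_def)
    moreover have "star (0\<^sub>m n n) = 0\<^sub>m n n" using q2 by (intro eq_matI) auto
    ultimately show ?case using H by (intro bexI[of _ "0\<^sub>m n n"]) auto
  next
    case (Suc j)
    then obtain R where "R \<in> carrier_mat n n" "star (star R) = R"
      "R * H * star R = proj_mat n j" "proj_mat n j * R = R" by auto
    then show ?case using orthonormal_step[OF H herm det _] Suc.prems by simp
  qed
  from this[of n] obtain R where R: "R \<in> carrier_mat n n" "R * H * star R = proj_mat n n" by auto
  have "proj_mat n n = 1\<^sub>m n" by (intro eq_matI) (auto simp: proj_mat_def)
  then show ?thesis using R by auto
qed

end

section \<open>Isometry groups and their tori\<close>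

context signed_frobenius
begin

definition isometries :: "nat \<Rightarrow> 'l mat set" where
  "isometries n = {A \<in> carrier_mat n n. det A \<noteq> 0 \<and> (if e > 0 then frob A = A else A * star A = 1\<^sub>m n)}"

definition special_isometries :: "nat \<Rightarrow> 'l mat set" where
  "special_isometries n = {A \<in> isometries n. det A = 1}"

lemma isometries_carrier: "A \<in> isometries n \<Longrightarrow> A \<in> carrier_mat n n"
  by (simp add: isometries_def)

lemma isometries_mult:
  assumes "A \<in> isometries n" "B \<in> isometries n"
  shows "A * B \<in> isometries n"
proof -
  have AB [simp]: "A \<in> carrier_mat n n" "B \<in> carrier_mat n n" using assms by (auto simp: isometries_def)
  have "A * B * star (A * B) = A * (B * star B) * star A"
    by (simp add: star_mult[of _ n] assoc_mult_mat[of _ n n _ n _ n] mult_carrier_mat[of _ n n _ n])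
  then show ?thesis
    using assms frob.mat_hom_mult[of A n n B n]
    by (auto simp: isometries_def det_mult[of _ n] mult_carrier_mat[of _ n n _ n] right_mult_one_mat[of A n n])
qed

lemma isometries_inverse:
  assumes "A \<in> isometries n"
  obtains B where "B \<in> isometries n" "A * B = 1\<^sub>m n" "B * A = 1\<^sub>m n"
proof -
  have A: "A \<in> carrier_mat n n" "det A \<noteq> 0" using assms by (auto simp: isometries_def)
  obtain B where B: "B \<in> carrier_mat n n" "A * B = 1\<^sub>m n" "B * A = 1\<^sub>m n"
    using obtain_mat_inverse[OF A] .
  have dB: "det B \<noteq> 0" using det_nonzero_if_right_inverse[OF B(1) A(1) B(3)] .
  have unique: "C = B" if C: "C \<in> carrier_mat n n" "A * C = 1\<^sub>m n" for C
  proof -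
    have "C = B * A * C" by (simp only: B(3) left_mult_one_mat[OF C(1)])
    also have "\<dots> = B" by (simp only: assoc_mult_mat[OF B(1) A(1) C(1)] C(2) right_mult_one_mat[OF B(1)])
    finally show ?thesis .
  qed
  have "B \<in> isometries n"
  proof (cases "e > 0")
    case True
    then have "A * frob B = frob (A * B)"
      using assms frob.mat_hom_mult[OF A(1) B(1)] by (simp add: isometries_def)
    also have "\<dots> = 1\<^sub>m n" by (simp add: B frob.mat_hom_one)
    finally have "frob B = B" using B by (intro unique) auto
    then show ?thesis using True B dB by (simp add: isometries_def)
  next
    case False
    then have AA: "A * star A = 1\<^sub>m n" using assms by (simp add: isometries_def)
    then have "star A = B" using A by (intro unique) auto
    moreover have "star (A * B) = 1\<^sub>m n" by (simp add: B)
    ultimately have "star B * B = 1\<^sub>m n" using star_mult[OF A(1) B(1)] by simp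
    then have "B * star B = 1\<^sub>m n" using B by (intro mat_mult_left_right_inverse[of "star B" n B]) auto
    then show ?thesis using False B dB by (simp add: isometries_def)
  qed
  then show ?thesis using that B by blast
qed

section \<open>Eigenvalue sequences along a permutation with two cycles\<close>

lemma e_pos_\<Phi>: "e > 0 \<Longrightarrow> \<Phi> x = x ^ q"
  unfolding \<Phi>_def using e_cases by auto

lemma e_neg_\<Phi>: "\<not> e > 0 \<Longrightarrow> \<Phi> x = inverse (x ^ q)"
  unfolding \<Phi>_def using e_cases q2 by (auto simp: power_int_minus)

text \<open>The permutation of Weyl type (k, m): one cycle on the first k indices and one on the
  remaining m.\<close>

definition cyc :: "nat \<Rightarrow> nat \<Rightarrow> nat \<Rightarrow> nat" where
  "cyc k m j = (if j < k then (if Suc j = k then 0 else Suc j) else (if Suc j = k + m then k else Suc j))"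

definition cycle_mat :: "nat \<Rightarrow> nat \<Rightarrow> 'l mat" where
  "cycle_mat k m = mat (k + m) (k + m) (\<lambda>(i, j). if i = cyc k m j then 1 else 0)"

lemma cycle_mat_carrier [simp]: "cycle_mat k m \<in> carrier_mat (k + m) (k + m)"
  by (simp add: cycle_mat_def)

lemma cyc_less: "j < k + m \<Longrightarrow> cyc k m j < k + m"
  by (auto simp: cyc_def)

lemma eigs_cyc:
  assumes "a \<in> torus k" "b \<in> torus m" "j < k + m"
  shows "eigs k a b (cyc k m j) = \<Phi> (eigs k a b j)"
proof -
  have ab: "(\<Phi> ^^ k) a = a" "(\<Phi> ^^ m) b = b" using assms by (auto simp: torus_def)
  consider "Suc j = k" | "Suc j < k" | "k \<le> j" "Suc (j - k) = m" | "k \<le> j" "Suc (j - k) < m"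
    using assms(3) by linarith
  then show ?thesis
  proof cases
    case 1
    then show ?thesis using ab(1) by (auto simp: eigs_def cyc_def)
  next
    case 3
    then show ?thesis using ab(2) by (auto simp: eigs_def cyc_def)
  qed (auto simp: eigs_def cyc_def Suc_diff_le)
qed

text \<open>Converse of \<open>eigs_cyc\<close>: each step along a cycle applies
  \<open>\<Phi>\<close>, and going round once returns to the start, so \<open>d 0\<close> and
  \<open>d k\<close> are fixed by the k-th and m-th iterate.\<close>

lemma eigs_from_cyc:
  assumes k: "k > 0" and m: "m > 0"
    and d: "\<And>j. j < k + m \<Longrightarrow> d (cyc k m j) = \<Phi> (d j)" "\<And>j. j < k + m \<Longrightarrow> d j \<noteq> 0"
  shows "d 0 \<in> torus k" "d k \<in> torus m" "\<And>i. i < k + m \<Longrightarrow> d i = eigs k (d 0) (d k) i"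
proof -
  have 1: "d i = (\<Phi> ^^ i) (d 0)" if "i < k" for i
    using that
  proof (induction i)
    case (Suc i)
    then show ?case using d(1)[of i] by (simp add: cyc_def)
  qed simp
  have 2: "d (k + i) = (\<Phi> ^^ i) (d k)" if "i < m" for i
    using that
  proof (induction i)
    case (Suc i)
    then show ?case using d(1)[of "k + i"] by (simp add: cyc_def)
  qed simp
  show "d i = eigs k (d 0) (d k) i" if "i < k + m" for i
    using 1[of i] 2[of "i - k"] that by (auto simp: eigs_def)
  have "\<Phi> (d (k - 1)) = d 0" using d(1)[of "k - 1"] k by (simp add: cyc_def)
  moreover have "\<Phi> ((\<Phi> ^^ (k - 1)) (d 0)) = (\<Phi> ^^ k) (d 0)" using k by (metis Suc_diff_1 comp_apply funpow.simps(2))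
  ultimately show "d 0 \<in> torus k" using d(2)[of 0] 1[of "k - 1"] k by (simp add: torus_def)
  have "\<Phi> (d (k + (m - 1))) = d k" using d(1)[of "k + (m - 1)"] m by (cases m) (simp_all add: cyc_def)
  moreover have "\<Phi> ((\<Phi> ^^ (m - 1)) (d k)) = (\<Phi> ^^ m) (d k)" using m by (metis Suc_diff_1 comp_apply funpow.simps(2))
  ultimately show "d k \<in> torus m" using d(2)[of k] 2[of "m - 1"] m by (simp add: torus_def)
qed

lemma bij_cyc: "bij_betw (cyc k m) {..<k + m} {..<k + m}"
proof -
  have "inj_on (cyc k m) {..<k + m}" by (rule inj_onI) (auto simp: cyc_def split: if_splits)
  moreover have "cyc k m ` {..<k + m} \<subseteq> {..<k + m}" using cyc_less by auto
  ultimately show ?thesis by (simp add: bij_betw_def endo_inj_surj)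
qed

lemma eigs_nonzero: "a \<in> torus k \<Longrightarrow> b \<in> torus m \<Longrightarrow> eigs k a b i \<noteq> 0"
  by (simp add: eigs_def torus_def)

text \<open>
  This instance of Lang's theorem has an explicit solution for \<open>e > 0\<close>, a Vandermonde matrix \<open>V\<close>. For
  \<open>e < 0\<close> the matrix \<open>V P V\<^sup>*\<close> with \<open>P\<close> the permutation matrix is Hermitian, and \<open>V\<close> is multiplied by
  a matrix that transforms this form into the standard one.
\<close>

lemma ex_lang:
  assumes a: "a \<in> torus k" and b: "b \<in> torus m" and inj: "inj_on (eigs k a b) {..<k + m}"
  shows "\<exists>x\<in>carrier_mat (k + m) (k + m). det x \<noteq> 0 \<and>
     (if e > 0 then frob x = x * cycle_mat k m else x * cycle_mat k m * star x = 1\<^sub>m (k + m))"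
proof -
  define n where "n = k + m"
  define d where "d = eigs k a b"
  define V where "V f = mat n n (\<lambda>(i, j). f j ^ i)" for f :: "nat \<Rightarrow> 'l"
  let ?P = "cycle_mat k m"
  have V [simp]: "V f \<in> carrier_mat n n" for f by (simp add: V_def)
  have P [simp]: "?P \<in> carrier_mat n n" by (simp add: n_def)
  have d_cyc: "d (cyc k m j) = \<Phi> (d j)" "d j \<noteq> 0" if "j < n" for j
    using eigs_cyc[OF a b] eigs_nonzero[OF a b] that by (auto simp: d_def n_def)
  \<comment> \<open>The permutation matrix moves the column of the node \<open>d (cyc k m j)\<close>
    to position j, and this node is \<open>\<Phi> (d j)\<close>.\<close>
  have VP: "V d * ?P = V (\<lambda>j. \<Phi> (d j))"
    using cyc_less d_cyc by (intro eq_matI) (auto simp: V_def cycle_mat_def n_def scalar_prod_def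
       if_distrib[of "\<lambda>x. _ * x"] sum.delta cong: if_cong)
  have detV: "det (V d) \<noteq> 0"
    unfolding V_def by (rule det_vandermonde_nonzero) (use inj in \<open>simp add: d_def n_def\<close>)
  show ?thesis
  proof (cases "e > 0")
    case True
    have "frob (V d) = V d * ?P"
      unfolding VP by (intro eq_matI) (auto simp: V_def e_pos_\<Phi>[OF True] power_mult[symmetric] mult.commute)
    then show ?thesis using True detV unfolding n_def[symmetric] by (intro bexI[of _ "V d"]) auto
  next
    case False
    define H where "H = V d * ?P * star (V d)"
    have H [simp]: "H \<in> carrier_mat n n" by (simp add: H_def mult_carrier_mat[of _ n n _ n])
    \<comment> \<open>For e < 0 the q-th power of \<open>d j\<close> is the inverse of
      \<open>d (cyc k m j)\<close>. Reindexing along the cycle removes the permutation, and H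
      factors as a Vandermonde matrix in the d times the transpose of one in their inverses.\<close>
    have H_entry: "H $$ (r, s) = (\<Sum>i<n. d i ^ r * inverse (d i) ^ s)" if "r < n" "s < n" for r s
    proof -
      have "H $$ (r, s) = (\<Sum>j<n. \<Phi> (d j) ^ r * (d j ^ s) ^ q)"
        using that unfolding H_def VP by (simp add: V_def scalar_prod_def lessThan_atLeast0)
      also have "\<dots> = (\<Sum>j<n. d (cyc k m j) ^ r * inverse (d (cyc k m j)) ^ s)"
        using d_cyc by (intro sum.cong) (auto simp: e_neg_\<Phi>[OF False] power_mult[symmetric] mult.commute)
      also have "\<dots> = (\<Sum>i<n. d i ^ r * inverse (d i) ^ s)"
        using bij_cyc[of k m] unfolding n_def[symmetric]
        by (rule sum.reindex_bij_betw[of _ _ _ "\<lambda>i. d i ^ r * inverse (d i) ^ s"])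
      finally show ?thesis .
    qed
    \<comment> \<open>The q-th power turns each node into the inverse of the next one, which
      exchanges the exponents r and s up to the same reindexing.\<close>
    have herm: "star H = H"
    proof (rule eq_matI)
      fix r s assume "r < dim_row H" "s < dim_col H"
      then have rs: "r < n" "s < n" using H by auto
      have "star H $$ (r, s) = (\<Sum>i<n. d i ^ s * inverse (d i) ^ r) ^ q"
        using rs H carrier_matD[OF H] by (simp add: H_entry)
      also have "\<dots> = (\<Sum>i<n. (d i ^ s * inverse (d i) ^ r) ^ q)"
        by (rule frob.hom_sum)
      also have "\<dots> = (\<Sum>j<n. d (cyc k m j) ^ r * inverse (d (cyc k m j)) ^ s)"
        using d_cyc by (intro sum.cong) (auto simp: e_neg_\<Phi>[OF False] power_mult_distrib power_inverse power_mult[symmetric] mult.commute)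
      also have "\<dots> = (\<Sum>i<n. d i ^ r * inverse (d i) ^ s)"
        using bij_cyc[of k m] unfolding n_def[symmetric]
        by (rule sum.reindex_bij_betw[of _ _ _ "\<lambda>i. d i ^ r * inverse (d i) ^ s"])
      finally show "star H $$ (r, s) = H $$ (r, s)" using H_entry[OF rs] by simp
    qed (use carrier_matD[OF H] in auto)
    have "H = V d * transpose_mat (V (\<lambda>j. inverse (d j)))"
      using carrier_matD[OF H] by (intro eq_matI) (simp_all add: H_entry V_def scalar_prod_def lessThan_atLeast0)
    moreover have "det (V (\<lambda>j. inverse (d j))) \<noteq> 0"
      unfolding V_def by (rule det_vandermonde_nonzero) (use inj in \<open>auto simp: d_def n_def inj_on_def\<close>)
    ultimately have "det H \<noteq> 0"
      using detV by (simp add: det_mult[of _ n] det_transpose[of _ n])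
    then obtain R where R: "R \<in> carrier_mat n n" "R * H * star R = 1\<^sub>m n"
      using hermitian_congruent_one[OF H herm] by blast
    define x where "x = R * V d"
    have x: "x \<in> carrier_mat n n" using R by (simp add: x_def mult_carrier_mat[of _ n n _ n])
    have "x * ?P * star x = R * H * star R"
      unfolding x_def H_def using R(1)
      by (simp add: star_mult[of _ n] assoc_mult_mat[of _ n n _ n _ n] mult_carrier_mat[of _ n n _ n])
    then have xP: "x * ?P * star x = 1\<^sub>m n" using R by simp
    then have "x * (?P * star x) = 1\<^sub>m n" using x by (simp add: assoc_mult_mat[of _ n n _ n _ n])
    then have "det x \<noteq> 0"
      by (rule det_nonzero_if_right_inverse[OF x, rotated]) (use x in \<open>simp add: mult_carrier_mat[of _ n n _ n]\<close>)
    then show ?thesis using False x xP unfolding n_def[symmetric] by (intro bexI[of _ x]) auto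
  qed
qed

end

section \<open>Diagonal matrices and cancellation\<close>

lemma mat_commute_diag:
  fixes A :: "'a::field mat"
  assumes A: "A \<in> carrier_mat n n" and inj: "inj_on d {..<n}" and comm: "A * mat_diag n d = mat_diag n d * A"
  shows "A = mat_diag n (\<lambda>i. A $$ (i, i))"
proof (rule eq_matI)
  fix i j assume "i < dim_row (mat_diag n (\<lambda>i. A $$ (i, i)))" "j < dim_col (mat_diag n (\<lambda>i. A $$ (i, i)))"
  then have ij: "i < n" "j < n" by (auto simp: mat_diag_def)
  have "A $$ (i, j) * d j = d i * A $$ (i, j)"
    using arg_cong[OF comm, of "\<lambda>B. B $$ (i, j)"] ij A
    by (simp add: mat_diag_mult_left[OF A] mat_diag_mult_right[OF A])
  moreover have "d i \<noteq> d j" if "i \<noteq> j" using inj ij that by (auto dest: inj_onD)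
  ultimately show "A $$ (i, j) = mat_diag n (\<lambda>i. A $$ (i, i)) $$ (i, j)"
    using ij by (auto simp: mat_diag_def)
qed (use A in \<open>auto simp: mat_diag_def\<close>)

lemma mat_diag_eqD: "mat_diag n f = mat_diag n g \<Longrightarrow> i < n \<Longrightarrow> f i = g i"
  by (drule arg_cong[of _ _ "\<lambda>A. A $$ (i, i)"]) (simp add: mat_diag_def)

lemma mat_diag_cong: "(\<And>i. i < n \<Longrightarrow> f i = g i) \<Longrightarrow> mat_diag n f = mat_diag n g"
  by (intro eq_matI) (auto simp: mat_diag_def)

lemma mult_mat_cancel_left:
  fixes A :: "'a::field mat"
  assumes "A \<in> carrier_mat n n" "B \<in> carrier_mat n n" "C \<in> carrier_mat n n" "Ai \<in> carrier_mat n n"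
    "Ai * A = 1\<^sub>m n" "A * B = A * C"
  shows "B = C"
proof -
  have "Ai * (A * D) = D" if "D \<in> carrier_mat n n" for D
    by (simp only: assoc_mult_mat[OF assms(4,1) that, symmetric] assms(5) left_mult_one_mat[OF that])
  then show ?thesis using assms(2,3,6) by metis
qed

lemma mult_mat_cancel_right:
  fixes A :: "'a::field mat"
  assumes "A \<in> carrier_mat n n" "B \<in> carrier_mat n n" "C \<in> carrier_mat n n" "Ai \<in> carrier_mat n n"
    "A * Ai = 1\<^sub>m n" "B * A = C * A"
  shows "B = C"
proof -
  have "D * A * Ai = D" if "D \<in> carrier_mat n n" for D
    by (simp only: assoc_mult_mat[OF that assms(1,4)] assms(5) right_mult_one_mat[OF that])
  then show ?thesis using assms(2,3,6) by metis
qed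

lemma char_poly_mat_diag: "char_poly (mat_diag n d) = (\<Prod>i\<leftarrow>[0..<n]. [:- d i, 1:])"
proof -
  have "char_poly (mat_diag n d) = (\<Prod>a\<leftarrow>diag_mat (mat_diag n d). [:- a, 1:])"
    by (rule char_poly_upper_triangular[of _ n]) (auto simp: mat_diag_def upper_triangular_def)
  also have "diag_mat (mat_diag n d) = map d [0..<n]"
    by (simp add: diag_mat_def mat_diag_def)
  finally show ?thesis by (simp add: comp_def)
qed

lemma det_mat_diag: "det (mat_diag n d) = (\<Prod>i<n. d i)"
proof -
  have "det (mat_diag n d) = prod_list (diag_mat (mat_diag n d))"
    by (rule det_upper_triangular[of _ n]) (auto simp: mat_diag_def upper_triangular_def)
  also have "diag_mat (mat_diag n d) = map d [0..<n]"
    by (simp add: diag_mat_def mat_diag_def)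
  finally show ?thesis by (simp add: prod.list_conv_set_nth lessThan_atLeast0)
qed

text \<open>
  Conjugation by \<open>x\<close> turns the Frobenius map that defines the group into its composition with the
  permutation \<open>cyc k m\<close>; the diagonal matrices fixed by the latter form the torus \<open>T\<^sub>k \<times> T\<^sub>m\<close>.
\<close>

locale torus_frame = signed_frobenius q e ty
  for q :: nat and e :: int and ty :: "'l::alg_closed_field itself" +
  fixes k m n :: nat and x xi :: "'l mat"
  assumes km: "k > 0" "m > 0" "n = k + m"
    and x: "x \<in> carrier_mat n n" "xi \<in> carrier_mat n n" "x * xi = 1\<^sub>m n" "xi * x = 1\<^sub>m n"
    and lang: "if e > 0 then frob x = x * cycle_mat k m else x * cycle_mat k m * star x = 1\<^sub>m n"
begin

definition tor :: "'l \<Rightarrow> 'l \<Rightarrow> 'l mat" where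
  "tor a b = x * mat_diag n (eigs k a b) * xi"

lemmas sq = mult_carrier_mat[of _ n n _ n] assoc_mult_mat[of _ n n _ n _ n]
  right_mult_one_mat[of _ n n] left_mult_one_mat[of _ n n]

lemma P [simp]: "cycle_mat k m \<in> carrier_mat n n" by (simp add: km)

lemma P_entry: "i < n \<Longrightarrow> j < n \<Longrightarrow> cycle_mat k m $$ (i, j) = (if i = cyc k m j then 1 else 0)"
  by (simp add: km cycle_mat_def)

lemma cyc_less_n: "j < n \<Longrightarrow> cyc k m j < n"
  using cyc_less km by simp

declare x(1,2) [simp]

lemma xi_cancel: "B \<in> carrier_mat n n \<Longrightarrow> x * (xi * B) = B" "B \<in> carrier_mat n n \<Longrightarrow> xi * (x * B) = B"
  using assoc_mult_mat[of x n n xi n B n] assoc_mult_mat[of xi n n x n B n] x by (auto simp: sq)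

lemma tor_carrier [simp]: "tor a b \<in> carrier_mat n n"
  by (simp add: tor_def sq)

lemma tor_x: "tor a b * x = x * mat_diag n (eigs k a b)"
  unfolding tor_def using x by (simp add: sq)

lemma eq_torI:
  assumes "y \<in> carrier_mat n n" "y * x = x * mat_diag n (eigs k a b)"
  shows "y = tor a b"
  by (rule mult_mat_cancel_right[of x n _ _ xi]) (use assms x in \<open>auto simp: tor_x\<close>)

lemma frob_diag: "frob (mat_diag n d) = mat_diag n (\<lambda>i. d i ^ q)"
  using q2 by (intro eq_matI) (auto simp: mat_diag_def)

lemma star_diag: "star (mat_diag n d) = mat_diag n (\<lambda>i. d i ^ q)"
  unfolding frob_diag by (intro eq_matI) (auto simp: mat_diag_def)

lemma lang_pos: "e > 0 \<Longrightarrow> frob x = x * cycle_mat k m"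
  and lang_neg: "\<not> e > 0 \<Longrightarrow> x * (cycle_mat k m * star x) = 1\<^sub>m n"
  using lang by (auto simp: sq)

lemma P_diag: "cycle_mat k m * mat_diag n f = mat_diag n g * cycle_mat k m \<longleftrightarrow>
    (\<forall>j<n. f j = g (cyc k m j))" (is "?l = ?r")
proof
  assume l: ?l
  show ?r
  proof (intro allI impI)
    fix j assume j: "j < n"
    have "(cycle_mat k m * mat_diag n f) $$ (cyc k m j, j) = (mat_diag n g * cycle_mat k m) $$ (cyc k m j, j)"
      using l by simp
    then show "f j = g (cyc k m j)"
      using j cyc_less_n[OF j]
      by (simp add: mat_diag_mult_left[OF P] mat_diag_mult_right[OF P] P_entry)
  qed
next
  assume ?r
  then show ?l
    by (intro eq_matI) (auto simp: mat_diag_mult_left[OF P] mat_diag_mult_right[OF P] P_entry)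
qed

lemma diag_P_diag: "mat_diag n g * (cycle_mat k m * mat_diag n f) = cycle_mat k m \<longleftrightarrow>
    (\<forall>j<n. g (cyc k m j) * f j = 1)" (is "?l = ?r")
proof -
  have eq: "mat_diag n g * (cycle_mat k m * mat_diag n f) =
      mat n n (\<lambda>(i, j). g i * cycle_mat k m $$ (i, j) * f j)"
    by (subst mat_diag_mult_left[of _ n n]) (auto simp: sq mat_diag_mult_right[OF P] mult.assoc intro!: eq_matI)
  show ?thesis
  proof
    assume l: ?l
    show ?r
    proof (intro allI impI)
      fix j assume j: "j < n"
      have "(mat_diag n g * (cycle_mat k m * mat_diag n f)) $$ (cyc k m j, j) = cycle_mat k m $$ (cyc k m j, j)"
        using l by simp
      then show "g (cyc k m j) * f j = 1"
        unfolding eq using j cyc_less_n[OF j] by (simp add: P_entry)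
    qed
  next
    assume ?r
    then show ?l
      unfolding eq using carrier_matD[OF P] by (intro eq_matI) (auto simp: P_entry)
  qed
qed

text \<open>Write y = x D x^(-1). For e > 0 the Frobenius image of x is xP, so y is fixed if and
  only if P D^q = D P. For e < 0 the condition becomes D P D^q = P. Both say that D follows
  \<open>\<Phi>\<close> along the cycles.\<close>

lemma isometry_iff_cyc:
  assumes y: "y \<in> carrier_mat n n" and yx: "y * x = x * mat_diag n d" and det: "det y \<noteq> 0"
    and nz: "\<And>j. j < n \<Longrightarrow> d j \<noteq> 0"
  shows "y \<in> isometries n \<longleftrightarrow> (\<forall>j<n. d (cyc k m j) = \<Phi> (d j))"
proof (cases "e > 0")
  case True
  let ?P = "cycle_mat k m"
  have fx: "frob x * frob xi = 1\<^sub>m n" "frob x \<in> carrier_mat n n" "frob xi \<in> carrier_mat n n"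
    using frob.mat_hom_mult[OF x(1,2)] x frob.mat_hom_one[of n] by auto
  have "frob y * frob x = frob x * mat_diag n (\<lambda>i. d i ^ q)"
    using frob.mat_hom_mult[OF y x(1)] frob.mat_hom_mult[OF x(1), of "mat_diag n d" n] yx by (simp add: frob_diag)
  also have "\<dots> = x * (?P * mat_diag n (\<lambda>i. d i ^ q))"
    by (simp add: lang_pos[OF True] sq)
  finally have 1: "frob y * frob x = x * (?P * mat_diag n (\<lambda>i. d i ^ q))" .
  have "y * frob x = (y * x) * ?P" using y by (simp add: lang_pos[OF True] sq)
  also have "\<dots> = x * (mat_diag n d * ?P)" by (simp add: yx sq)
  finally have 2: "y * frob x = x * (mat_diag n d * ?P)" .
  have "y \<in> isometries n \<longleftrightarrow> frob y = y" using y det True by (simp add: isometries_def)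
  also have "\<dots> \<longleftrightarrow> frob y * frob x = y * frob x"
    using mult_mat_cancel_right[of "frob x" n "frob y" y "frob xi"] fx y by auto
  also have "\<dots> \<longleftrightarrow> ?P * mat_diag n (\<lambda>i. d i ^ q) = mat_diag n d * ?P"
    unfolding 1 2
    using mult_mat_cancel_left[of x n "?P * mat_diag n (\<lambda>i. d i ^ q)" "mat_diag n d * ?P" xi] x
    by (auto simp: mult_carrier_mat[of _ n n _ n])
  also have "\<dots> \<longleftrightarrow> (\<forall>j<n. d (cyc k m j) = \<Phi> (d j))"
    by (auto simp: P_diag e_pos_\<Phi>[OF True])
  finally show ?thesis .
next
  case False
  let ?P = "cycle_mat k m"
  have sx: "star xi * star x = 1\<^sub>m n" "star x * star xi = 1\<^sub>m n"
    unfolding star_mult[OF x(1,2), symmetric] star_mult[OF x(2,1), symmetric] x(3,4) by (rule star_one)+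
  have "star (y * x) = star (x * mat_diag n d)" by (simp add: yx)
  then have s: "star x * star y = mat_diag n (\<lambda>i. d i ^ q) * star x"
    using y by (simp add: star_mult[of _ n] star_diag)
  \<comment> \<open>Inserting x P x^* = 1 in the middle lets y act on x from the left and y^* on x^*
    from the right.\<close>
  have "y * star y = y * (x * (?P * star x)) * star y"
    using y by (simp add: lang_neg[OF False] sq)
  also have "\<dots> = (y * x) * (?P * (star x * star y))"
    using y by (simp add: sq)
  also have "\<dots> = x * (mat_diag n d * (?P * mat_diag n (\<lambda>i. d i ^ q)) * star x)"
    unfolding yx s by (simp add: sq)
  finally have 1: "y * star y = x * (mat_diag n d * (?P * mat_diag n (\<lambda>i. d i ^ q)) * star x)" .
  have "y \<in> isometries n \<longleftrightarrow> y * star y = 1\<^sub>m n" using y det False by (simp add: isometries_def)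
  also have "\<dots> \<longleftrightarrow> x * (mat_diag n d * (?P * mat_diag n (\<lambda>i. d i ^ q)) * star x) = x * (?P * star x)"
    unfolding 1 lang_neg[OF False] ..
  also have "\<dots> \<longleftrightarrow> mat_diag n d * (?P * mat_diag n (\<lambda>i. d i ^ q)) * star x = ?P * star x"
    using mult_mat_cancel_left[of x n "mat_diag n d * (?P * mat_diag n (\<lambda>i. d i ^ q)) * star x" "?P * star x" xi] x
    by (auto simp: mult_carrier_mat[of _ n n _ n])
  also have "\<dots> \<longleftrightarrow> mat_diag n d * (?P * mat_diag n (\<lambda>i. d i ^ q)) = ?P"
    using mult_mat_cancel_right[of "star x" n "mat_diag n d * (?P * mat_diag n (\<lambda>i. d i ^ q))" "?P" "star xi"] x sx
    by (auto simp: mult_carrier_mat[of _ n n _ n])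
  also have "\<dots> \<longleftrightarrow> (\<forall>j<n. d (cyc k m j) = \<Phi> (d j))"
    unfolding diag_P_diag e_neg_\<Phi>[OF False] using nz
    by (metis inverse_unique left_inverse mult.commute power_not_zero)
  finally show ?thesis .
qed

lemma prod_eigs: "(\<Prod>i<n. eigs k a b i) = nrm k a * nrm m b"
proof -
  have "(\<Prod>i<n. eigs k a b i) = (\<Prod>i<k. eigs k a b i) * (\<Prod>i=k..<n. eigs k a b i)"
    using km prod.atLeastLessThan_concat[of 0 k n "eigs k a b"] by (simp add: lessThan_atLeast0)
  also have "(\<Prod>i=k..<n. eigs k a b i) = (\<Prod>i<m. eigs k a b (k + i))"
    using prod.shift_bounds_nat_ivl[of "eigs k a b" 0 k m] km by (simp add: lessThan_atLeast0 add.commute)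
  finally show ?thesis by (simp add: eigs_def nrm_def)
qed

lemma det_similar_diag:
  assumes y: "y \<in> carrier_mat n n" and yx: "y * x = x * mat_diag n d"
  shows "det y = (\<Prod>i<n. d i)"
proof -
  have "det x \<noteq> 0" using det_nonzero_if_right_inverse[of x n xi] x by simp
  moreover have "det y * det x = det x * det (mat_diag n d)"
    using arg_cong[OF yx, of det] y by (simp add: det_mult[of _ n])
  ultimately show ?thesis by (simp add: det_mat_diag)
qed

lemma det_tor: "det (tor a b) = nrm k a * nrm m b"
  using det_similar_diag[OF tor_carrier tor_x] by (simp add: prod_eigs)

lemma tor_isometry:
  assumes "a \<in> torus k" "b \<in> torus m"
  shows "tor a b \<in> isometries n"
proof -
  have "det (tor a b) \<noteq> 0"
    using nrm_in_torus[OF assms(1)] nrm_in_torus[OF assms(2)] by (simp add: det_tor torus_def)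
  then show ?thesis
    using isometry_iff_cyc[OF tor_carrier tor_x, of a b] eigs_cyc[OF assms] eigs_nonzero[OF assms] km by auto
qed

lemma tor_mult: "tor a b * tor a' b' = tor (a * a') (b * b')"
proof (rule eq_torI)
  have "tor a b * tor a' b' * x = tor a b * x * mat_diag n (eigs k a' b')"
    by (simp only: assoc_mult_mat[OF tor_carrier tor_carrier x(1)] tor_x[of a' b']
        assoc_mult_mat[OF tor_carrier x(1) mat_diag_dim])
  also have "\<dots> = x * (mat_diag n (eigs k a b) * mat_diag n (eigs k a' b'))"
    unfolding tor_x by (simp only: assoc_mult_mat[OF x(1) mat_diag_dim mat_diag_dim])
  also have "mat_diag n (eigs k a b) * mat_diag n (eigs k a' b') = mat_diag n (eigs k (a * a') (b * b'))"
    unfolding mat_diag_diag by (rule mat_diag_cong) (simp add: eigs_def funpow_\<Phi>_mult)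
  finally show "tor a b * tor a' b' * x = x * mat_diag n (eigs k (a * a') (b * b'))" .
qed (simp add: sq)

lemma tor_one: "tor 1 1 = 1\<^sub>m n"
proof (rule eq_torI[symmetric])
  have "(\<Phi> ^^ i) 1 = 1" for i by (simp add: funpow_\<Phi>)
  then have "mat_diag n (eigs k 1 1) = 1\<^sub>m n"
    by (subst mat_diag_one[symmetric], intro mat_diag_cong) (simp add: eigs_def)
  then show "1\<^sub>m n * x = x * mat_diag n (eigs k 1 1)" by (simp add: sq)
qed simp

lemma tor_power: "tor a b ^\<^sub>m r = tor (a ^ r) (b ^ r)"
proof (induction r)
  case 0
  show ?case using carrier_matD(1)[OF tor_carrier[of a b]] by (simp add: tor_one)
next
  case (Suc r)
  then show ?case by (simp add: tor_mult mult.commute)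
qed

lemma tor_inject:
  assumes "tor a b = tor a' b'"
  shows "a = a'" "b = b'"
proof -
  have "x * mat_diag n (eigs k a b) = x * mat_diag n (eigs k a' b')"
    using tor_x assms by metis
  then have "mat_diag n (eigs k a b) = mat_diag n (eigs k a' b')"
    using mult_mat_cancel_left[of x n _ _ xi] x by auto
  moreover have "0 < n" "k < n" using km by auto
  ultimately have "eigs k a b 0 = eigs k a' b' 0" "eigs k a b k = eigs k a' b' k"
    by (blast dest: mat_diag_eqD)+
  then show "a = a'" "b = b'" using km by (auto simp: eigs_def)
qed

text \<open>Commuting with a matrix with n distinct eigenvalues forces y to be diagonal in the
  eigenbasis x; being an isometry, it then satisfies the cycle condition and lies in the
  torus.\<close>

lemma tor_centralizer:
  assumes y: "y \<in> isometries n" and inj: "inj_on (eigs k a b) {..<n}" and comm: "y * tor a b = tor a b * y"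
  obtains a' b' where "a' \<in> torus k" "b' \<in> torus m" "y = tor a' b'"
proof -
  have yc [simp]: "y \<in> carrier_mat n n" and dy: "det y \<noteq> 0" using y by (auto simp: isometries_def)
  define z where "z = xi * (y * x)"
  define D where "D = mat_diag n (eigs k a b)"
  have D [simp]: "D \<in> carrier_mat n n" by (simp add: D_def)
  have z [simp]: "z \<in> carrier_mat n n" by (simp add: z_def sq)
  have xz: "x * z = y * x" by (simp add: z_def xi_cancel sq)
  have "x * (z * D) = x * (D * z)"
  proof -
    have "x * (z * D) = y * (x * D)" using assoc_mult_mat[of x n n z n D n] by (simp add: xz sq)
    also have "\<dots> = y * tor a b * x" by (simp add: tor_x[symmetric] D_def sq)
    also have "\<dots> = tor a b * (x * z)" by (simp add: comm xz sq)
    also have "\<dots> = x * (D * z)"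
      using assoc_mult_mat[of "tor a b" n n x n z n] assoc_mult_mat[of x n n D n z n] by (simp add: tor_x D_def[symmetric])
    finally show ?thesis .
  qed
  then have "z * D = D * z"
    using mult_mat_cancel_left[of x n "z * D" "D * z" xi] x by (simp add: mult_carrier_mat[of _ n n _ n])
  then have zd: "z = mat_diag n (\<lambda>i. z $$ (i, i))"
    unfolding D_def by (intro mat_commute_diag[OF z inj])
  define d where "d i = z $$ (i, i)" for i
  have yx: "y * x = x * mat_diag n d" using xz zd unfolding d_def[abs_def] by metis
  have nz: "d j \<noteq> 0" if "j < n" for j
    using det_similar_diag[OF yc yx] dy that by auto
  have cyc: "d (cyc k m j) = \<Phi> (d j)" if "j < n" for j
    using isometry_iff_cyc[OF yc yx dy nz] y that by blast
  note d = eigs_from_cyc[OF km(1,2), of d, folded km(3), OF cyc nz]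
  have "mat_diag n d = mat_diag n (eigs k (d 0) (d k))" by (rule mat_diag_cong) (rule d(3))
  then have "y = tor (d 0) (d k)" using yx by (intro eq_torI[OF yc]) metis
  then show ?thesis using that d(1,2) by blast
qed

lemma eigenvalue_conj_tor:
  assumes g: "g \<in> carrier_mat n n" "gi \<in> carrier_mat n n" "g * gi = 1\<^sub>m n" "gi * g = 1\<^sub>m n"
  shows "{c. eigenvalue (g * tor a b * gi) c} = eigs k a b ` {..<n}"
proof -
  let ?y = "g * tor a b * gi"
  have y: "?y \<in> carrier_mat n n" using g by (simp add: mult_carrier_mat[of _ n n _ n])
  have "similar_mat ?y (tor a b)"
    unfolding similar_mat_def similar_mat_wit_def using g y by (intro exI[of _ g] exI[of _ gi]) auto
  moreover have "similar_mat (tor a b) (mat_diag n (eigs k a b))"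
    unfolding similar_mat_def similar_mat_wit_def using x carrier_matD[OF tor_carrier[of a b]] tor_def[of a b]
    by (intro exI[of _ x] exI[of _ xi]) auto
  ultimately have "char_poly ?y = (\<Prod>i\<leftarrow>[0..<n]. [:- eigs k a b i, 1:])"
    by (simp add: char_poly_similar char_poly_mat_diag)
  then show ?thesis
    using eigenvalue_root_char_poly[OF y] by (auto simp: poly_prod_list prod_list_zero_iff)
qed

end

context signed_frobenius
begin

text \<open>The Vandermonde construction starts from the distinct eigenvalues of one pair (a, b),
  but the frame obtained carries the whole torus.\<close>

lemma ex_torus_frame:
  assumes "k > 0" "m > 0" "a \<in> torus k" "b \<in> torus m" "inj_on (eigs k a b) {..<k + m}"
  obtains x xi :: "'l mat" where "torus_frame q e k m (k + m) x xi"
proof -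
  obtain x where x: "x \<in> carrier_mat (k + m) (k + m)" "det x \<noteq> 0"
    "if e > 0 then frob x = x * cycle_mat k m else x * cycle_mat k m * star x = 1\<^sub>m (k + m)"
    using ex_lang[OF assms(3-5)] by blast
  obtain xi where "xi \<in> carrier_mat (k + m) (k + m)" "x * xi = 1\<^sub>m (k + m)" "xi * x = 1\<^sub>m (k + m)"
    using obtain_mat_inverse[OF x(1,2)] .
  then show ?thesis using assms(1,2) x by (intro that[of x xi]) (unfold_locales, auto)
qed

end

section \<open>Counting regular elements\<close>

lemma card_le_fibres:
  assumes "finite A" "\<And>x. x \<in> A \<Longrightarrow> card {x' \<in> A. f x' = f x} \<le> c"
  shows "card A \<le> card (f ` A) * c"
proof -
  have "card A = (\<Sum>y\<in>f ` A. card {x \<in> A. f x = y})"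
    using sum.image_gen[OF assms(1), of "\<lambda>_. 1::nat" f] by simp
  also have "\<dots> \<le> (\<Sum>y\<in>f ` A. c)" using assms by (intro sum_mono) auto
  finally show ?thesis by simp
qed

lemma card_mats_le:
  assumes "finite K"
  shows "finite {A \<in> carrier_mat n n. elements_mat A \<subseteq> K}"
    "card {A \<in> carrier_mat n n. elements_mat A \<subseteq> K} \<le> card K ^ (n * n)"
proof -
  let ?D = "{..<n} \<times> {..<n}"
  let ?P = "?D \<rightarrow>\<^sub>E K"
  have fin: "finite ?P" using assms by (intro finite_PiE) auto
  have sub: "{A \<in> carrier_mat n n. elements_mat A \<subseteq> K} \<subseteq> mat n n ` ?P"
  proof
    fix A assume A: "A \<in> {A \<in> carrier_mat n n. elements_mat A \<subseteq> K}"
    have "A = mat n n (restrict (($$) A) ?D)" using A by (intro eq_matI) auto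
    moreover have "restrict (($$) A) ?D \<in> ?P"
      using A elements_matI[of A n n] by (auto simp: subset_iff)
    ultimately show "A \<in> mat n n ` ?P" by blast
  qed
  show "finite {A \<in> carrier_mat n n. elements_mat A \<subseteq> K}"
    using sub fin finite_subset by blast
  have "card {A \<in> carrier_mat n n. elements_mat A \<subseteq> K} \<le> card (mat n n ` ?P)"
    using sub fin by (intro card_mono) auto
  also have "\<dots> \<le> card ?P" using fin by (rule card_image_le)
  also have "\<dots> = card K ^ (n * n)" by (simp add: card_PiE card_cartesian_product)
  finally show "card {A \<in> carrier_mat n n. elements_mat A \<subseteq> K} \<le> card K ^ (n * n)" .
qed

section \<open>Conjugation by an invertible matrix\<close>

locale mat_conj =
  fixes n :: nat and g gi :: "'a::field mat"
  assumes g: "g \<in> carrier_mat n n" "gi \<in> carrier_mat n n" "g * gi = 1\<^sub>m n" "gi * g = 1\<^sub>m n"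
begin

definition cj :: "'a mat \<Rightarrow> 'a mat" where "cj A = gi * A * g"

lemma cj_carrier: "A \<in> carrier_mat n n \<Longrightarrow> cj A \<in> carrier_mat n n"
  using g by (simp add: cj_def mult_carrier_mat[of _ n n _ n])

lemma cancel: "A \<in> carrier_mat n n \<Longrightarrow> g * (gi * A) = A" "A \<in> carrier_mat n n \<Longrightarrow> gi * (g * A) = A"
  using assoc_mult_mat[of g n n gi n A n, symmetric] assoc_mult_mat[of gi n n g n A n, symmetric] g by simp_all

lemma cj_mult:
  assumes "A \<in> carrier_mat n n" "B \<in> carrier_mat n n"
  shows "cj (A * B) = cj A * cj B"
  using assms g unfolding cj_def
  by (simp add: assoc_mult_mat[of _ n n _ n _ n] mult_carrier_mat[of _ n n _ n] cancel)

lemma cj_one: "cj (1\<^sub>m n) = 1\<^sub>m n"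
  using g by (simp add: cj_def)

lemma cj_power:
  assumes "A \<in> carrier_mat n n"
  shows "cj (A ^\<^sub>m r) = cj A ^\<^sub>m r"
proof (induction r)
  case 0
  show ?case using assms carrier_matD(1)[OF cj_carrier[OF assms]] by (simp add: cj_one)
next
  case (Suc r)
  then show ?case using assms by (simp add: cj_mult)
qed

lemma cj_inverse:
  assumes "A \<in> carrier_mat n n"
  shows "g * cj A * gi = A"
  using assms g unfolding cj_def
  by (simp add: assoc_mult_mat[of _ n n _ n _ n] mult_carrier_mat[of _ n n _ n] cancel right_mult_one_mat[of _ n n])

lemma cj_inverse':
  assumes "A \<in> carrier_mat n n"
  shows "cj (g * A * gi) = A"
  using assms g unfolding cj_def
  by (simp add: assoc_mult_mat[of _ n n _ n _ n] mult_carrier_mat[of _ n n _ n] cancel right_mult_one_mat[of _ n n])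

end

lemma pow_mat_commute:
  fixes A :: "'a::field mat"
  assumes "A \<in> carrier_mat n n" "B \<in> carrier_mat n n" "A * B = B * A"
  shows "A * B ^\<^sub>m r = B ^\<^sub>m r * A"
proof (induction r)
  case 0
  then show ?case using assms by simp
next
  case (Suc r)
  have P: "B ^\<^sub>m r \<in> carrier_mat n n" using assms by simp
  have "A * (B ^\<^sub>m r * B) = A * B ^\<^sub>m r * B" by (rule assoc_mult_mat[OF assms(1) P assms(2), symmetric])
  also have "\<dots> = B ^\<^sub>m r * (A * B)"
    unfolding Suc by (rule assoc_mult_mat[OF P assms(1,2)])
  also have "\<dots> = B ^\<^sub>m r * B * A"
    unfolding assms(3) by (rule assoc_mult_mat[OF P assms(2,1), symmetric])
  finally show ?case by simp
qed

section \<open>Orders of the isometry groups, regular elements and their roots\<close>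

context signed_frobenius
begin

text \<open>In the unitary case A and its double star are both left inverses of
  \<open>star A\<close>; so they agree, and the double star is the entrywise q^2-th power.\<close>

lemma isometries_entries: "isometries n \<subseteq> {A \<in> carrier_mat n n. elements_mat A \<subseteq> {x. x ^ (q * q) = x}}"
proof
  fix A assume A: "A \<in> isometries n"
  have Ac: "A \<in> carrier_mat n n" using A by (rule isometries_carrier)
  have ff: "frob (frob A) = A"
  proof (cases "e > 0")
    case True
    then show ?thesis using A by (simp add: isometries_def)
  next
    case False
    then have 1: "A * star A = 1\<^sub>m n" using A by (simp add: isometries_def)
    have "star (A * star A) = star (1\<^sub>m n)" by (simp only: 1)
    then have 2: "star (star A) * star A = 1\<^sub>m n"
      using star_mult[OF Ac star_carrier[OF Ac]] by simp
    have "star A * A = 1\<^sub>m n" using mat_mult_left_right_inverse[OF Ac star_carrier[OF Ac] 1] .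
    then have "star (star A) = A"
      using mult_mat_cancel_right[of "star A" n "star (star A)" A A] Ac 1 2 by simp
    moreover have "star (star A) = frob (frob A)" by (intro eq_matI) auto
    ultimately show ?thesis by simp
  qed
  have "A $$ (i, j) ^ (q * q) = frob (frob A) $$ (i, j)" if "i < n" "j < n" for i j
    using that Ac by (simp add: power_mult)
  then show "A \<in> {A \<in> carrier_mat n n. elements_mat A \<subseteq> {x. x ^ (q * q) = x}}"
    unfolding ff using Ac by (auto simp: elements_mat_def)
qed

lemma finite_isometries: "finite (isometries n)"
proof -
  have "finite {x::'l. x ^ (q * q) = x}"
  proof -
    have "{x::'l. x ^ (q * q) = x} \<subseteq> insert 0 {x. x ^ (q * q - 1) = 1}"
    proof
      fix x :: 'l assume x: "x \<in> {x. x ^ (q * q) = x}"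
      have "x ^ (q * q) = x ^ (q * q - 1) * x"
        using q2 by (intro power_minus_mult[symmetric]) simp
      then show "x \<in> insert 0 {x. x ^ (q * q - 1) = 1}" using x by auto
    qed
    moreover have "q * q - 1 > 0" using q2 mult_le_mono[OF q2 q2] by simp
    ultimately show ?thesis
      using card_power_eq_le(1)[of "q * q - 1" "1::'l"] by (auto intro: finite_subset)
  qed
  from finite_subset[OF isometries_entries card_mats_le(1)[OF this]] show ?thesis .
qed

lemma special_isometries_carrier: "A \<in> special_isometries n \<Longrightarrow> A \<in> carrier_mat n n"
  by (simp add: special_isometries_def isometries_def)

text \<open>The matrices diag(c, 1, ..., 1) with c in T_1 are isometries of determinant c, so they
  represent different cosets of the special subgroup.\<close>

lemma card_special_isometries:
  assumes "n > 0"
  shows "tau 1 * card (special_isometries n) \<le> card (isometries n)"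
proof -
  define dg where "dg c = mat_diag n (\<lambda>i. if i = 0 then c else 1)" for c :: 'l
  have dg [simp]: "dg c \<in> carrier_mat n n" for c by (simp add: dg_def)
  have det_dg: "det (dg c) = c" for c
    unfolding dg_def det_mat_diag using assms by (subst prod.delta) auto
  have iso: "dg c \<in> isometries n" if "c \<in> torus 1" for c
  proof -
    have c: "c \<noteq> 0" "\<Phi> c = c" using that by (auto simp: torus_def)
    have fr: "frob (dg c) = dg (c ^ q)" "star (dg c) = dg (c ^ q)"
      using q2 by (auto simp: dg_def mat_diag_def intro!: eq_matI)
    show ?thesis
    proof (cases "e > 0")
      case True
      then show ?thesis using c fr e_pos_\<Phi>[OF True, of c] by (simp add: isometries_def det_dg)
    next
      case False
      have "c * c ^ q = 1" using c e_neg_\<Phi>[OF False, of c] by (metis left_inverse power_not_zero)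
      then have "dg c * dg (c ^ q) = 1\<^sub>m n"
        unfolding dg_def mat_diag_diag by (subst mat_diag_one[symmetric], intro mat_diag_cong) auto
      then show ?thesis using False c fr by (simp add: isometries_def det_dg)
    qed
  qed
  have "inj_on (\<lambda>(c, s). dg c * s) (torus 1 \<times> special_isometries n)"
  proof (rule inj_onI, clarify)
    fix c s c' s' assume *: "c \<in> torus 1" "s \<in> special_isometries n" "c' \<in> torus 1" "s' \<in> special_isometries n"
      "dg c * s = dg c' * s'"
    have s: "s \<in> carrier_mat n n" "s' \<in> carrier_mat n n" using * special_isometries_carrier by auto
    have "det (dg c * s) = c" "det (dg c' * s') = c'"
      using det_mult[OF dg s(1), of c] det_mult[OF dg s(2), of c'] *(2,4)
      by (simp_all add: det_dg special_isometries_def)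
    then have c: "c = c'" using * by simp
    obtain B where "B \<in> carrier_mat n n" "B * dg c = 1\<^sub>m n"
      using obtain_mat_inverse[OF dg, of c] det_dg torus_nonzero *(1) by metis
    then have "s = s'" using mult_mat_cancel_left[of "dg c" n s s' B] s * c by simp
    then show "c = c' \<and> s = s'" using c by simp
  qed
  then have "card (torus 1 \<times> special_isometries n) = card ((\<lambda>(c, s). dg c * s) ` (torus 1 \<times> special_isometries n))"
    by (simp add: card_image)
  also have "\<dots> \<le> card (isometries n)"
    using iso isometries_mult finite_isometries by (intro card_mono) (auto simp: special_isometries_def)
  finally show ?thesis by (simp add: card_cartesian_product card_torus)
qed

text \<open>The frame is quantified because every pair brings its own one. The product of x, the
  diagonal matrix and \<open>xi\<close> is the element \<open>tor a b\<close> of that frame.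
  Conjugation is by the full isometry group.\<close>

definition regular :: "nat \<Rightarrow> nat \<Rightarrow> 'l mat set" where
  "regular M n = {y. \<exists>k m x xi a b g gi. torus_frame q e k m n x xi \<and> (a, b) \<in> good M k m \<and>
     g \<in> isometries n \<and> gi \<in> isometries n \<and> g * gi = 1\<^sub>m n \<and> gi * g = 1\<^sub>m n \<and>
     y = g * (x * mat_diag n (eigs k a b) * xi) * gi}"

lemma regular_special: "y \<in> regular M n \<Longrightarrow> y \<in> special_isometries n"
proof -
  assume "y \<in> regular M n"
  then obtain k m x xi a b g gi where F: "torus_frame q e k m n x xi" and ab: "(a, b) \<in> good M k m"
    and g: "g \<in> isometries n" "gi \<in> isometries n" "g * gi = 1\<^sub>m n"
    and y: "y = g * (x * mat_diag n (eigs k a b) * xi) * gi"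
    unfolding regular_def by blast
  interpret F: torus_frame q e "TYPE('l)" k m n x xi by (rule F)
  have t: "y = g * F.tor a b * gi" by (simp add: y F.tor_def)
  have c [simp]: "g \<in> carrier_mat n n" "gi \<in> carrier_mat n n" using g isometries_carrier by auto
  have "det g * det gi = 1" using det_mult[OF c] g(3) by simp
  moreover have "det y = det g * det (F.tor a b) * det gi"
    unfolding t by (simp add: det_mult[of _ n] mult_carrier_mat[of _ n n _ n])
  moreover have "det (F.tor a b) = 1" using ab by (simp add: F.det_tor good_def)
  ultimately have "det y = 1" by simp
  moreover have "y \<in> isometries n"
    unfolding t using ab g by (intro isometries_mult F.tor_isometry) (auto simp: good_def)
  ultimately show ?thesis by (simp add: special_isometries_def)
qed

text \<open>The factor z is there for the central quotient, where \<open>M\<close>-th powers are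
  known only up to the centre. A solution y commutes with its own power and with z, hence with the
  \<open>M\<close>-th power of \<open>y0\<close>, whose eigenvalues are distinct. So y lies in the
  torus of \<open>y0\<close>, as does z, and each of its two coordinates solves an equation of
  degree M.\<close>

lemma card_roots_regular:
  assumes M: "M > 0" and y0: "y0 \<in> regular M n" and z: "z \<in> isometries n" "z * y0 = y0 * z"
  shows "card {y \<in> isometries n. y * z = z * y \<and> y ^\<^sub>m M = y0 ^\<^sub>m M * z} \<le> M\<^sup>2"
proof -
  obtain k m x xi a b g gi where F: "torus_frame q e k m n x xi" and ab: "(a, b) \<in> good M k m"
    and gI: "g \<in> isometries n" "gi \<in> isometries n" "g * gi = 1\<^sub>m n" "gi * g = 1\<^sub>m n"
    and y0_eq: "y0 = g * (x * mat_diag n (eigs k a b) * xi) * gi"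
    using y0 unfolding regular_def by blast
  interpret F: torus_frame q e "TYPE('l)" k m n x xi by (rule F)
  have gc: "g \<in> carrier_mat n n" "gi \<in> carrier_mat n n" using gI isometries_carrier by auto
  interpret mat_conj n g gi by unfold_locales (use gc gI in auto)
  have y0_c: "y0 \<in> carrier_mat n n" using regular_special[OF y0] special_isometries_carrier by blast
  have cj_y0: "cj y0 = F.tor a b"
    using cj_inverse'[OF F.tor_carrier[of a b]] by (simp only: y0_eq F.tor_def)
  have inj: "inj_on (eigs k (a ^ M) (b ^ M)) {..<n}" using ab F.km by (simp add: good_def)
  have cj_iso: "cj y \<in> isometries n" if "y \<in> isometries n" for y
    unfolding cj_def using that gI by (intro isometries_mult)
  have zc: "z \<in> carrier_mat n n" using z isometries_carrier by blast
  have cent: "\<exists>a' b'. a' \<in> torus k \<and> b' \<in> torus m \<and> cj y = F.tor a' b'"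
    if y: "y \<in> isometries n" and comm: "y * y0 ^\<^sub>m M = y0 ^\<^sub>m M * y" for y
  proof -
    have "cj (y * y0 ^\<^sub>m M) = cj (y0 ^\<^sub>m M * y)" using comm by simp
    then have "cj y * F.tor (a ^ M) (b ^ M) = F.tor (a ^ M) (b ^ M) * cj y"
      using y0_c isometries_carrier[OF y] by (simp add: cj_mult cj_power cj_y0 F.tor_power)
    then show ?thesis using F.tor_centralizer[OF cj_iso[OF y] inj] by blast
  qed
  have "z * y0 ^\<^sub>m M = y0 ^\<^sub>m M * z" using pow_mat_commute[OF zc y0_c z(2)] .
  then obtain c c' where cz: "cj z = F.tor c c'" using cent[OF z(1)] by blast
  let ?S = "{y \<in> isometries n. y * z = z * y \<and> y ^\<^sub>m M = y0 ^\<^sub>m M * z}"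
  let ?A = "{a'. a' ^ M = a ^ M * c}" and ?B = "{b'. b' ^ M = b ^ M * c'}"
  have "?S \<subseteq> (\<lambda>(a', b'). g * F.tor a' b' * gi) ` (?A \<times> ?B)"
  proof
    fix y assume y: "y \<in> ?S"
    have yc: "y \<in> carrier_mat n n" using y isometries_carrier by blast
    have y0M: "y0 ^\<^sub>m M \<in> carrier_mat n n" using y0_c by simp
    have yM: "y ^\<^sub>m M = y0 ^\<^sub>m M * z" and yz: "y * z = z * y" using y by auto
    have "y * y0 ^\<^sub>m M * z = y * (y0 ^\<^sub>m M * z)" by (rule assoc_mult_mat[OF yc y0M zc])
    also have "\<dots> = y * y ^\<^sub>m M" by (simp only: yM)
    also have "\<dots> = y ^\<^sub>m M * y" by (rule pow_mat_commute[OF yc yc refl])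
    also have "\<dots> = y0 ^\<^sub>m M * z * y" by (simp only: yM)
    also have "\<dots> = y0 ^\<^sub>m M * (z * y)" by (rule assoc_mult_mat[OF y0M zc yc])
    also have "\<dots> = y0 ^\<^sub>m M * (y * z)" by (simp only: yz)
    also have "\<dots> = y0 ^\<^sub>m M * y * z" by (rule assoc_mult_mat[OF y0M yc zc, symmetric])
    finally have eq: "y * y0 ^\<^sub>m M * z = y0 ^\<^sub>m M * y * z" .
    obtain zi where "zi \<in> isometries n" "z * zi = 1\<^sub>m n" using isometries_inverse[OF z(1)] by blast
    then have "y * y0 ^\<^sub>m M = y0 ^\<^sub>m M * y"
      using mult_mat_cancel_right[of z n "y * y0 ^\<^sub>m M" "y0 ^\<^sub>m M * y" zi] eq isometries_carrier zc yc y0M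
      by (simp add: mult_carrier_mat[of _ n n _ n])
    then obtain a' b' where t: "cj y = F.tor a' b'" using cent y by blast
    have "cj (y ^\<^sub>m M) = cj (y0 ^\<^sub>m M * z)" using y by simp
    then have "F.tor (a' ^ M) (b' ^ M) = F.tor (a ^ M * c) (b ^ M * c')"
      using yc y0_c zc by (simp add: cj_power cj_mult t cj_y0 cz F.tor_power F.tor_mult)
    then have "(a', b') \<in> ?A \<times> ?B" using F.tor_inject by blast
    moreover have "y = g * F.tor a' b' * gi" using cj_inverse[OF yc] t by simp
    ultimately show "y \<in> (\<lambda>(a', b'). g * F.tor a' b' * gi) ` (?A \<times> ?B)"
      by (intro image_eqI[of _ _ "(a', b')"]) simp_all
  qed
  moreover have fin: "finite (?A \<times> ?B)" using card_power_eq_le(1)[OF M] by blast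
  ultimately have "card ?S \<le> card (?A \<times> ?B)" by (intro surj_card_le)
  also have "\<dots> \<le> M * M" unfolding card_cartesian_product by (intro mult_mono card_power_eq_le M) auto
  finally show ?thesis by (simp add: power2_eq_square)
qed

text \<open>Iterates of \<open>\<Phi>\<close> commute with powers, so a collision of eigenvalues
  would persist after taking \<open>M\<close>-th powers.\<close>

lemma good_inj:
  assumes "(a, b) \<in> good M k m"
  shows "inj_on (eigs k a b) {..<k + m}"
proof (rule inj_onI)
  fix i j assume *: "i \<in> {..<k + m}" "j \<in> {..<k + m}" "eigs k a b i = eigs k a b j"
  have "eigs k (a ^ M) (b ^ M) l = eigs k a b l ^ M" for l
    by (simp add: eigs_def funpow_\<Phi>_power)
  then have "eigs k (a ^ M) (b ^ M) i = eigs k (a ^ M) (b ^ M) j" using *(3) by simp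
  then show "i = j" using assms * by (auto simp: good_def dest: inj_onD)
qed

text \<open>Orbit counting: two isometries conjugate t to the same matrix only if they differ by an
  element of the centralizer of t, which lies in a torus with \<open>tau k * tau m\<close> elements.
  All conjugates share their eigenvalue set.\<close>

lemma card_regular_class:
  assumes km: "k > 0" "m > 0" "n = k + m" and ab: "(a, b) \<in> good M k m"
  shows "card (isometries n) \<le>
    card {y \<in> regular M n. {c. eigenvalue y c} = eigs k a b ` {..<n}} * (tau k * tau m)"
proof -
  have tor: "a \<in> torus k" "b \<in> torus m" using ab by (auto simp: good_def)
  have inj: "inj_on (eigs k a b) {..<n}" using good_inj[OF ab] km by simp
  obtain x xi where F: "torus_frame q e k m n x (xi :: 'l mat)"
    using ex_torus_frame[OF km(1,2) tor] inj km by metis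
  interpret F: torus_frame q e "TYPE('l)" k m n x xi by (rule F)
  define t where "t = F.tor a b"
  have tc [simp]: "t \<in> carrier_mat n n" by (simp add: t_def)
  have "\<forall>g\<in>isometries n. \<exists>gi. gi \<in> isometries n \<and> g * gi = 1\<^sub>m n \<and> gi * g = 1\<^sub>m n"
    using isometries_inverse by blast
  then obtain iv where iv: "\<And>g. g \<in> isometries n \<Longrightarrow> iv g \<in> isometries n \<and> g * iv g = 1\<^sub>m n \<and> iv g * g = 1\<^sub>m n"
    by metis
  define f where "f g = g * t * iv g" for g
  have conj: "mat_conj n g (iv g)" if "g \<in> isometries n" for g
    using iv[OF that] that isometries_carrier by unfold_locales auto
  have "card (isometries n) \<le> card (f ` isometries n) * (tau k * tau m)"
  proof (rule card_le_fibres[OF finite_isometries])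
    fix g0 assume g0: "g0 \<in> isometries n"
    interpret g0: mat_conj n g0 "iv g0" by (rule conj[OF g0])
    have "{g \<in> isometries n. f g = f g0} \<subseteq> (\<lambda>(a', b'). g0 * F.tor a' b') ` (torus k \<times> torus m)"
    proof
      fix g assume "g \<in> {g \<in> isometries n. f g = f g0}"
      then have g: "g \<in> isometries n" and fg: "g * t * iv g = g0 * t * iv g0" by (auto simp: f_def)
      interpret g: mat_conj n g "iv g" by (rule conj[OF g])
      note c [simp] = g0.g(1,2) g.g(1,2)
      define h where "h = iv g0 * g"
      have h: "h \<in> isometries n" unfolding h_def using g g0 iv by (intro isometries_mult) auto
      have hc: "h \<in> carrier_mat n n" using h isometries_carrier by blast
      have 1: "g * t = g0 * t * iv g0 * g"
      proof -
        have "g * t * iv g * g = g * t"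
          using g.g(4) by (simp add: assoc_mult_mat[of _ n n _ n _ n] mult_carrier_mat[of _ n n _ n] right_mult_one_mat[of t n n])
        then show ?thesis using fg by simp
      qed
      have "h * t = iv g0 * (g * t)" unfolding h_def by (simp add: assoc_mult_mat[of _ n n _ n _ n])
      also have "\<dots> = t * h"
        unfolding 1 h_def
        by (simp add: assoc_mult_mat[of _ n n _ n _ n] mult_carrier_mat[of _ n n _ n] g0.cancel)
      finally obtain a' b' where ab': "a' \<in> torus k" "b' \<in> torus m" "h = F.tor a' b'"
        using F.tor_centralizer[OF h inj] unfolding t_def by blast
      have "g = g0 * h" unfolding h_def by (simp add: g0.cancel)
      then show "g \<in> (\<lambda>(a', b'). g0 * F.tor a' b') ` (torus k \<times> torus m)" using ab' by auto
    qed
    moreover have fin: "finite (torus k \<times> torus m)" using finite_torus km by blast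
    ultimately have "card {g \<in> isometries n. f g = f g0} \<le> card (torus k \<times> torus m)"
      by (intro surj_card_le)
    then show "card {g \<in> isometries n. f g = f g0} \<le> tau k * tau m"
      using card_torus km by (simp add: card_cartesian_product)
  qed
  moreover have "card (f ` isometries n) \<le> card {y \<in> regular M n. {c. eigenvalue y c} = eigs k a b ` {..<n}}"
  proof (rule card_mono)
    have "finite (special_isometries n)"
      using finite_isometries by (rule finite_subset[rotated]) (auto simp: special_isometries_def)
    then show "finite {y \<in> regular M n. {c. eigenvalue y c} = eigs k a b ` {..<n}}"
      by (rule finite_subset[rotated]) (use regular_special in blast)
    show "f ` isometries n \<subseteq> {y \<in> regular M n. {c. eigenvalue y c} = eigs k a b ` {..<n}}"
    proof
      fix y assume "y \<in> f ` isometries n"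
      then obtain g where g: "g \<in> isometries n" "y = g * F.tor a b * iv g" by (auto simp: f_def t_def)
      interpret g: mat_conj n g "iv g" by (rule conj[OF g(1)])
      have "{c. eigenvalue y c} = eigs k a b ` {..<n}"
        unfolding g(2) by (rule F.eigenvalue_conj_tor[OF g.g])
      moreover have "y = g * (x * mat_diag n (eigs k a b) * xi) * iv g"
        using g(2) by (simp only: F.tor_def)
      then have "y \<in> regular M n"
        unfolding regular_def using F ab g(1) iv[OF g(1)]
        by (intro CollectI exI[of _ k] exI[of _ m] exI[of _ x] exI[of _ xi] exI[of _ a] exI[of _ b]
            exI[of _ g] exI[of _ "iv g"]) blast
      ultimately show "y \<in> {y \<in> regular M n. {c. eigenvalue y c} = eigs k a b ` {..<n}}" by simp
    qed
  qed
  ultimately show ?thesis by (meson le_refl mult_le_mono order.trans)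
qed

end

text \<open>Double counting with weights: at most \<open>w i\<close> indices share the value r of i,
  so their shares \<open>N r / w i\<close> add up to at most \<open>N r\<close>.\<close>

lemma sum_le_sum_image:
  fixes N :: "'b \<Rightarrow> real" and w :: "'a \<Rightarrow> real"
  assumes fin: "finite I" and N: "\<And>r. N r \<ge> 0"
    and w: "\<And>i. i \<in> I \<Longrightarrow> real (card {j \<in> I. f j = f i}) \<le> w i"
  shows "(\<Sum>i\<in>I. N (f i) / w i) \<le> (\<Sum>r\<in>f ` I. N r)"
proof -
  have "(\<Sum>i\<in>I. N (f i) / w i) = (\<Sum>r\<in>f ` I. \<Sum>i\<in>{i \<in> I. f i = r}. N (f i) / w i)"
    by (rule sum.image_gen[OF fin])
  also have "\<dots> \<le> (\<Sum>r\<in>f ` I. N r)"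
  proof (rule sum_mono)
    fix r assume "r \<in> f ` I"
    then obtain i0 where i0: "i0 \<in> I" "f i0 = r" by blast
    define c where "c = real (card {j \<in> I. f j = r})"
    have c: "c > 0" unfolding c_def using fin i0 by (auto simp: card_gt_0_iff)
    have "(\<Sum>i\<in>{i \<in> I. f i = r}. N (f i) / w i) \<le> (\<Sum>i\<in>{i \<in> I. f i = r}. N r / c)"
    proof (rule sum_mono)
      fix i assume i: "i \<in> {i \<in> I. f i = r}"
      then have "c \<le> w i" using w[of i] by (auto simp: c_def)
      then show "N (f i) / w i \<le> N r / c" using i c N by (auto intro!: divide_left_mono)
    qed
    also have "\<dots> = N r" using c by (simp add: c_def)
    finally show "(\<Sum>i\<in>{i \<in> I. f i = r}. N (f i) / w i) \<le> N r" .
  qed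
  finally show ?thesis .
qed

section \<open>Orbits of eigenvalues and the number of triples with the same eigenvalue set\<close>

context signed_frobenius
begin

definition orb :: "nat \<Rightarrow> 'l \<Rightarrow> 'l set" where "orb k a = (\<lambda>i. (\<Phi> ^^ i) a) ` {..<k}"

lemma orb_closed:
  assumes "a \<in> torus k" "x \<in> orb k a"
  shows "(\<Phi> ^^ i) x \<in> orb k a"
proof (induction i)
  case 0
  then show ?case using assms by simp
next
  case (Suc i)
  then obtain j where j: "j < k" "(\<Phi> ^^ i) x = (\<Phi> ^^ j) a" by (auto simp: orb_def)
  have eq: "(\<Phi> ^^ Suc i) x = (\<Phi> ^^ Suc j) a" using j by simp
  show ?case
  proof (cases "Suc j = k")
    case True
    then have "(\<Phi> ^^ Suc j) a = (\<Phi> ^^ 0) a" using assms(1) by (simp add: torus_def)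
    then show ?thesis unfolding eq orb_def using j by (intro image_eqI[of _ _ 0]) auto
  next
    case False
    then show ?thesis unfolding eq orb_def using j by (intro image_eqI[of _ _ "Suc j"]) auto
  qed
qed

lemma eigs_image: "eigs k a b ` {..<k + m} = orb k a \<union> orb m b"
proof -
  have "{..<k + m} = {..<k} \<union> (+) k ` {..<m}"
    by (simp add: lessThan_atLeast0 ivl_disj_un add.commute)
  moreover have "eigs k a b ` {..<k} = orb k a" unfolding orb_def by (intro image_cong) (auto simp: eigs_def)
  moreover have "eigs k a b ` (+) k ` {..<m} = orb m b"
    unfolding orb_def image_image by (intro image_cong) (auto simp: eigs_def)
  ultimately show ?thesis by (simp only: image_Un)
qed

lemma eigs_inj_iff:
  "inj_on (eigs k a b) {..<k + m} \<Longrightarrow> inj_on (\<lambda>i. (\<Phi> ^^ i) a) {..<k}"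
  "inj_on (eigs k a b) {..<k + m} \<Longrightarrow> inj_on (\<lambda>i. (\<Phi> ^^ i) b) {..<m}"
  "inj_on (eigs k a b) {..<k + m} \<Longrightarrow> orb k a \<inter> orb m b = {}"
proof -
  assume inj: "inj_on (eigs k a b) {..<k + m}"
  have 1: "i = j" if "eigs k a b i = eigs k a b j" "i < k + m" "j < k + m" for i j
    using inj that by (auto dest: inj_onD)
  show "inj_on (\<lambda>i. (\<Phi> ^^ i) a) {..<k}"
    by (rule inj_onI, rule 1) (auto simp: eigs_def)
  show "inj_on (\<lambda>i. (\<Phi> ^^ i) b) {..<m}"
  proof (rule inj_onI)
    fix i j assume "i \<in> {..<m}" "j \<in> {..<m}" "(\<Phi> ^^ i) b = (\<Phi> ^^ j) b"
    then show "i = j" using 1[of "k + i" "k + j"] by (simp add: eigs_def)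
  qed
  show "orb k a \<inter> orb m b = {}"
  proof (rule ccontr)
    assume "orb k a \<inter> orb m b \<noteq> {}"
    then obtain i j where "i < k" "j < m" "(\<Phi> ^^ i) a = (\<Phi> ^^ j) b" by (auto simp: orb_def)
    then show False using 1[of i "k + j"] by (simp add: eigs_def)
  qed
qed

text \<open>Periods are shared along an orbit. If the first k iterates are distinct and the k-th
  returns, then k is the exact period, so the lengths agree; an inclusion of orbits of equal size is
  an equality.\<close>

lemma orb_unique:
  assumes a: "a \<in> torus k" "inj_on (\<lambda>i. (\<Phi> ^^ i) a) {..<k}" and x: "x \<in> orb k a"
    and x': "x \<in> torus k'" "inj_on (\<lambda>i. (\<Phi> ^^ i) x) {..<k'}" and k: "0 < k" "0 < k'"
  shows "k' = k" "orb k' x = orb k a"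
proof -
  obtain i where i: "x = (\<Phi> ^^ i) a" using x by (auto simp: orb_def)
  have xk: "x \<in> torus k" "a \<in> torus k'" using a(1) x'(1) unfolding i by (auto simp: torus_funpow_\<Phi>_iff)
  show kk: "k' = k"
  proof (rule ccontr)
    assume "k' \<noteq> k"
    then consider "k < k'" | "k' < k" by linarith
    then show False
    proof cases
      case 1
      then show False using xk(1) k inj_onD[OF x'(2), of k 0] by (auto simp: torus_def)
    next
      case 2
      then show False using xk(2) k inj_onD[OF a(2), of k' 0] by (auto simp: torus_def)
    qed
  qed
  have "orb k x \<subseteq> orb k a" using orb_closed[OF a(1) x] by (auto simp: orb_def[of k x])
  moreover have "card (orb k x) = k" "card (orb k a) = k"
    using a(2) x'(2) kk by (auto simp: orb_def card_image)
  moreover have "finite (orb k a)" by (simp add: orb_def)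
  ultimately show "orb k' x = orb k a" unfolding kk by (metis card_subset_eq)
qed

definition good_triples :: "nat \<Rightarrow> nat \<Rightarrow> (nat \<times> 'l \<times> 'l) set" where
  "good_triples M n = (SIGMA k:{0<..<n}. good M k (n - k))"

definition eig_set :: "nat \<Rightarrow> nat \<times> 'l \<times> 'l \<Rightarrow> 'l set" where
  "eig_set n = (\<lambda>(k, a, b). eigs k a b ` {..<n})"

lemma finite_good: "k > 0 \<Longrightarrow> m > 0 \<Longrightarrow> finite (good M k m)"
  by (rule finite_subset[of _ "torus k \<times> torus m"]) (auto simp: good_def finite_torus)

lemma finite_good_triples: "finite (good_triples M n)"
  unfolding good_triples_def by (intro finite_SigmaI) (auto simp: finite_good)

lemma card_orb_le: "finite (orb k a)" "card (orb k a) \<le> k"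
  using card_image_le[of "{..<k}" "\<lambda>i. (\<Phi> ^^ i) a"] by (auto simp: orb_def)

text \<open>The eigenvalue set determines the two orbits up to order. A triple chooses the order and
  a starting point in each orbit.\<close>

lemma card_same_eig_set:
  assumes "(k, a, b) \<in> good_triples M n"
  shows "card {t \<in> good_triples M n. eig_set n t = eig_set n (k, a, b)} \<le> 2 * k * (n - k)"
proof -
  define m where "m = n - k"
  have km: "0 < k" "0 < m" "n = k + m" and ab: "(a, b) \<in> good M k m"
    using assms by (auto simp: good_triples_def m_def)
  have t: "a \<in> torus k" "b \<in> torus m" using ab by (auto simp: good_def)
  note I = eigs_inj_iff[OF good_inj[OF ab]]
  let ?S = "{t \<in> good_triples M n. eig_set n t = eig_set n (k, a, b)}"
  have "?S \<subseteq> {k} \<times> (orb k a \<times> orb m b) \<union> {m} \<times> (orb m b \<times> orb k a)"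
  proof
    fix s assume s: "s \<in> ?S"
    obtain k' a' b' where s_eq: "s = (k', a', b')" by (cases s)
    define m' where "m' = n - k'"
    have km': "0 < k'" "0 < m'" "n = k' + m'" and ab': "(a', b') \<in> good M k' m'"
      using s s_eq by (auto simp: good_triples_def m'_def)
    have t': "a' \<in> torus k'" "b' \<in> torus m'" using ab' by (auto simp: good_def)
    note I' = eigs_inj_iff[OF good_inj[OF ab']]
    have un: "orb k' a' \<union> orb m' b' = orb k a \<union> orb m b"
      using s eigs_image[of k a b m] eigs_image[of k' a' b' m'] by (simp add: s_eq eig_set_def flip: km(3) km'(3))
    have self: "a' \<in> orb k' a'" "b' \<in> orb m' b'"
      using km' by (auto simp: orb_def image_iff intro: bexI[of _ 0])
    consider "a' \<in> orb k a" | "a' \<in> orb m b" using un self by blast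
    then show "s \<in> {k} \<times> (orb k a \<times> orb m b) \<union> {m} \<times> (orb m b \<times> orb k a)"
    proof cases
      case 1
      note u = orb_unique[OF t(1) I(1) 1 t'(1) I'(1) km(1) km'(1)]
      then have "b' \<in> orb m b" using un self I'(3) by blast
      then show ?thesis using 1 u by (simp add: s_eq)
    next
      case 2
      note u = orb_unique[OF t(2) I(2) 2 t'(1) I'(1) km(2) km'(1)]
      then have "b' \<in> orb k a" using un self I'(3) by blast
      then show ?thesis using 2 u by (simp add: s_eq)
    qed
  qed
  then have "card ?S \<le> card ({k} \<times> (orb k a \<times> orb m b) \<union> {m} \<times> (orb m b \<times> orb k a))"
    by (intro card_mono) (auto simp: card_orb_le)
  also have "\<dots> \<le> card ({k} \<times> (orb k a \<times> orb m b)) + card ({m} \<times> (orb m b \<times> orb k a))"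
    by (rule card_Un_le)
  also have "\<dots> \<le> k * m + m * k"
    unfolding card_cartesian_product by (intro add_mono) (auto intro!: mult_le_mono card_orb_le)
  finally show ?thesis by (simp add: m_def algebra_simps)
qed

lemma finite_special_isometries: "finite (special_isometries n)"
  using finite_isometries by (rule finite_subset[rotated]) (auto simp: special_isometries_def)

lemma finite_regular: "finite (regular M n)"
  using finite_special_isometries by (rule finite_subset[rotated]) (use regular_special in blast)

text \<open>The regular elements split into disjoint parts according to their eigenvalue sets. Each
  triple contributes its part with weight 1/(2k(n-k)), and \<open>card_same_eig_set\<close> shows
  that no part is counted more than once in total.\<close>

lemma card_regular_ge:
  "real (card (special_isometries n)) *
     (\<Sum>k\<in>{0<..<n}. real (card (good M k (n - k))) * real (tau 1) /
        (real (tau k) * real (tau (n - k)) * (2 * real k * real (n - k))))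
   \<le> real (card (regular M n))"
proof -
  let ?S = "real (card (special_isometries n))"
  define I where "I = good_triples M n"
  define N where "N R = real (card {y \<in> regular M n. {c. eigenvalue y c} = R})" for R
  define w where "w = (\<lambda>(k, a::'l, b::'l). 2 * real k * real (n - k))"
  have finI: "finite I" by (simp add: I_def finite_good_triples)
  have "?S * (\<Sum>k\<in>{0<..<n}. real (card (good M k (n - k))) * real (tau 1) /
        (real (tau k) * real (tau (n - k)) * (2 * real k * real (n - k)))) =
     (\<Sum>k\<in>{0<..<n}. \<Sum>p\<in>good M k (n - k). ?S * real (tau 1) / (real (tau k) * real (tau (n - k))) / w (k, p))"
    unfolding sum_distrib_left by (rule sum.cong) (auto simp: w_def split_beta)
  also have "\<dots> = (\<Sum>t\<in>I. ?S * real (tau 1) / (real (tau (fst t)) * real (tau (n - fst t))) / w t)"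
    unfolding I_def good_triples_def by (subst sum.Sigma) (auto simp: finite_good split_beta)
  also have "\<dots> \<le> (\<Sum>t\<in>I. N (eig_set n t) / w t)"
  proof (rule sum_mono)
    fix t assume t: "t \<in> I"
    obtain k a b where t_eq: "t = (k, a, b)" by (cases t)
    have k: "0 < k" "k < n" and ab: "(a, b) \<in> good M k (n - k)"
      using t by (auto simp: I_def good_triples_def t_eq)
    have "tau 1 * card (special_isometries n) \<le> card (isometries n)"
      using k by (intro card_special_isometries) simp
    also have "\<dots> \<le> card {y \<in> regular M n. {c. eigenvalue y c} = eigs k a b ` {..<n}} * (tau k * tau (n - k))"
      by (rule card_regular_class[OF _ _ _ ab]) (use k in auto)
    finally have "real (tau 1 * card (special_isometries n)) \<le> N (eig_set n t) * (real (tau k) * real (tau (n - k)))"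
      unfolding N_def eig_set_def t_eq by (simp flip: of_nat_mult)
    then have "?S * real (tau 1) / (real (tau k) * real (tau (n - k))) \<le> N (eig_set n t)"
      using tau_pos[of k] tau_pos[of "n - k"] k by (simp add: divide_le_eq mult.commute)
    then show "?S * real (tau 1) / (real (tau (fst t)) * real (tau (n - fst t))) / w t \<le> N (eig_set n t) / w t"
      unfolding t_eq by (intro divide_right_mono) (auto simp: w_def)
  qed
  also have "\<dots> \<le> (\<Sum>R\<in>eig_set n ` I. N R)"
  proof (rule sum_le_sum_image[OF finI])
    fix t assume t: "t \<in> I"
    obtain k a b where t_eq: "t = (k, a, b)" by (cases t)
    have "card {s \<in> I. eig_set n s = eig_set n t} \<le> 2 * k * (n - k)"
      using card_same_eig_set[of k a b M n] t by (simp add: I_def t_eq)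
    then have "real (card {s \<in> I. eig_set n s = eig_set n t}) \<le> real (2 * k * (n - k))"
      by (rule of_nat_mono)
    then show "real (card {s \<in> I. eig_set n s = eig_set n t}) \<le> w t"
      by (simp add: w_def t_eq)
  qed (simp add: N_def)
  also have "\<dots> = real (card (\<Union>R\<in>eig_set n ` I. {y \<in> regular M n. {c. eigenvalue y c} = R}))"
    unfolding N_def using finI finite_regular by (subst card_UN_disjoint) auto
  also have "\<dots> \<le> real (card (regular M n))"
    using finite_regular by (intro of_nat_mono card_mono) auto
  finally show ?thesis .
qed

end

section \<open>Harmonic sums\<close>

text \<open>Telescoping of ln(k+1) - ln k = ln(1 + 1/k) <= 1/k; the case \<open>K = Suc L\<close> is
  the empty sum.\<close>

lemma sum_inverse_ge_ln:
  assumes "1 \<le> K" "K \<le> Suc L"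
  shows "ln (real (Suc L)) - ln (real K) \<le> (\<Sum>k=K..L. 1 / real k)"
  using assms(2)
proof (induction L)
  case 0
  then show ?case using assms(1) by (cases "K = 1") auto
next
  case (Suc L)
  show ?case
  proof (cases "K = Suc (Suc L)")
    case False
    then have K: "K \<le> Suc L" using Suc.prems by simp
    have "ln (real (Suc (Suc L))) - ln (real (Suc L)) = ln (1 + 1 / real (Suc L))"
    proof -
      have "1 + 1 / real (Suc L) = real (Suc (Suc L)) / real (Suc L)" by (simp add: field_simps)
      then show ?thesis by (simp add: ln_div del: of_nat_Suc)
    qed
    also have "\<dots> \<le> 1 / real (Suc L)" by (rule ln_add_one_self_le_self) simp
    finally show ?thesis using Suc.IH[OF K] K by simp
  qed simp
qed

text \<open>Partial fractions, and the symmetry that exchanges k and n - k.\<close>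

lemma sum_inverse_products:
  assumes "1 \<le> K" "2 * K \<le> n"
  shows "(\<Sum>k=K..n - K. 1 / (real k * real (n - k))) = 2 / real n * (\<Sum>k=K..n - K. 1 / real k)"
proof -
  have "(\<Sum>k=K..n - K. 1 / (real k * real (n - k))) =
      (\<Sum>k=K..n - K. 1 / real n * (1 / real k + 1 / real (n - k)))"
    using assms by (intro sum.cong) (auto simp: field_simps of_nat_diff)
  also have "\<dots> = 1 / real n * ((\<Sum>k=K..n - K. 1 / real k) + (\<Sum>k=K..n - K. 1 / real (n - k)))"
    by (simp only: sum_distrib_left[symmetric] sum.distrib)
  also have "(\<Sum>k=K..n - K. 1 / real (n - k)) = (\<Sum>k=K..n - K. 1 / real k)"
    using assms by (intro sum.reindex_bij_witness[of _ "\<lambda>k. n - k" "\<lambda>k. n - k"]) auto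
  finally show ?thesis by (simp add: field_simps)
qed

text \<open>With all k available, the weight 1/2 gives 1/(2n) times the harmonic sum up to n - 1,
  and this sum is at least ln n.\<close>

lemma half_harmonic_bound:
  assumes n: "n \<ge> 2" and \<gamma>: "\<And>k. 0 < k \<Longrightarrow> k < n \<Longrightarrow> 1 / 2 \<le> \<gamma> k"
  shows "ln (real n) / (2 * real n) \<le> (\<Sum>k\<in>{0<..<n}. \<gamma> k / (2 * real k * real (n - k)))"
proof -
  have set: "{0<..<n} = {1..n - 1}" by auto
  have "ln (real n) / (2 * real n) \<le> 1 / 4 * (2 / real n * (\<Sum>k=1..n - 1. 1 / real k))"
    using sum_inverse_ge_ln[of 1 "n - 1"] n by (simp add: field_simps)
  also have "\<dots> = (\<Sum>k=1..n - 1. (1 / 2) / (2 * real k * real (n - k)))"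
  proof -
    have "(\<Sum>k=1..n - 1. (1 / 2) / (2 * real k * real (n - k))) = 1 / 4 * (\<Sum>k=1..n - 1. 1 / (real k * real (n - k)))"
      unfolding sum_distrib_left by (intro sum.cong) auto
    then show ?thesis using sum_inverse_products[of 1 n] n by simp
  qed
  also have "\<dots> \<le> (\<Sum>k\<in>{0<..<n}. \<gamma> k / (2 * real k * real (n - k)))"
    unfolding set using \<gamma> by (intro sum_mono divide_right_mono) auto
  finally show ?thesis .
qed

text \<open>Cutting off the ends and the middle lowers the harmonic sum from ln n to no less than ln
  n - (ln 2 + ln K + 1). With weight 3/4 instead of 1/2 this is affordable as soon as ln n is three
  times the loss.\<close>

lemma tail_harmonic_bound:
  assumes K: "K \<ge> 1" and n: "n \<ge> (6 * K) ^ 3" and \<gamma>0: "\<And>k. \<gamma> k \<ge> 0"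
    and \<gamma>: "\<And>k. K \<le> k \<Longrightarrow> k \<le> n - K \<Longrightarrow> k \<noteq> n - k \<Longrightarrow> 3 / 4 \<le> \<gamma> k"
  shows "ln (real n) / (2 * real n) \<le> (\<Sum>k\<in>{0<..<n}. \<gamma> k / (2 * real k * real (n - k)))"
proof -
  have "6 * K \<le> (6 * K) ^ 3" using K by (intro self_le_power) auto
  then have nK: "6 * K \<le> n" using n by linarith
  let ?mid = "{k. k = n - k} \<inter> {K..n - K}"
  define S where "S = (\<Sum>k=K..n - K. 1 / real k)"
  have lnS: "ln (real n) - ln 2 - ln (real K) \<le> S"
  proof -
    have "ln (real n / 2) \<le> ln (real (Suc (n - K)))"
      using nK K by (subst ln_le_cancel_iff) (auto simp: of_nat_diff)
    moreover have "K \<le> Suc (n - K)" using nK by linarith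
    ultimately show ?thesis
      using sum_inverse_ge_ln[of K "n - K"] nK K by (simp add: S_def ln_div)
  qed
  \<comment> \<open>Origin of (6K)^3: ln(6K) = ln 2 + ln 3 + ln K, and ln 3 >= 1 pays for the middle
    term.\<close>
  have ln_n: "3 * (ln 2 + ln (real K) + 1) \<le> ln (real n)"
  proof -
    have "1 \<le> ln (3::real)" using exp_le by (simp add: ln_ge_iff)
    moreover have "ln (6 * real K) = ln 2 + ln 3 + ln (real K)"
      using K ln_mult[of "2 * 3" "real K"] ln_mult[of 2 "3::real"] by simp
    moreover have "3 * ln (6 * real K) \<le> ln (real n)"
    proof -
      have "3 * ln (6 * real K) = ln ((6 * real K) ^ 3)" using K ln_realpow[of "6 * real K" 3] by (simp only: of_nat_numeral)
      also have "(6 * real K) ^ 3 = real ((6 * K) ^ 3)" by simp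
      also have "ln \<dots> \<le> ln (real n)" using K nK n by (subst ln_le_cancel_iff) (auto simp del: of_nat_power)
      finally show ?thesis .
    qed
    ultimately have "1 \<le> ln (3::real)" "3 * (ln 2 + ln 3 + ln (real K)) \<le> ln (real n)" by simp_all
    then show ?thesis unfolding distrib_left by linarith
  qed
  \<comment> \<open>At most the index n/2 is concerned; its term is at most 2/n, which amounts to a
    loss of 1 in S.\<close>
  have mid: "(\<Sum>k\<in>?mid. 1 / (real k * real (n - k))) \<le> 2 / real n * 1"
  proof -
    have "?mid \<subseteq> {n div 2}" by auto
    then have "(\<Sum>k\<in>?mid. 1 / (real k * real (n - k))) \<le> (\<Sum>k\<in>{n div 2}. 1 / (real k * real (n - k)))"
      by (intro sum_mono2) auto
    also have "\<dots> = 1 / (real (n div 2) * real (n - n div 2))" by simp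
    also have "\<dots> \<le> 1 / (1 * (real n / 2))"
      using nK K by (intro divide_left_mono mult_mono) (auto simp: of_nat_diff)
    finally show ?thesis by simp
  qed
  have "ln (real n) / (2 * real n) \<le> 3 / 8 * (2 / real n * (S - 1))"
  proof -
    have "1 / 2 * ln (real n) \<le> 3 / 4 * (S - 1)"
      using lnS ln_n unfolding distrib_left right_diff_distrib by linarith
    then have "1 / 2 * ln (real n) / real n \<le> 3 / 4 * (S - 1) / real n"
      by (intro divide_right_mono) auto
    moreover have "3 / 4 * (S - 1) / real n = 3 / 8 * (2 / real n * (S - 1))"
      using nK K by (simp add: field_simps)
    ultimately show ?thesis by simp
  qed
  also have "\<dots> \<le> 3 / 8 * ((\<Sum>k=K..n - K. 1 / (real k * real (n - k))) - (\<Sum>k\<in>?mid. 1 / (real k * real (n - k))))"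
    using sum_inverse_products[OF K, of n] mid nK by (simp add: S_def right_diff_distrib)
  also have "\<dots> = 3 / 8 * (\<Sum>k\<in>{K..n - K} - ?mid. 1 / (real k * real (n - k)))"
    by (subst sum_diff) auto
  also have "\<dots> = (\<Sum>k\<in>{K..n - K} - ?mid. (3 / 4) / (2 * real k * real (n - k)))"
    by (simp add: sum_distrib_left field_simps)
  also have "\<dots> \<le> (\<Sum>k\<in>{K..n - K} - ?mid. \<gamma> k / (2 * real k * real (n - k)))"
    using \<gamma> by (intro sum_mono divide_right_mono) auto
  also have "\<dots> \<le> (\<Sum>k\<in>{0<..<n}. \<gamma> k / (2 * real k * real (n - k)))"
    using K nK \<gamma>0 by (intro sum_mono2) auto
  finally show ?thesis .
qed

section \<open>The proportion of good pairs\<close>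

context signed_frobenius
begin

text \<open>The constant 4 reproduces itself: 4 q^D is at most 2 q^(D+1), and the new summand is at
  most q^(D+1) + 1.\<close>

lemma sum_tau_le: "(\<Sum>d=1..D. tau d) \<le> 4 * q ^ D"
proof (induction D)
  case (Suc D)
  have "2 * q ^ D \<le> q ^ Suc D" using q2 by simp
  moreover have "1 \<le> q ^ Suc D" using q2 by simp
  moreover have "(\<Sum>d=1..Suc D. tau d) = (\<Sum>d=1..D. tau d) + tau (Suc D)" by simp
  ultimately show ?case using Suc.IH tau_bounds(1)[of "Suc D"] by linarith
qed simp

lemma tau_ge_half: "k > 0 \<Longrightarrow> real q ^ k / 2 \<le> real (tau k)"
proof -
  assume k: "k > 0"
  have "2 \<le> q ^ k" using q2 k self_le_power[of q k] by linarith
  then have "q ^ k \<le> 2 * tau k" using tau_bounds(2)[of k] by linarith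
  then have "real (q ^ k) \<le> real (2 * tau k)" by (rule of_nat_mono)
  then show ?thesis by simp
qed

lemma short_fraction_le:
  assumes "k > 0"
  shows "real (\<Sum>d=1..k div 2. M * tau d) / real (tau k) \<le> 8 * real M / real q ^ (k - k div 2)"
proof -
  have "(\<Sum>d=1..k div 2. M * tau d) \<le> M * (4 * q ^ (k div 2))"
    using sum_tau_le[of "k div 2"] unfolding sum_distrib_left[symmetric] by (rule mult_le_mono2)
  then have "real (\<Sum>d=1..k div 2. M * tau d) \<le> real (M * (4 * q ^ (k div 2)))" by (rule of_nat_mono)
  then have "real (\<Sum>d=1..k div 2. M * tau d) / real (tau k) \<le> (4 * real M * real q ^ (k div 2)) / (real q ^ k / 2)"
    using tau_ge_half[OF assms] q2 by (intro frac_le) auto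
  also have "real q ^ k = real q ^ (k - k div 2) * real q ^ (k div 2)"
    by (simp flip: power_add)
  finally show ?thesis using q2 by simp
qed

text \<open>This is \<open>card_good_ge\<close> divided by the number of pairs with norm product 1,
  which is \<open>tau k * tau m / tau 1\<close>. The losses from short orbits decay exponentially in
  k and m, whereas the loss for k = m decays only with q.\<close>

lemma good_fraction_ge:
  assumes k: "k > 0" and m: "m > 0" and M: "M > 0"
  shows "1 - 8 * real M / real q ^ (k - k div 2) - 8 * real M / real q ^ (m - m div 2)
      - (if k = m then 4 * real M / real q else 0) \<le>
    real (card (good M k m)) * real (tau 1) / (real (tau k) * real (tau m))"
proof -
  define B where "B k = real (\<Sum>d=1..k div 2. M * tau d)" for k
  define t where "t k = real (tau k)" for k
  define s where "s k = real (ker_card k)" for k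
  define C where "C = real (card (good M k m))"
  have t: "t k > 0" "t m > 0" "t 1 > 0" using tau_pos k m by (auto simp: t_def)
  have ts: "t k = t 1 * s k" "t m = t 1 * s m"
    using tau_eq[of k] tau_eq[of m] by (auto simp: t_def s_def)
  have s: "s k > 0" "s m > 0" using t ts by (auto simp: zero_less_mult_iff)
  have "real (tau k * ker_card m) \<le> real (card (good M k m) +
     (\<Sum>d=1..k div 2. M * tau d) * ker_card m + (\<Sum>d=1..m div 2. M * tau d) * ker_card k +
     (if k = m then 2 * M * ker_card k * ker_card k else 0))"
    by (intro of_nat_mono card_good_ge assms)
  then have main: "t k * s m \<le> C + B k * s m + B m * s k + (if k = m then 2 * real M * s k * s k else 0)"
    unfolding t_def s_def C_def B_def by (cases "k = m") simp_all
  have "1 = (t k * s m) / (t k * s m)" using t s by simp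
  also have "\<dots> \<le> (C + B k * s m + B m * s k + (if k = m then 2 * real M * s k * s k else 0)) / (t k * s m)"
    using main t s by (intro divide_right_mono) auto
  also have "\<dots> = C * t 1 / (t k * t m) + B k / t k + B m / t m + (if k = m then 2 * real M / t 1 else 0)"
    using t s by (auto simp: ts field_simps)
  finally have "1 \<le> C * t 1 / (t k * t m) + B k / t k + B m / t m + (if k = m then 2 * real M / t 1 else 0)" .
  moreover have "B k / t k \<le> 8 * real M / real q ^ (k - k div 2)" "B m / t m \<le> 8 * real M / real q ^ (m - m div 2)"
    using short_fraction_le k m by (auto simp: B_def t_def)
  moreover have "2 * real M / t 1 \<le> 4 * real M / real q"
  proof -
    have "2 * real M / t 1 \<le> 2 * real M / (real q / 2)"
      using tau_ge_half[of 1] q2 by (intro divide_left_mono) (auto simp: t_def)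
    then show ?thesis by simp
  qed
  ultimately show ?thesis unfolding C_def t_def by (auto split: if_splits)
qed

lemma good_sum_ge:
  assumes M: "M > 0" and n: "n \<ge> 2" and large: "q \<ge> 40 * M \<or> n \<ge> (768 * M) ^ 3"
  shows "ln (real n) / (2 * real n) \<le> (\<Sum>k\<in>{0<..<n}. real (card (good M k (n - k))) * real (tau 1) /
        (real (tau k) * real (tau (n - k)) * (2 * real k * real (n - k))))"
proof -
  define \<gamma> where "\<gamma> k = real (card (good M k (n - k))) * real (tau 1) / (real (tau k) * real (tau (n - k)))" for k
  have "ln (real n) / (2 * real n) \<le> (\<Sum>k\<in>{0<..<n}. \<gamma> k / (2 * real k * real (n - k)))"
    using large
  proof
    assume q: "q \<ge> 40 * M"
    then have q': "40 * real M \<le> real q" by (metis of_nat_mono of_nat_mult of_nat_numeral)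
    have le: "8 * real M / real q ^ (k - k div 2) \<le> 1 / 5" if "k > 0" for k
    proof -
      have "real q ^ 1 \<le> real q ^ (k - k div 2)" using q2 that by (intro power_increasing) auto
      then have "40 * real M \<le> real q ^ (k - k div 2)" using q' unfolding power_one_right by linarith
      then show ?thesis using q2 by (simp add: field_simps)
    qed
    show ?thesis
    proof (rule half_harmonic_bound[OF n])
      fix k assume k: "0 < k" "k < n"
      \<comment> \<open>The losses add up to at most 1/5 + 1/5 + 1/10 = 1/2.\<close>
      have "4 * real M / real q \<le> 1 / 10" using q' q2 by (simp add: field_simps)
      then show "1 / 2 \<le> \<gamma> k"
        using good_fraction_ge[OF k(1) _ M, of "n - k"] le[OF k(1)] le[of "n - k"] k
        unfolding \<gamma>_def by (auto split: if_splits)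
    qed
  next
    assume n3: "n \<ge> (768 * M) ^ 3"
    \<comment> \<open>The threshold 128 M makes the exponent at least 64 M, and 2^(64 M) exceeds 64
      M; two losses of 1/8 leave 3/4. The factor 768 in the bound on n is 6 * 128.\<close>
    have le: "8 * real M / real q ^ (k - k div 2) \<le> 1 / 8" if "128 * M \<le> k" for k
    proof -
      have "64 * M \<le> k - k div 2" using that by linarith
      then have "(2::real) ^ (64 * M) \<le> 2 ^ (k - k div 2)" by (intro power_increasing) auto
      also have "\<dots> \<le> real q ^ (k - k div 2)" using q2 by (intro power_mono) auto
      finally have "2 ^ (64 * M) \<le> real q ^ (k - k div 2)" .
      moreover have "64 * real M \<le> 2 ^ (64 * M)"
        using of_nat_less_two_power[of "64 * M", where 'a = real] by simp
      ultimately have "64 * real M \<le> real q ^ (k - k div 2)" by linarith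
      then show ?thesis using q2 by (simp add: field_simps)
    qed
    show ?thesis
    proof (rule tail_harmonic_bound[of "128 * M"])
      fix k assume k: "128 * M \<le> k" "k \<le> n - 128 * M" "k \<noteq> n - k"
      have "768 * M \<le> (768 * M) ^ 3" using M by (intro self_le_power) auto
      then have "k > 0" "n - k > 0" "128 * M \<le> n - k" using k M n3 by linarith+
      then show "3 / 4 \<le> \<gamma> k"
        using good_fraction_ge[of k "n - k" M] M le[OF k(1)] le[of "n - k"] k(3) unfolding \<gamma>_def by simp
    qed (use M n3 in \<open>auto simp: \<gamma>_def\<close>)
  qed
  then show ?thesis by (simp add: \<gamma>_def)
qed

end

section \<open>Linear and unitary groups over a finite field\<close>

lemma group_center_subset: "group_center G \<subseteq> carrier G"
  unfolding group_center_def by blast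

lemma group_center_commute:
  "z \<in> group_center G \<Longrightarrow> g \<in> carrier G \<Longrightarrow> z \<otimes>\<^bsub>G\<^esub> g = g \<otimes>\<^bsub>G\<^esub> z"
  unfolding group_center_def by blast

lemma (in group) center_normal: "group_center G \<lhd> G"
proof (rule normalI)
  show "subgroup (group_center G) G"
  proof (rule subgroupI)
    have "\<one> \<in> group_center G" by (simp add: group_center_def)
    then show "group_center G \<noteq> {}" by blast
  next
    fix a assume a: "a \<in> group_center G"
    show "inv a \<in> group_center G"
      unfolding group_center_def
    proof (intro CollectI conjI ballI)
      show "inv a \<in> carrier G" using a group_center_subset[of G] by auto
      fix g assume g: "g \<in> carrier G"
      have "a \<otimes> g = g \<otimes> a" "a \<in> carrier G"
        using group_center_commute[OF a g] a group_center_subset[of G] by auto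
      then show "inv a \<otimes> g = g \<otimes> inv a"
        using g by (metis inv_closed inv_solve_left inv_solve_right m_assoc m_closed)
    qed
  next
    fix a b assume ab: "a \<in> group_center G" "b \<in> group_center G"
    then have c: "a \<in> carrier G" "b \<in> carrier G" using group_center_subset[of G] by auto
    have "a \<otimes> b \<otimes> g = g \<otimes> (a \<otimes> b)" if g: "g \<in> carrier G" for g
    proof -
      have comm: "a \<otimes> g = g \<otimes> a" "b \<otimes> g = g \<otimes> b" using ab g unfolding group_center_def by blast+
      have "a \<otimes> b \<otimes> g = a \<otimes> (g \<otimes> b)" using c g by (simp only: m_assoc comm)
      also have "\<dots> = a \<otimes> g \<otimes> b" using c g by (simp only: m_assoc)
      also have "\<dots> = g \<otimes> a \<otimes> b" by (simp only: comm)
      finally show ?thesis using c g by (simp only: m_assoc)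
    qed
    then show "a \<otimes> b \<in> group_center G" using c by (simp add: group_center_def)
  qed (rule group_center_subset)
  show "\<forall>x\<in>carrier G. group_center G #> x = x <# group_center G"
    unfolding r_coset_def l_coset_def using group_center_commute[of _ G] by (intro ballI SUP_cong) simp_all
qed

text \<open>Two elements have the same \<open>M\<close>-th power modulo the centre Z if and only if
  these powers differ by some z in Z, so a fibre has at most |Z| c elements. The second part
  supplies the factor |Z| that cancels this one.\<close>

lemma (in group) card_power_word_image_quotient:
  assumes fin: "finite (carrier G)" and Y: "Y \<subseteq> carrier G"
    and c: "\<And>y z. y \<in> Y \<Longrightarrow> z \<in> group_center G \<Longrightarrow>
      card {y' \<in> Y. y' [^] M = y [^] M \<otimes> z} \<le> c"
  shows "card Y \<le> card (power_word_image M (G Mod group_center G)) * (card (group_center G) * c)"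
    "order (G Mod group_center G) * card (group_center G) = order G"
proof -
  let ?Z = "group_center G"
  interpret N: normal ?Z G by (rule center_normal)
  show "order (G Mod ?Z) * card ?Z = order G"
  proof -
    have "order (G Mod ?Z) = card (rcosets ?Z)" unfolding Coset.order_def FactGroup_def by simp
    then show ?thesis by (simp only: lagrange[OF N.subgroup_axioms])
  qed
  have finZ: "finite ?Z" by (rule finite_subset[OF group_center_subset fin])
  have finY: "finite Y" using fin Y finite_subset by blast
  define f where "f y = ?Z #> (y [^] M)" for y
  have "card Y \<le> card (f ` Y) * (card ?Z * c)"
  proof (rule card_le_fibres[OF finY])
    fix y assume y: "y \<in> Y"
    have "{y' \<in> Y. f y' = f y} \<subseteq> (\<Union>z\<in>?Z. {y' \<in> Y. y' [^] M = y [^] M \<otimes> z})"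
    proof
      fix y' assume "y' \<in> {y' \<in> Y. f y' = f y}"
      then have y': "y' \<in> Y" "?Z #> (y' [^] M) = ?Z #> (y [^] M)" by (auto simp: f_def)
      have "y' [^] M \<in> ?Z #> (y' [^] M)"
        using y' Y N.subgroup_axioms by (intro rcos_self) auto
      then have "y' [^] M \<in> ?Z #> (y [^] M)" using y'(2) by simp
      then obtain z where z: "z \<in> ?Z" "y' [^] M = z \<otimes> y [^] M" by (auto simp: r_coset_def)
      then have "y' [^] M = y [^] M \<otimes> z"
        using group_center_commute[OF z(1), of "y [^] M"] y Y by auto
      then show "y' \<in> (\<Union>z\<in>?Z. {y' \<in> Y. y' [^] M = y [^] M \<otimes> z})" using z y' by blast
    qed
    then have "card {y' \<in> Y. f y' = f y} \<le> card (\<Union>z\<in>?Z. {y' \<in> Y. y' [^] M = y [^] M \<otimes> z})"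
      using finY finZ by (intro card_mono) auto
    also have "\<dots> \<le> (\<Sum>z\<in>?Z. card {y' \<in> Y. y' [^] M = y [^] M \<otimes> z})" by (rule card_UN_le[OF finZ])
    also have "\<dots> \<le> (\<Sum>z\<in>?Z. c)" using c[OF y] by (intro sum_mono)
    finally show "card {y' \<in> Y. f y' = f y} \<le> card ?Z * c" by simp
  qed
  moreover have "card (f ` Y) \<le> card (power_word_image M (G Mod ?Z))"
  proof (rule card_mono)
    have "carrier (G Mod ?Z) = (\<lambda>a. ?Z #> a) ` carrier G"
      by (auto simp: FactGroup_def RCOSETS_def)
    then show "finite (power_word_image M (G Mod ?Z))" using fin by (simp add: power_word_image_def)
    show "f ` Y \<subseteq> power_word_image M (G Mod ?Z)"
    proof
      fix w assume "w \<in> f ` Y"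
      then obtain y where y: "y \<in> Y" "w = ?Z #> (y [^] M)" by (auto simp: f_def)
      then have "w = (?Z #> y) [^]\<^bsub>G Mod ?Z\<^esub> M" using N.FactGroup_pow[of y M] Y by auto
      moreover have "?Z #> y \<in> carrier (G Mod ?Z)" using y Y by (auto simp: FactGroup_def RCOSETS_def)
      ultimately show "w \<in> power_word_image M (G Mod ?Z)" by (auto simp: power_word_image_def)
    qed
  qed
  ultimately show "card Y \<le> card (power_word_image M (G Mod ?Z)) * (card ?Z * c)"
    by (meson le_refl mult_le_mono order.trans)
qed

section \<open>Transfer of SL and SU to matrices over L\<close>

definition lin_group :: "lin_type \<Rightarrow> nat \<Rightarrow> nat \<Rightarrow> nat ring \<Rightarrow> nat mat monoid" where
  "lin_group \<epsilon> n q F = (case \<epsilon> of Plus \<Rightarrow> SL n F | Minus \<Rightarrow> SU n q F)"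

lemma PSL_eps_eq: "PSL_eps \<epsilon> n q F = lin_group \<epsilon> n q F Mod group_center (lin_group \<epsilon> n q F)"
  by (cases \<epsilon>) (auto simp: lin_group_def PSL_def PSU_def)

text \<open>The assumption \<open>h_image\<close> identifies the image of F with the subfield of
  order q or q^2 of L; without it the map on matrices would be injective but not known to reach all
  special isometries.\<close>

locale embedded_group = signed_frobenius q e ty
  for q :: nat and e :: int and ty :: "'l::alg_closed_field itself" +
  fixes F :: "nat ring" and h :: "nat \<Rightarrow> 'l" and \<epsilon> :: lin_type and n :: nat
  assumes F: "cring F"
    and e_def: "e = (case \<epsilon> of Plus \<Rightarrow> int q | Minus \<Rightarrow> - int q)"
    and h_add: "\<And>x y. x \<in> carrier F \<Longrightarrow> y \<in> carrier F \<Longrightarrow> h (x \<oplus>\<^bsub>F\<^esub> y) = h x + h y"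
    and h_mult: "\<And>x y. x \<in> carrier F \<Longrightarrow> y \<in> carrier F \<Longrightarrow> h (x \<otimes>\<^bsub>F\<^esub> y) = h x * h y"
    and h_one: "h \<one>\<^bsub>F\<^esub> = 1"
    and h_inj: "inj_on h (carrier F)"
    and h_image: "h ` carrier F = {x. x ^ entry_field_order \<epsilon> q = x}"
begin

sublocale F: cring F by (rule F)

lemma h_zero: "h \<zero>\<^bsub>F\<^esub> = 0"
proof -
  have "h \<zero>\<^bsub>F\<^esub> = h \<zero>\<^bsub>F\<^esub> + h \<zero>\<^bsub>F\<^esub>"
    using h_add[OF F.zero_closed F.zero_closed] by (simp only: F.r_zero[OF F.zero_closed])
  then show ?thesis by (simp only: add_cancel_right_right)
qed

lemma h_minus: "x \<in> carrier F \<Longrightarrow> h (\<ominus>\<^bsub>F\<^esub> x) = - h x"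
  using h_add[of "\<ominus>\<^bsub>F\<^esub> x" x] by (simp add: F.l_neg h_zero eq_neg_iff_add_eq_0)

lemma h_finsum: "finite A \<Longrightarrow> (\<And>a. a \<in> A \<Longrightarrow> f a \<in> carrier F) \<Longrightarrow> h (finsum F f A) = (\<Sum>a\<in>A. h (f a))"
proof (induction A rule: finite_induct)
  case (insert a A)
  then show ?case by (simp add: h_add Pi_def)
qed (simp add: h_zero)

lemma h_finprod: "finite A \<Longrightarrow> (\<And>a. a \<in> A \<Longrightarrow> f a \<in> carrier F) \<Longrightarrow> h (finprod F f A) = (\<Prod>a\<in>A. h (f a))"
proof (induction A rule: finite_induct)
  case (insert a A)
  then show ?case by (simp add: h_mult Pi_def)
qed (simp add: h_one)

lemma h_pow: "x \<in> carrier F \<Longrightarrow> h (x [^]\<^bsub>F\<^esub> (r::nat)) = h x ^ r"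
  by (induction r) (simp_all add: h_one h_mult mult.commute)

abbreviation \<phi> :: "nat mat \<Rightarrow> 'l mat" where "\<phi> \<equiv> map_mat h"

lemma mats_overD: "A \<in> mats_over F n \<Longrightarrow> A \<in> carrier_mat n n"
  "A \<in> mats_over F n \<Longrightarrow> i < n \<Longrightarrow> j < n \<Longrightarrow> A $$ (i, j) \<in> carrier F"
  by (auto simp: mats_over_def)

lemma mats_overI: "A \<in> carrier_mat n n \<Longrightarrow> (\<And>i j. i < n \<Longrightarrow> j < n \<Longrightarrow> A $$ (i, j) \<in> carrier F) \<Longrightarrow> A \<in> mats_over F n"
  by (auto simp: mats_over_def)

lemma \<phi>_inj: "inj_on \<phi> (mats_over F n)"
proof (rule inj_onI)
  fix A B assume AB: "A \<in> mats_over F n" "B \<in> mats_over F n" "\<phi> A = \<phi> B"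
  note c = AB(1,2)[THEN mats_overD(1)]
  show "A = B"
  proof (rule eq_matI)
    fix i j assume "i < dim_row B" "j < dim_col B"
    then have ij: "i < n" "j < n" using c by auto
    have "h (A $$ (i, j)) = h (B $$ (i, j))"
      using arg_cong[OF AB(3), of "\<lambda>C. C $$ (i, j)"] c ij by simp
    then show "A $$ (i, j) = B $$ (i, j)"
      using inj_onD[OF h_inj] mats_overD(2)[OF AB(1) ij] mats_overD(2)[OF AB(2) ij] by blast
  qed (use c in auto)
qed

lemma mult_over_closed:
  assumes "A \<in> mats_over F n" "B \<in> mats_over F n"
  shows "mat_mult_over F n A B \<in> mats_over F n" "\<phi> (mat_mult_over F n A B) = \<phi> A * \<phi> B"
proof -
  note c = assms[THEN mats_overD(1)]
  note d = mats_overD(2)[OF assms(1)] mats_overD(2)[OF assms(2)]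
  show "mat_mult_over F n A B \<in> mats_over F n"
    by (rule mats_overI) (use d in \<open>auto simp: mat_mult_over_def intro!: F.finsum_closed\<close>)
  show "\<phi> (mat_mult_over F n A B) = \<phi> A * \<phi> B"
  proof (rule eq_matI)
    fix i j assume "i < dim_row (\<phi> A * \<phi> B)" "j < dim_col (\<phi> A * \<phi> B)"
    then have ij: "i < n" "j < n" using c by auto
    have "h (\<Oplus>\<^bsub>F\<^esub>k\<in>{..<n}. A $$ (i, k) \<otimes>\<^bsub>F\<^esub> B $$ (k, j)) = (\<Sum>k<n. h (A $$ (i, k) \<otimes>\<^bsub>F\<^esub> B $$ (k, j)))"
      using d ij by (intro h_finsum) auto
    also have "\<dots> = (\<Sum>k<n. h (A $$ (i, k)) * h (B $$ (k, j)))"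
      using d ij by (intro sum.cong) (auto simp: h_mult)
    finally show "\<phi> (mat_mult_over F n A B) $$ (i, j) = (\<phi> A * \<phi> B) $$ (i, j)"
      using c ij by (simp add: mat_mult_over_def scalar_prod_def lessThan_atLeast0)
  qed (use c in \<open>auto simp: mat_mult_over_def\<close>)
qed

lemma one_over_closed: "mat_one_over F n \<in> mats_over F n" "\<phi> (mat_one_over F n) = 1\<^sub>m n"
  by (auto intro!: mats_overI eq_matI simp: mat_one_over_def h_one h_zero)

lemma det_over_closed:
  assumes "A \<in> mats_over F n"
  shows "det_over F n A \<in> carrier F" "h (det_over F n A) = det (\<phi> A)"
proof -
  note c = mats_overD(1)[OF assms] and d = mats_overD(2)[OF assms]
  have p: "p i < n" if "p permutes {..<n}" "i < n" for p i
    using permutes_in_image[OF that(1), of i] that(2) by simp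
  have fin: "finite {p. p permutes {..<n}}" by (rule finite_permutations) simp
  have prod: "(\<Otimes>\<^bsub>F\<^esub>i\<in>{..<n}. A $$ (i, p i)) \<in> carrier F" if "p permutes {..<n}" for p
    using d p[OF that] by (intro F.finprod_closed) auto
  show "det_over F n A \<in> carrier F"
    unfolding det_over_def using prod by (intro F.finsum_closed) auto
  have "h (det_over F n A) = (\<Sum>p | p permutes {..<n}. signof p * (\<Prod>i<n. h (A $$ (i, p i))))"
    unfolding det_over_def
  proof (subst h_finsum[OF fin], goal_cases)
    case (1 p)
    then show ?case using prod by simp
  next
    case 2
    show ?case
    proof (rule sum.cong)
      fix p assume "p \<in> {p. p permutes {..<n}}"
      then have pp: "p permutes {..<n}" by simp
      have "h (\<Otimes>\<^bsub>F\<^esub>i\<in>{..<n}. A $$ (i, p i)) = (\<Prod>i<n. h (A $$ (i, p i)))"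
        using d p[OF pp] by (intro h_finprod) auto
      then show "h ((if evenperm p then \<one>\<^bsub>F\<^esub> else \<ominus>\<^bsub>F\<^esub> \<one>\<^bsub>F\<^esub>) \<otimes>\<^bsub>F\<^esub> (\<Otimes>\<^bsub>F\<^esub>i\<in>{..<n}. A $$ (i, p i))) =
          signof p * (\<Prod>i<n. h (A $$ (i, p i)))"
        using prod[OF pp] by (subst h_mult) (auto simp: h_one h_minus sign_def)
    qed simp
  qed
  also have "\<dots> = det (\<phi> A)"
    using c p by (subst det_def'[of _ n]) (auto simp: lessThan_atLeast0 intro!: sum.cong prod.cong)
  finally show "h (det_over F n A) = det (\<phi> A)" .
qed

lemma det_over_one_iff: "A \<in> mats_over F n \<Longrightarrow> det_over F n A = \<one>\<^bsub>F\<^esub> \<longleftrightarrow> det (\<phi> A) = 1"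
  using det_over_closed[of A] inj_onD[OF h_inj, of "det_over F n A" "\<one>\<^bsub>F\<^esub>"] h_one by auto

lemma conj_transpose_closed:
  assumes "A \<in> mats_over F n"
  shows "conj_transpose q F A \<in> mats_over F n" "\<phi> (conj_transpose q F A) = star (\<phi> A)"
  using mats_overD[OF assms]
  by (auto intro!: mats_overI eq_matI simp: conj_transpose_def h_pow)

lemma h_frob: "x \<in> carrier F \<Longrightarrow> h x ^ entry_field_order \<epsilon> q = h x"
  using h_image by blast

lemma e_pos_iff: "e > 0 \<longleftrightarrow> \<epsilon> = Plus"
  using q2 by (cases \<epsilon>) (auto simp: e_def)

text \<open>In the linear case invariance under \<open>frob\<close> is automatic, as the entries lie
  in the field of order q; in the unitary case \<open>conj_transpose\<close> becomes
  \<open>star\<close>.\<close>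

lemma carrier_lin_group: "carrier (lin_group \<epsilon> n q F) = {A \<in> mats_over F n. \<phi> A \<in> special_isometries n}"
proof (cases \<epsilon>)
  case Plus
  have "frob (\<phi> A) = \<phi> A" if "A \<in> mats_over F n" for A
    using mats_overD[OF that] h_frob Plus by (intro eq_matI) auto
  then show ?thesis
    using mats_overD(1) e_pos_iff Plus det_over_one_iff
    by (auto simp: lin_group_def SL_def special_isometries_def isometries_def)
next
  case Minus
  have "mat_mult_over F n A (conj_transpose q F A) = mat_one_over F n \<longleftrightarrow> \<phi> A * star (\<phi> A) = 1\<^sub>m n"
    if A: "A \<in> mats_over F n" for A
  proof -
    note c = conj_transpose_closed[OF A]
    show ?thesis
      using mult_over_closed[OF A c(1)] one_over_closed c(2)
        inj_onD[OF \<phi>_inj, of "mat_mult_over F n A (conj_transpose q F A)" "mat_one_over F n"] by auto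
  qed
  then show ?thesis
    using mats_overD(1) e_pos_iff Minus det_over_one_iff
    by (auto simp: lin_group_def SU_def SL_def special_isometries_def isometries_def)
qed

lemma lin_group_ops:
  "A \<otimes>\<^bsub>lin_group \<epsilon> n q F\<^esub> B = mat_mult_over F n A B" "\<one>\<^bsub>lin_group \<epsilon> n q F\<^esub> = mat_one_over F n"
  by (cases \<epsilon>; simp add: lin_group_def SU_def SL_def)+

text \<open>The defining equations force all entries into the image of h: x^q = x in the linear
  case, and x^(q^2) = x by \<open>isometries_entries\<close> in the unitary case.\<close>

lemma special_isometries_image: "special_isometries n \<subseteq> \<phi> ` carrier (lin_group \<epsilon> n q F)"
proof
  fix B assume B: "B \<in> special_isometries n"
  then have Bc: "B \<in> carrier_mat n n" and iso: "B \<in> isometries n"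
    by (auto simp: special_isometries_def isometries_def)
  have im: "B $$ (i, j) \<in> h ` carrier F" if "i < n" "j < n" for i j
  proof (cases \<epsilon>)
    case Plus
    then have "frob B = B" using iso e_pos_iff by (simp add: isometries_def)
    then have "frob B $$ (i, j) = B $$ (i, j)" by simp
    then show ?thesis unfolding h_image using Plus that Bc by simp
  next
    case Minus
    have "elements_mat B \<subseteq> {x. x ^ (q * q) = x}" using iso isometries_entries by blast
    then show ?thesis
      unfolding h_image using Minus elements_matI[OF Bc that refl] by (auto simp: power2_eq_square)
  qed
  define A where "A = map_mat (inv_into (carrier F) h) B"
  have A: "A \<in> mats_over F n"
    using Bc inv_into_into[OF im] by (intro mats_overI) (auto simp: A_def)
  have "\<phi> A = B"
    using Bc f_inv_into_f[OF im] by (intro eq_matI) (auto simp: A_def)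
  then show "B \<in> \<phi> ` carrier (lin_group \<epsilon> n q F)"
    using A B unfolding carrier_lin_group by blast
qed

lemma special_isometries_mult:
  "A \<in> special_isometries n \<Longrightarrow> B \<in> special_isometries n \<Longrightarrow> A * B \<in> special_isometries n"
  using isometries_mult by (auto simp: special_isometries_def isometries_def det_mult[of _ n])

lemma special_isometries_one: "1\<^sub>m n \<in> special_isometries n"
  by (simp add: special_isometries_def isometries_def frob.mat_hom_one)

text \<open>The group laws are pulled back along the injective map \<open>\<phi>\<close> from
  matrices over L.\<close>

lemma group_lin_group: "group (lin_group \<epsilon> n q F)"
proof (rule groupI)
  let ?G = "lin_group \<epsilon> n q F"
  note C = carrier_lin_group
  show one: "\<one>\<^bsub>?G\<^esub> \<in> carrier ?G"
    using one_over_closed special_isometries_one by (simp add: C lin_group_ops)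
  show closed: "A \<otimes>\<^bsub>?G\<^esub> B \<in> carrier ?G" if "A \<in> carrier ?G" "B \<in> carrier ?G" for A B
    using that mult_over_closed special_isometries_mult by (simp add: C lin_group_ops)
  have hom: "\<phi> (A \<otimes>\<^bsub>?G\<^esub> B) = \<phi> A * \<phi> B" if "A \<in> carrier ?G" "B \<in> carrier ?G" for A B
    using that mult_over_closed by (simp add: C lin_group_ops)
  have inj: "A = B" if "\<phi> A = \<phi> B" "A \<in> carrier ?G" "B \<in> carrier ?G" for A B
    using inj_onD[OF \<phi>_inj] that by (simp add: C)
  have car: "\<phi> A \<in> carrier_mat n n" if "A \<in> carrier ?G" for A
    using that mats_overD(1) by (simp add: C)
  show "A \<otimes>\<^bsub>?G\<^esub> B \<otimes>\<^bsub>?G\<^esub> D = A \<otimes>\<^bsub>?G\<^esub> (B \<otimes>\<^bsub>?G\<^esub> D)"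
    if "A \<in> carrier ?G" "B \<in> carrier ?G" "D \<in> carrier ?G" for A B D
    using that closed car by (intro inj) (simp_all add: hom assoc_mult_mat[of _ n n _ n _ n])
  show "\<one>\<^bsub>?G\<^esub> \<otimes>\<^bsub>?G\<^esub> A = A" if "A \<in> carrier ?G" for A
    using that closed one car[OF that] one_over_closed(2)
    by (intro inj) (simp_all add: hom, simp add: lin_group_ops)
  show "\<exists>B\<in>carrier ?G. B \<otimes>\<^bsub>?G\<^esub> A = \<one>\<^bsub>?G\<^esub>" if A: "A \<in> carrier ?G" for A
  proof -
    have iso: "\<phi> A \<in> isometries n" "det (\<phi> A) = 1" using A by (auto simp: C special_isometries_def)
    obtain B where B: "B \<in> isometries n" "\<phi> A * B = 1\<^sub>m n" "B * \<phi> A = 1\<^sub>m n"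
      using isometries_inverse[OF iso(1)] .
    have "det (\<phi> A) * det B = 1"
      using det_mult[OF car[OF A] isometries_carrier[OF B(1)]] B(2) by simp
    then have "B \<in> special_isometries n" using B(1) iso(2) by (simp add: special_isometries_def)
    then obtain B' where B': "B' \<in> carrier ?G" "B = \<phi> B'" using special_isometries_image by blast
    then have "B' \<otimes>\<^bsub>?G\<^esub> A = \<one>\<^bsub>?G\<^esub>"
      using A B closed one one_over_closed(2) by (intro inj) (simp_all add: hom, simp add: lin_group_ops)
    then show ?thesis using B' by blast
  qed
qed

lemma \<phi>_bij: "bij_betw \<phi> (carrier (lin_group \<epsilon> n q F)) (special_isometries n)"
  using special_isometries_image inj_on_subset[OF \<phi>_inj] unfolding bij_betw_def
  by (auto simp: carrier_lin_group)

lemma \<phi>_mult: "A \<in> carrier (lin_group \<epsilon> n q F) \<Longrightarrow> B \<in> carrier (lin_group \<epsilon> n q F) \<Longrightarrow>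
    \<phi> (A \<otimes>\<^bsub>lin_group \<epsilon> n q F\<^esub> B) = \<phi> A * \<phi> B"
  using mult_over_closed by (simp add: carrier_lin_group lin_group_ops)

lemma \<phi>_pow:
  assumes A: "A \<in> carrier (lin_group \<epsilon> n q F)"
  shows "\<phi> (A [^]\<^bsub>lin_group \<epsilon> n q F\<^esub> (r::nat)) = \<phi> A ^\<^sub>m r"
proof (induction r)
  case 0
  have "A \<in> carrier_mat n n" using A mats_overD(1) by (simp add: carrier_lin_group)
  then show ?case using one_over_closed(2) by (simp add: nat_pow_def lin_group_ops)
next
  case (Suc r)
  interpret group "lin_group \<epsilon> n q F" by (rule group_lin_group)
  show ?case using A Suc by (simp add: \<phi>_mult)
qed

lemma power_word_image_ge:
  assumes M: "M > 0" and n: "n \<ge> 2" and large: "q \<ge> 40 * M \<or> n \<ge> (768 * M) ^ 3"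
  shows "ln (real n) / (2 * real n * (real M)\<^sup>2) * real (order (PSL_eps \<epsilon> n q F))
    \<le> real (card (power_word_image M (PSL_eps \<epsilon> n q F)))"
proof -
  let ?G = "lin_group \<epsilon> n q F"
  interpret group ?G by (rule group_lin_group)
  define Y where "Y = {A \<in> carrier ?G. \<phi> A \<in> regular M n}"
  have inj: "inj_on \<phi> (carrier ?G)" and im: "\<phi> ` carrier ?G = special_isometries n"
    using \<phi>_bij by (auto simp: bij_betw_def)
  have fin: "finite (carrier ?G)"
    using finite_special_isometries[of n] finite_imageD[OF _ inj] im by simp
  have ord: "order ?G = card (special_isometries n)"
    using bij_betw_same_card[OF \<phi>_bij] by (simp add: Coset.order_def)
  have "\<phi> ` Y = regular M n"
    using im regular_special by (auto simp: Y_def)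
  then have card_Y: "card Y = card (regular M n)"
    using card_image[OF inj_on_subset[OF inj, of Y]] by (auto simp: Y_def)
  have fibres: "card {y' \<in> Y. y' [^]\<^bsub>?G\<^esub> M = y [^]\<^bsub>?G\<^esub> M \<otimes>\<^bsub>?G\<^esub> z} \<le> M\<^sup>2"
    if y: "y \<in> Y" and z: "z \<in> group_center ?G" for y z
  proof -
    have yc: "y \<in> carrier ?G" "\<phi> y \<in> regular M n" using y by (auto simp: Y_def)
    have zc: "z \<in> carrier ?G" using z group_center_subset[of ?G] by blast
    have comm: "\<phi> z * \<phi> g = \<phi> g * \<phi> z" if "g \<in> carrier ?G" for g
      using group_center_commute[OF z that] \<phi>_mult[OF zc that] \<phi>_mult[OF that zc] by simp
    \<comment> \<open>The centre of the abstract group is used only through the fact that the image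
      of z commutes with the images of all group elements.\<close>
    let ?S = "{w \<in> isometries n. w * \<phi> z = \<phi> z * w \<and> w ^\<^sub>m M = \<phi> y ^\<^sub>m M * \<phi> z}"
    have "card {y' \<in> Y. y' [^]\<^bsub>?G\<^esub> M = y [^]\<^bsub>?G\<^esub> M \<otimes>\<^bsub>?G\<^esub> z} \<le> card ?S"
    proof (rule card_inj_on_le[of \<phi>])
      show "inj_on \<phi> {y' \<in> Y. y' [^]\<^bsub>?G\<^esub> M = y [^]\<^bsub>?G\<^esub> M \<otimes>\<^bsub>?G\<^esub> z}"
        by (rule inj_on_subset[OF inj]) (auto simp: Y_def)
      show "finite ?S" using finite_isometries[of n] by simp
      show "\<phi> ` {y' \<in> Y. y' [^]\<^bsub>?G\<^esub> M = y [^]\<^bsub>?G\<^esub> M \<otimes>\<^bsub>?G\<^esub> z} \<subseteq> ?S"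
      proof
        fix w assume "w \<in> \<phi> ` {y' \<in> Y. y' [^]\<^bsub>?G\<^esub> M = y [^]\<^bsub>?G\<^esub> M \<otimes>\<^bsub>?G\<^esub> z}"
        then obtain y' where y': "w = \<phi> y'" "y' \<in> carrier ?G" "y' [^]\<^bsub>?G\<^esub> M = y [^]\<^bsub>?G\<^esub> M \<otimes>\<^bsub>?G\<^esub> z"
          by (auto simp: Y_def)
        have "\<phi> y' ^\<^sub>m M = \<phi> y ^\<^sub>m M * \<phi> z"
          using arg_cong[OF y'(3), of \<phi>] y'(2) yc(1) zc by (simp add: \<phi>_pow \<phi>_mult)
        moreover have "\<phi> y' \<in> isometries n"
          using y'(2) by (simp add: carrier_lin_group special_isometries_def)
        ultimately show "w \<in> ?S" using y' comm[of y'] by simp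
      qed
    qed
    also have "\<dots> \<le> M\<^sup>2"
      using zc comm[OF yc(1)] yc(2)
      by (intro card_roots_regular[OF M]) (auto simp: carrier_lin_group special_isometries_def)
    finally show ?thesis .
  qed
  note Q = card_power_word_image_quotient[OF fin _ fibres, folded PSL_eps_eq]
  define z where "z = real (card (group_center ?G))"
  define I where "I = real (card (power_word_image M (PSL_eps \<epsilon> n q F)))"
  define O' where "O' = real (order (PSL_eps \<epsilon> n q F))"
  have "\<one>\<^bsub>?G\<^esub> \<in> group_center ?G" by (simp add: group_center_def)
  then have z: "z > 0"
    unfolding z_def using finite_subset[OF group_center_subset fin] by (auto simp: card_gt_0_iff)
  have "card Y \<le> card (power_word_image M (PSL_eps \<epsilon> n q F)) * (card (group_center ?G) * M\<^sup>2)"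
    by (rule Q(1)) (auto simp: Y_def)
  then have 1: "real (card Y) \<le> I * (z * (real M)\<^sup>2)"
    unfolding I_def z_def by (metis of_nat_mono of_nat_mult of_nat_power)
  have "order (PSL_eps \<epsilon> n q F) * card (group_center ?G) = order ?G"
    by (rule Q(2)) (auto simp: Y_def)
  then have 2: "O' * z = real (card (special_isometries n))"
    unfolding O'_def z_def ord[symmetric] by (metis of_nat_mult)
  have "real (card (special_isometries n)) * (ln (real n) / (2 * real n)) \<le> real (card (regular M n))"
    using mult_left_mono[OF good_sum_ge[OF M n large], of "real (card (special_isometries n))"]
      card_regular_ge[of n M] by simp
  then have "O' * z * (ln (real n) / (2 * real n)) \<le> I * (z * (real M)\<^sup>2)"
    using 1 2 card_Y by simp
  then have "z * (O' * (ln (real n) / (2 * real n))) \<le> z * (I * (real M)\<^sup>2)" by (simp add: mult_ac)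
  then have "O' * (ln (real n) / (2 * real n)) \<le> I * (real M)\<^sup>2" by (rule mult_left_le_imp_le[OF _ z])
  then have "O' * (ln (real n) / (2 * real n)) / (real M)\<^sup>2 \<le> I" using M by (simp only: pos_divide_le_eq zero_less_power of_nat_0_less_iff)
  then show ?thesis unfolding O'_def I_def by (simp add: field_simps)
qed

end

section \<open>Passing to a field that is a type\<close>

text \<open>All parameters are bound here so that this is a property of the field alone; a single
  choice of a field can then serve all of them.\<close>

definition many_powers :: "nat ring \<Rightarrow> bool" where
  "many_powers F \<longleftrightarrow> (\<forall>M \<epsilon> n q. M > 1 \<longrightarrow> n \<ge> 2 \<longrightarrow> primepow q \<longrightarrow>
     is_GF (entry_field_order \<epsilon> q) F \<longrightarrow> q \<ge> 40 * M \<or> n \<ge> (768 * M) ^ 3 \<longrightarrow>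
     real (card (power_word_image M (PSL_eps \<epsilon> n q F))) \<ge>
       ln (real n) / (2 * real n * (real M)\<^sup>2) * real (order (PSL_eps \<epsilon> n q F)))"

text \<open>
  Type classes, and with them the algebraic closure, need a field that is a type, whereas the theorem
  quantifies over structures. One fixed structure can be made a type, so we choose a counterexample if
  there is one: the theorem for this single field implies it for all.
\<close>

definition critical_field :: "nat ring" where
  "critical_field = (SOME F. field F \<and> finite (carrier F) \<and>
     (many_powers F \<longrightarrow> (\<forall>F'. field F' \<longrightarrow> finite (carrier F') \<longrightarrow> many_powers F')))"

lemma critical_field:
  "field critical_field" "finite (carrier critical_field)"
  "many_powers critical_field \<Longrightarrow> field F' \<Longrightarrow> finite (carrier F') \<Longrightarrow> many_powers F'"
proof -
  have "\<exists>F::nat ring. field F \<and> finite (carrier F) \<and>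
     (many_powers F \<longrightarrow> (\<forall>F'. field F' \<longrightarrow> finite (carrier F') \<longrightarrow> many_powers F'))"
  proof (cases "\<forall>F'. field F' \<longrightarrow> finite (carrier F') \<longrightarrow> many_powers F'")
    case True
    \<comment> \<open>Without a counterexample any finite field will do; the integers modulo 2,
      copied to the naturals, provide one.\<close>
    interpret residues_prime 2 "residue_ring (int 2)"
      by unfold_locales auto
    have "card (carrier (residue_ring (int 2))) = 2"
      by (simp add: residue_ring_def)
    then have "is_GF 2 (residue_ring (int 2))"
      using is_field by (simp add: is_GF_def)
    from is_GF_nat_model[OF this] obtain K :: "nat ring" where "is_GF 2 K" by auto
    then show ?thesis
      using True card_ge_0_finite[of "carrier K"] unfolding is_GF_def by fastforce
  qed blast
  from someI_ex[OF this, folded critical_field_def]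
  show "field critical_field" "finite (carrier critical_field)"
    "many_powers critical_field \<Longrightarrow> field F' \<Longrightarrow> finite (carrier F') \<Longrightarrow> many_powers F'"
    by blast+
qed

typedef critical = "carrier critical_field"
  using ring.ring_simprules(6)[OF field.is_ring[OF critical_field(1)]] by blast

interpretation critical: cring critical_field
  by (rule fieldE(1)[OF critical_field(1)])

lemma critical_Units: "Units critical_field = carrier critical_field - {\<zero>\<^bsub>critical_field\<^esub>}"
  by (rule field.field_Units[OF critical_field(1)])

setup_lifting type_definition_critical

instantiation critical :: Fields.field
begin

lift_definition zero_critical :: critical is "\<zero>\<^bsub>critical_field\<^esub>" by simp
lift_definition one_critical :: critical is "\<one>\<^bsub>critical_field\<^esub>" by simp
lift_definition plus_critical :: "critical \<Rightarrow> critical \<Rightarrow> critical"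
  is "(\<oplus>\<^bsub>critical_field\<^esub>)" by simp
lift_definition times_critical :: "critical \<Rightarrow> critical \<Rightarrow> critical"
  is "(\<otimes>\<^bsub>critical_field\<^esub>)" by simp
lift_definition uminus_critical :: "critical \<Rightarrow> critical"
  is "\<lambda>x. \<ominus>\<^bsub>critical_field\<^esub> x" by simp
lift_definition minus_critical :: "critical \<Rightarrow> critical \<Rightarrow> critical"
  is "\<lambda>x y. x \<ominus>\<^bsub>critical_field\<^esub> y" by simp
text \<open>The class of fields demands that the inverse of 0 is 0, while \<open>inv\<close> is
  meaningful only on units.\<close>

lift_definition inverse_critical :: "critical \<Rightarrow> critical"
  is "\<lambda>x. if x = \<zero>\<^bsub>critical_field\<^esub> then x else inv\<^bsub>critical_field\<^esub> x"
  using critical_Units by auto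
definition divide_critical :: "critical \<Rightarrow> critical \<Rightarrow> critical" where
  "divide_critical x y = x * inverse y"

instance
proof
  fix x y z :: critical
  show "x * y * z = x * (y * z)" by transfer (rule critical.m_assoc)
  show "x * y = y * x" by transfer (rule critical.m_comm)
  show "1 * x = x" by transfer simp
  show "x + y + z = x + (y + z)" by transfer (rule critical.a_assoc)
  show "x + y = y + x" by transfer (rule critical.a_comm)
  show "0 + x = x" by transfer simp
  show "- x + x = 0" by transfer (rule critical.l_neg)
  show "x - y = x + - y" by transfer (simp add: a_minus_def)
  show "(x + y) * z = x * z + y * z" by transfer (rule critical.l_distr)
  show "(0 :: critical) \<noteq> 1" by transfer (use fieldE(2)[OF critical_field(1)] in auto)
  show "x \<noteq> 0 \<Longrightarrow> inverse x * x = 1"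
    by transfer (use critical_Units in \<open>auto intro: critical.Units_l_inv\<close>)
  show "x div y = x * inverse y" by (rule divide_critical_def)
  show "inverse (0 :: critical) = 0" by transfer simp
qed

end

text \<open>Translation by 1 permutes the field, so it does not change the sum of all
  elements.\<close>

lemma of_nat_card_UNIV_eq_0: "finite (UNIV :: 'a::field set) \<Longrightarrow> (of_nat (card (UNIV :: 'a set)) :: 'a) = 0"
proof -
  assume fin: "finite (UNIV :: 'a set)"
  have "(\<Sum>x\<in>(UNIV :: 'a set). x) = (\<Sum>x\<in>UNIV. x + 1)"
    by (rule sum.reindex_bij_witness[of _ "\<lambda>x. x + 1" "\<lambda>x. x - 1"]) auto
  also have "\<dots> = (\<Sum>x\<in>UNIV. x) + of_nat (card (UNIV :: 'a set))" by (simp add: sum.distrib)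
  finally show ?thesis by simp
qed

text \<open>Multiplication by a nonzero x permutes the nonzero elements, so it does not change their
  product.\<close>

lemma power_card_UNIV:
  fixes x :: "'a::field"
  assumes fin: "finite (UNIV :: 'a set)"
  shows "x ^ card (UNIV :: 'a set) = x"
proof (cases "x = 0")
  case True
  then show ?thesis using fin by (simp add: card_gt_0_iff zero_power)
next
  case False
  let ?U = "UNIV - {0 :: 'a}"
  have "(\<Prod>y\<in>?U. y) = (\<Prod>y\<in>?U. x * y)"
    by (rule prod.reindex_bij_witness[of _ "\<lambda>y. x * y" "\<lambda>y. y / x"]) (use False in auto)
  also have "\<dots> = x ^ card ?U * (\<Prod>y\<in>?U. y)" by (simp add: prod.distrib)
  finally have "x ^ card ?U = 1" using fin by simp
  moreover have "card (UNIV :: 'a set) = Suc (card ?U)" by (rule card_Suc_Diff1[OF fin, symmetric]) simp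
  ultimately show ?thesis by (simp only: power_Suc mult_1_right)
qed

lemma card_power_eq_self_le:
  assumes "Q \<ge> 2"
  shows "finite {x::'a::field. x ^ Q = x}" "card {x::'a::field. x ^ Q = x} \<le> Q"
proof -
  have sub: "{x::'a. x ^ Q = x} \<subseteq> insert 0 {x. x ^ (Q - 1) = 1}"
  proof
    fix x :: 'a assume x: "x \<in> {x. x ^ Q = x}"
    have "x ^ Q = x ^ (Q - 1) * x" using assms by (intro power_minus_mult[symmetric]) simp
    then show "x \<in> insert 0 {x. x ^ (Q - 1) = 1}" using x by auto
  qed
  have fin: "finite {x::'a. x ^ (Q - 1) = 1}" "card {x::'a. x ^ (Q - 1) = 1} \<le> Q - 1"
    using assms by (intro card_power_eq_le; simp)+
  show "finite {x::'a. x ^ Q = x}" using sub fin(1) by (metis finite_insert finite_subset)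
  have "card {x::'a. x ^ Q = x} \<le> card (insert 0 {x::'a. x ^ (Q - 1) = 1})"
    using fin(1) by (intro card_mono sub) simp
  also have "\<dots> \<le> Suc (card {x::'a. x ^ (Q - 1) = 1})" using fin(1) by (simp add: card_insert_if)
  also have "\<dots> \<le> Q" using fin(2) assms by simp
  finally show "card {x::'a. x ^ Q = x} \<le> Q" .
qed

lemma critical_card: "finite (UNIV :: critical set)" "card (UNIV :: critical set) = card (carrier critical_field)"
proof -
  have inj: "inj Rep_critical" by (auto simp: inj_on_def Rep_critical_inject)
  have range: "range Rep_critical = carrier critical_field"
    by (rule type_definition.Rep_range[OF type_definition_critical])
  show "finite (UNIV :: critical set)" using finite_imageD[OF _ inj] critical_field(2) range by simp
  show "card (UNIV :: critical set) = card (carrier critical_field)"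
    using card_image[OF inj] range by simp
qed

definition embed :: "nat \<Rightarrow> critical alg_closure" where "embed x = to_ac (Abs_critical x)"

lemma many_powers_critical: "many_powers critical_field"
  unfolding many_powers_def
proof (intro allI impI)
  fix M \<epsilon> n q
  assume M: "M > 1" and n: "n \<ge> 2" and q: "primepow q" and GF: "is_GF (entry_field_order \<epsilon> q) critical_field"
    and large: "q \<ge> 40 * M \<or> n \<ge> (768 * M) ^ 3"
  define Q where "Q = entry_field_order \<epsilon> q"
  define e where "e = (case \<epsilon> of Plus \<Rightarrow> int q | Minus \<Rightarrow> - int q)"
  have cardQ: "card (UNIV :: critical set) = Q" using GF critical_card by (simp add: is_GF_def Q_def)
  obtain p k where p: "Factorial_Ring.prime p" "k > 0" "q = p ^ k" using q by (auto simp: primepow_def)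
  have q2: "q \<ge> 2" using p prime_ge_2_nat[of p] self_le_power[of p k] by auto
  have Qp: "\<exists>j. Q = p ^ j" by (cases \<epsilon>) (auto simp: Q_def p power_mult[symmetric])
  have "q ^ 1 \<le> q ^ 2" using q2 by (intro power_increasing) auto
  then have Q2: "Q \<ge> 2" using q2 by (cases \<epsilon>) (auto simp: Q_def)
  have "(of_nat Q :: critical alg_closure) = to_ac (of_nat Q)" by simp
  also have "\<dots> = 0" using of_nat_card_UNIV_eq_0[OF critical_card(1)] cardQ by (simp del: to_ac_of_nat)
  finally have dvd: "CHAR(critical alg_closure) dvd Q" by (simp add: of_nat_eq_0_iff_char_dvd)
  then have "CHAR(critical alg_closure) > 0" using Q2 by (intro Nat.gr0I) auto
  then have pr: "Factorial_Ring.prime CHAR(critical alg_closure)" by (rule prime_CHAR_semidom)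
  then have char: "CHAR(critical alg_closure) = p"
    using dvd Qp p(1) prime_dvd_power primes_dvd_imp_eq by metis
  have "CHAR(critical alg_closure) dvd q" using char p by (simp add: dvd_power)
  then have q0: "(of_nat q :: critical alg_closure) = 0" by (simp add: of_nat_eq_0_iff_char_dvd)
  have add_q: "(x + y) ^ q = x ^ q + y ^ q" for x y :: "critical alg_closure"
    by (rule freshmans_dream'[OF pr, of q k]) (simp only: char p(3))
  have embed_image: "embed ` carrier critical_field = range to_ac"
  proof -
    have "embed ` carrier critical_field = to_ac ` Abs_critical ` carrier critical_field"
      by (simp add: image_image embed_def)
    then show ?thesis by (simp only: type_definition.Abs_image[OF type_definition_critical])
  qed
  have inj: "inj (to_ac :: critical \<Rightarrow> _)" by (rule injI) simp
  \<comment> \<open>The field has Q elements, all of them roots of X^Q - X, which has at most Q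
    roots in the algebraic closure.\<close>
  have image: "range (to_ac :: critical \<Rightarrow> _) = {x. x ^ Q = x}"
  proof (rule card_seteq)
    show "finite {x :: critical alg_closure. x ^ Q = x}" by (rule card_power_eq_self_le[OF Q2])
    show "range (to_ac :: critical \<Rightarrow> _) \<subseteq> {x. x ^ Q = x}"
      using power_card_UNIV[OF critical_card(1)] unfolding cardQ by (auto simp flip: to_ac_power)
    show "card {x :: critical alg_closure. x ^ Q = x} \<le> card (range (to_ac :: critical \<Rightarrow> _))"
      using card_power_eq_self_le(2)[OF Q2] by (simp add: card_image[OF inj] cardQ)
  qed
  interpret embedded_group q e "TYPE(critical alg_closure)" critical_field embed \<epsilon> n
  proof
    show "q \<ge> 2" by (rule q2)
    show "e = int q \<or> e = - int q" by (cases \<epsilon>) (auto simp: e_def)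
    show "e = (case \<epsilon> of Plus \<Rightarrow> int q | Minus \<Rightarrow> - int q)" by (rule e_def)
    show "embed ` carrier critical_field = {x. x ^ entry_field_order \<epsilon> q = x}"
      using embed_image image by (simp add: Q_def)
    show "embed \<one>\<^bsub>critical_field\<^esub> = 1" by (simp add: embed_def one_critical.abs_eq[symmetric] flip: one_critical_def)
    show "inj_on embed (carrier critical_field)"
      using inj by (auto simp: inj_on_def embed_def Abs_critical_inject)
  next
    fix x y assume "x \<in> carrier critical_field" "y \<in> carrier critical_field"
    then show "embed (x \<oplus>\<^bsub>critical_field\<^esub> y) = embed x + embed y"
      "embed (x \<otimes>\<^bsub>critical_field\<^esub> y) = embed x * embed y"
      unfolding embed_def to_ac_add[symmetric] to_ac_mult[symmetric]
      by (simp_all add: plus_critical_def times_critical_def Abs_critical_inverse)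
  qed (auto simp: q0 add_q)
  show "ln (real n) / (2 * real n * (real M)\<^sup>2) * real (order (PSL_eps \<epsilon> n q critical_field))
      \<le> real (card (power_word_image M (PSL_eps \<epsilon> n q critical_field)))"
    using M by (intro power_word_image_ge n large) simp
qed

lemma order_PSL_eps_le:
  fixes F :: "nat ring"
  assumes "is_GF Q F" "Q > 0"
  shows "order (PSL_eps \<epsilon> n q F) \<le> Q ^ (n * n)"
proof -
  let ?G = "lin_group \<epsilon> n q F"
  have fin: "finite (carrier F)" and Q: "card (carrier F) = Q"
    using assms by (auto simp: is_GF_def card_ge_0_finite)
  have sub: "carrier ?G \<subseteq> {A \<in> carrier_mat n n. elements_mat A \<subseteq> carrier F}"
    by (cases \<epsilon>) (auto simp: lin_group_def SL_def SU_def mats_over_def)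
  note fm = card_mats_le[OF fin, of n]
  have "carrier (PSL_eps \<epsilon> n q F) = (\<lambda>a. group_center ?G #>\<^bsub>?G\<^esub> a) ` carrier ?G"
    unfolding PSL_eps_eq by (auto simp: FactGroup_def RCOSETS_def)
  then have "order (PSL_eps \<epsilon> n q F) \<le> card (carrier ?G)"
    unfolding Coset.order_def using card_image_le[OF finite_subset[OF sub fm(1)]] by simp
  also have "\<dots> \<le> Q ^ (n * n)"
    using card_mono[OF fm(1) sub] fm(2) Q by simp
  finally show ?thesis .
qed

theorem theorem1p4:
  fixes M :: nat
  assumes "M > 1"
  shows "\<exists>N::real. N > 0 \<and>
    (\<forall>(\<epsilon>::lin_type) (n::nat) (q::nat) (F::nat ring).
       n \<ge> 2 \<longrightarrow> primepow q \<longrightarrow> is_GF (entry_field_order \<epsilon> q) F \<longrightarrow>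
       (let G = PSL_eps \<epsilon> n q F in
          real (order G) \<ge> N \<longrightarrow>
          real (card (power_word_image M G)) \<ge>
            ln (real n) / (2 * real n * (real M)\<^sup>2) * real (order G)))"
proof -
  define b where "b = 40 * M"
  define c where "c = (768 * M) ^ 3"
  \<comment> \<open>If q < b and n < c, there are at most (q^2)^(n^2) matrices over the entry field,
    which is less than this number.\<close>
  define N where "N = b ^ (2 * (c * c))"
  have b: "b > 1" using assms by (simp add: b_def)
  show ?thesis
  proof (intro exI[of _ "real N"] conjI allI impI)
    show "real N > 0" using b by (simp add: N_def)
    fix \<epsilon> :: lin_type and n q :: nat and F :: "nat ring"
    assume n: "n \<ge> 2" and q: "primepow q" and GF: "is_GF (entry_field_order \<epsilon> q) F"
    have q0: "q > 1" using primepow_gt_Suc_0[OF q] by simp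
    have Q0: "entry_field_order \<epsilon> q > 0" using q0 by (cases \<epsilon>) auto
    have F: "field F" "finite (carrier F)"
      using GF Q0 by (auto simp: is_GF_def card_ge_0_finite)
    show "let G = PSL_eps \<epsilon> n q F in
          real (order G) \<ge> real N \<longrightarrow>
          real (card (power_word_image M G)) \<ge>
            ln (real n) / (2 * real n * (real M)\<^sup>2) * real (order G)"
      unfolding Let_def
    proof
      assume "real (order (PSL_eps \<epsilon> n q F)) \<ge> real N"
      then have ge: "N \<le> order (PSL_eps \<epsilon> n q F)" by simp
      have "q \<ge> b \<or> n \<ge> c"
      proof (rule ccontr)
        assume "\<not> (q \<ge> b \<or> n \<ge> c)"
        then have lt: "q < b" "n < c" by auto
        have "N \<le> entry_field_order \<epsilon> q ^ (n * n)"
          using ge order_PSL_eps_le[OF GF Q0] by (rule order.trans)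
        also have "\<dots> \<le> (q\<^sup>2) ^ (n * n)"
          using q0 by (intro power_mono) (cases \<epsilon>; simp add: power2_eq_square)+
        also have "\<dots> = q ^ (2 * (n * n))" by (rule power_mult[symmetric])
        also have "\<dots> \<le> b ^ (2 * (n * n))" using lt by (intro power_mono) auto
        also have "\<dots> < b ^ (2 * (c * c))"
          using b lt mult_strict_mono[of n c n c] by (intro power_strict_increasing) auto
        finally show False by (simp add: N_def)
      qed
      moreover have "many_powers F" using critical_field(3)[OF many_powers_critical F] .
      ultimately show "real (card (power_word_image M (PSL_eps \<epsilon> n q F))) \<ge>
            ln (real n) / (2 * real n * (real M)\<^sup>2) * real (order (PSL_eps \<epsilon> n q F))"
        using assms n q GF unfolding many_powers_def b_def c_def by blast
    qed
  qed
qed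

end
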